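(* Let $A,B\in\mathcal{S}'(S)$ with $A\cup B$ filling $S$, let $\mathcal{G}=\mathcal{G}(A\cup B)$ have small type, with $K$ vertices, and suppose that $A$ and $B$ can be oriented so that all intersections of $A$ with $B$ are positive. Then there exists a homomorphism (linear map) $$\eta\colon\mathbb{R}^K\to H_1(S;\mathbb{R})$$ such that $$(T_AT_B)_*\circ\eta=-\eta\circ\Theta(\sigma_A\sigma_B).$$ Moreover, $\Theta(\sigma_A\sigma_B)|_{\ker(\eta)}=-I$ and $\eta$ preserves spectral radii, i.e. $\Theta(\sigma_A\sigma_B)$ and $(T_AT_B)_*$ (acting on $H_1(S;\mathbb{R})$) have the same spectral radius.
   Context: $S$ is a compact connected oriented surface with finitely many marked points (not a sphere with at most three marked points). $\mathcal{S}'(S)$: isotopy classes of closed embedded $1$-manifolds in $S$ minus marked points, all of whose components are homotopically essential and not isotopic to a puncture (parallel components allowed). Representatives are in transverse minimal position. $A\cup B$ fills $S$ if every essential simple closed curve has nonzero geometric intersection number with a component of $A$ or $B$. $T_A\in\mathrm{Mod}(S)$ is the product of positive Dehn twists about the components of $A$; $(T_AT_B)_*$ is the induced map on $H_1(S;\mathbb{R})$. $\mathcal{G}(A\cup B)$ has one vertex per component of $A$ and $B$ and one edge per intersection point; small type means no multiple edges. For $\mathcal{G}$ of small type with vertices $s_1,\dots,s_K$, the Coxeter group $\mathfrak{C}(\mathcal{G})$ is generated by $s_1,\dots,s_K$ with relations $s_i^2=1$, $(s_is_j)^3=1$ for adjacent vertices, $(s_is_j)^2=1$ for distinct non-adjacent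 vertices. $\sigma_A$ (respectively $\sigma_B$) is the product of the generators corresponding to components of $A$ (respectively $B$). $\Theta$ is the geometric representation of $\mathfrak{C}(\mathcal{G})$ on $\mathbb{R}^K$ preserving the form $\Pi_{\mathcal{G}}$ with matrix $2I-\mathcal{A}d(\mathcal{G})$ ($\mathcal{A}d(\mathcal{G})$ the adjacency matrix): $s_i$ acts by $x\mapsto x-\Pi_{\mathcal{G}}(e_i,x)e_i$. The spectral radius of a linear map is the maximum of the moduli of its eigenvalues. *)

theory Defs
  imports
    "HOL-Analysis.Analysis"
    "HOL-Complex_Analysis.Winding_Numbers"
    "HOL-Homology.Simplices"
    "HOL-Algebra.Group"
begin

section \<open>First homology with real coefficients\<close>

instantiation poly_mapping :: (type, real_vector) real_vector
begin

lift_definition scaleR_poly_mapping :: "real \<Rightarrow> ('a \<Rightarrow>\<^sub>0 'b) \<Rightarrow> 'a \<Rightarrow>\<^sub>0 'b"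
  is "\<lambda>r c x. r *\<^sub>R c x"
  by (auto elim: rev_finite_subset)

instance
  by standard (transfer; auto simp: fun_eq_iff scaleR_add_left scaleR_add_right)+

end

type_synonym 'a real_chain = "((nat \<Rightarrow> real) \<Rightarrow> 'a) \<Rightarrow>\<^sub>0 real"

definition linear_extension :: "('b \<Rightarrow> 'v::real_vector) \<Rightarrow> ('b \<Rightarrow>\<^sub>0 real) \<Rightarrow> 'v"
  where "linear_extension f c =
    (\<Sum>x\<in>Poly_Mapping.keys c. Poly_Mapping.lookup c x *\<^sub>R f x)"

definition real_boundary :: "nat \<Rightarrow> 'a real_chain \<Rightarrow> 'a real_chain"
  where "real_boundary p =
    linear_extension (\<lambda>\<sigma>. \<Sum>k\<le>p. (-1) ^ k *\<^sub>R Poly_Mapping.single (singular_face p k \<sigma>) 1)"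

definition real_chain_map :: "nat \<Rightarrow> ('a \<Rightarrow> 'b) \<Rightarrow> 'a real_chain \<Rightarrow> 'b real_chain"
  where "real_chain_map p f =
    linear_extension (\<lambda>\<sigma>. Poly_Mapping.single (simplex_map p f \<sigma>) 1)"

definition real_chains :: "nat \<Rightarrow> 'a::topological_space real_chain set"
  where "real_chains p = {c. Poly_Mapping.keys c \<subseteq> singular_simplex_set p euclidean}"

definition real_cycles1 :: "'a::topological_space real_chain set"
  where "real_cycles1 = {c \<in> real_chains 1. real_boundary 1 c = 0}"

definition real_boundaries1 :: "'a::topological_space real_chain set"
  where "real_boundaries1 = real_boundary 2 ` real_chains 2"

definition real_homologous :: "'a::topological_space real_chain \<Rightarrow> 'a real_chain \<Rightarrow> bool"
  where "real_homologous c d \<longleftrightarrow>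
    c \<in> real_cycles1 \<and> d \<in> real_cycles1 \<and> c - d \<in> real_boundaries1"

lemma linear_extension_eq:
  assumes "finite S" "Poly_Mapping.keys c \<subseteq> S"
  shows "linear_extension f c = (\<Sum>x\<in>S. Poly_Mapping.lookup c x *\<^sub>R f x)"
  unfolding linear_extension_def
  by (rule sum.mono_neutral_left) (use assms in \<open>auto simp: in_keys_iff\<close>)

lemma lookup_scaleR [simp]:
  "Poly_Mapping.lookup (r *\<^sub>R c) x = r *\<^sub>R Poly_Mapping.lookup c x"
  by transfer simp

lemma keys_scaleR_subset: "Poly_Mapping.keys (r *\<^sub>R c) \<subseteq> Poly_Mapping.keys c"
  by (auto simp: in_keys_iff)

lemma linear_linear_extension: "linear (linear_extension f)"
proof (rule linearI)
  fix c d :: "'a \<Rightarrow>\<^sub>0 real" and r :: real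
  let ?S = "Poly_Mapping.keys c \<union> Poly_Mapping.keys d"
  have "linear_extension f (c + d) = (\<Sum>x\<in>?S. Poly_Mapping.lookup (c + d) x *\<^sub>R f x)"
    by (rule linear_extension_eq) (simp, rule keys_add)
  also have "\<dots> = (\<Sum>x\<in>?S. Poly_Mapping.lookup c x *\<^sub>R f x)
      + (\<Sum>x\<in>?S. Poly_Mapping.lookup d x *\<^sub>R f x)"
    by (simp add: lookup_add scaleR_add_left sum.distrib)
  also have "\<dots> = linear_extension f c + linear_extension f d"
    by (simp only: linear_extension_eq[of ?S c] linear_extension_eq[of ?S d]
        finite_UnI finite_keys sup_ge1 sup_ge2)
  finally show "linear_extension f (c + d) = linear_extension f c + linear_extension f d" .
  have "linear_extension f (r *\<^sub>R c)
      = (\<Sum>x\<in>Poly_Mapping.keys c. Poly_Mapping.lookup (r *\<^sub>R c) x *\<^sub>R f x)"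
    by (rule linear_extension_eq[OF finite_keys keys_scaleR_subset])
  then show "linear_extension f (r *\<^sub>R c) = r *\<^sub>R linear_extension f c"
    by (simp add: linear_extension_def scaleR_sum_right)
qed

lemma linear_extension_single [simp]:
  "linear_extension f (Poly_Mapping.single x r) = r *\<^sub>R f x"
  by (cases "r = 0") (auto simp: linear_extension_def)

lemma linear_real_boundary: "linear (real_boundary p)"
  by (simp add: real_boundary_def linear_linear_extension)

lemma linear_real_chain_map: "linear (real_chain_map p f)"
  by (simp add: real_chain_map_def linear_linear_extension)

lemma subspace_real_chains: "subspace (real_chains p)"
proof (rule subspaceI)
  fix c d :: "'a real_chain" and r :: real
  assume c: "c \<in> real_chains p" and d: "d \<in> real_chains p"
  show "c + d \<in> real_chains p"
    using c d keys_add[of c d] by (auto simp: real_chains_def)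
next
  fix c :: "'a real_chain" and r :: real
  assume "c \<in> real_chains p"
  then show "r *\<^sub>R c \<in> real_chains p"
    using keys_scaleR_subset[of r c] by (auto simp: real_chains_def)
qed (simp add: real_chains_def)

lemma subspace_real_cycles1: "subspace real_cycles1"
  using subspace_real_chains[of 1]
  by (auto simp: subspace_def real_cycles1_def linear_0[OF linear_real_boundary]
      linear_add[OF linear_real_boundary] linear_scale[OF linear_real_boundary])

lemma subspace_real_boundaries1: "subspace real_boundaries1"
  unfolding real_boundaries1_def
  by (rule linear_subspace_image[OF linear_real_boundary subspace_real_chains])

lemma real_homologous_refl: "c \<in> real_cycles1 \<Longrightarrow> real_homologous c c"
  by (simp add: real_homologous_def subspace_0[OF subspace_real_boundaries1])

lemma real_homologous_add:
  assumes "real_homologous a b" "real_homologous c d"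
  shows "real_homologous (a + c) (b + d)"
  using assms subspace_add[OF subspace_real_boundaries1, of "a - b" "c - d"]
  by (simp add: real_homologous_def subspace_add[OF subspace_real_cycles1] add_diff_add)

lemma real_homologous_scale:
  assumes "real_homologous a b"
  shows "real_homologous (r *\<^sub>R a) (r *\<^sub>R b)"
  using assms subspace_scale[OF subspace_real_boundaries1, of "a - b" r]
  by (simp add: real_homologous_def subspace_scale[OF subspace_real_cycles1]
      scaleR_diff_right)

lemma real_homologous_neg: "real_homologous a b \<Longrightarrow> real_homologous (- a) (- b)"
  using real_homologous_scale[of a b "- 1"] by simp

lemma real_homologous_diff:
  "real_homologous a b \<Longrightarrow> real_homologous c d \<Longrightarrow> real_homologous (a - c) (b - d)"
  using real_homologous_add[OF _ real_homologous_neg, of a b c d] by simp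

lemma part_equivp_real_homologous: "part_equivp real_homologous"
proof (rule part_equivpI)
  note Z = subspace_real_cycles1 and B = subspace_real_boundaries1
  have "real_homologous 0 (0 :: 'a real_chain)"
    by (rule real_homologous_refl) (rule subspace_0[OF Z])
  then show "\<exists>c::'a real_chain. real_homologous c c" ..
  show "symp (real_homologous :: 'a real_chain \<Rightarrow> _)"
  proof (rule sympI)
    fix c d :: "'a real_chain"
    assume "real_homologous c d"
    then show "real_homologous d c"
      using subspace_neg[OF B, of "c - d"] by (simp add: real_homologous_def)
  qed
  show "transp (real_homologous :: 'a real_chain \<Rightarrow> _)"
  proof (rule transpI)
    fix c d e :: "'a real_chain"
    assume "real_homologous c d" "real_homologous d e"
    then show "real_homologous c e"
      using subspace_add[OF B, of "c - d" "d - e"] by (simp add: real_homologous_def)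
  qed
qed

text \<open>The space $H_1(X;\mathbf{R})$, for $X$ the whole type \<open>'a\<close>.\<close>

quotient_type (overloaded) 'a real_H1 =
  "'a::topological_space real_chain" / partial: real_homologous
  by (rule part_equivp_real_homologous)

instantiation real_H1 :: (topological_space) real_vector
begin

lift_definition zero_real_H1 :: "'a real_H1" is 0
  by (rule real_homologous_refl) (rule subspace_0[OF subspace_real_cycles1])

lift_definition plus_real_H1 :: "'a real_H1 \<Rightarrow> 'a real_H1 \<Rightarrow> 'a real_H1" is "(+)"
  by (rule real_homologous_add)

lift_definition uminus_real_H1 :: "'a real_H1 \<Rightarrow> 'a real_H1" is uminus
  by (rule real_homologous_neg)

lift_definition minus_real_H1 :: "'a real_H1 \<Rightarrow> 'a real_H1 \<Rightarrow> 'a real_H1" is "(-)"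
  by (rule real_homologous_diff)

lift_definition scaleR_real_H1 :: "real \<Rightarrow> 'a real_H1 \<Rightarrow> 'a real_H1" is "(*\<^sub>R)"
  by (rule real_homologous_scale)

instance
proof
  fix a b c :: "'a real_H1" and r s :: real
  show "a + b + c = a + (b + c)"
    by transfer (simp only: add.assoc, intro real_homologous_add)
  show "a + b = b + a"
    by transfer (subst add.commute, rule real_homologous_add)
  show "0 + a = a"
    by transfer simp
  show "- a + a = 0"
    by transfer (simp add: real_homologous_refl subspace_0[OF subspace_real_cycles1])
  show "a - b = a + - b"
    by transfer (simp only: diff_conv_add_uminus, intro real_homologous_add real_homologous_neg)
  show "r *\<^sub>R (a + b) = r *\<^sub>R a + r *\<^sub>R b"
    by transfer (simp only: scaleR_add_right, intro real_homologous_add real_homologous_scale)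
  show "(r + s) *\<^sub>R a = r *\<^sub>R a + s *\<^sub>R a"
    by transfer (simp only: scaleR_add_left, intro real_homologous_add real_homologous_scale)
  show "r *\<^sub>R s *\<^sub>R a = (r * s) *\<^sub>R a"
    by transfer (simp only: scaleR_scaleR, rule real_homologous_scale)
  show "1 *\<^sub>R a = a"
    by transfer simp
qed

end

text \<open>The map induced by a continuous \<open>f\<close>; for other \<open>f\<close> the value is meaningless.\<close>

definition H1_map :: "('a::topological_space \<Rightarrow> 'b::topological_space) \<Rightarrow> 'a real_H1 \<Rightarrow> 'b real_H1"
  where "H1_map f x = abs_real_H1 (real_chain_map 1 f (rep_real_H1 x))"

lemma real_chain_map_in_chains:
  assumes f: "continuous_on UNIV f" and c: "c \<in> real_chains p"
  shows "real_chain_map p f c \<in> real_chains p"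
proof -
  have "Poly_Mapping.single (simplex_map p f \<sigma>) 1 \<in> real_chains p"
    if "\<sigma> \<in> Poly_Mapping.keys c" for \<sigma>
    using that c f singular_simplex_simplex_map[of p euclidean \<sigma> euclidean f]
    by (auto simp: real_chains_def)
  then show ?thesis
    unfolding real_chain_map_def linear_extension_def
    by (intro subspace_sum[OF subspace_real_chains] subspace_scale[OF subspace_real_chains])
qed

lemma real_boundary_chain_map:
  assumes c: "c \<in> real_chains p" and p: "1 \<le> p"
  shows "real_boundary p (real_chain_map p f c) = real_chain_map (p - 1) f (real_boundary p c)"
proof -
  have face: "singular_face p k (simplex_map p f \<sigma>) = simplex_map (p - 1) f (singular_face p k \<sigma>)"
    if "k \<le> p" for k \<sigma>
    using p that simplical_face_in_standard_simplex[of p k]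
    by (fastforce simp: singular_face_def simplex_map_def)
  show ?thesis
    by (simp add: linear_extension_def[of _ c] real_boundary_def real_chain_map_def
        linear_sum[OF linear_linear_extension] linear_scale[OF linear_linear_extension] face)
qed

lemma H1_map_abs:
  assumes f: "continuous_on UNIV f" and c: "c \<in> real_cycles1"
  shows "H1_map f (abs_real_H1 c) = abs_real_H1 (real_chain_map 1 f c)"
proof -
  let ?d = "rep_real_H1 (abs_real_H1 c)"
  have cd: "real_homologous ?d c"
    by (rule rep_abs_rsp_left[OF Quotient3_real_H1 real_homologous_refl[OF c]])
  then obtain e where e: "e \<in> real_chains 2" "?d - c = real_boundary 2 e"
    unfolding real_homologous_def real_boundaries1_def by blast
  have cyc: "real_chain_map 1 f z \<in> real_cycles1" if "z \<in> real_cycles1" for z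
    using that real_chain_map_in_chains[OF f, of z 1] real_boundary_chain_map[of z 1 f]
    by (simp add: real_cycles1_def linear_0[OF linear_real_chain_map])
  have "real_chain_map 1 f ?d - real_chain_map 1 f c = real_chain_map 1 f (real_boundary 2 e)"
    unfolding e(2)[symmetric] by (rule linear_diff[OF linear_real_chain_map, symmetric])
  also have "\<dots> = real_boundary 2 (real_chain_map 2 f e)"
    using real_boundary_chain_map[OF e(1), of f] by simp
  finally have "real_homologous (real_chain_map 1 f ?d) (real_chain_map 1 f c)"
    using cyc cd real_chain_map_in_chains[OF f e(1)]
    unfolding real_homologous_def real_boundaries1_def by blast
  then show ?thesis
    unfolding H1_map_def by (rule Quotient3_rel_abs[OF Quotient3_real_H1])
qed


section \<open>Oriented surfaces\<close>

text \<open>A marked surface is carried by a whole type \<open>'a\<close>. It is given by a set \<open>Q\<close> of charts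
  \<open>(U, \<phi>)\<close> into the closed upper half plane (boundary is allowed) and the set \<open>P\<close> of marked
  points. Topologically, a local homeomorphism of the plane preserves orientation at \<open>z\<close> if it
  takes small positive circles about \<open>z\<close> to loops of winding number 1 about the image of \<open>z\<close>.\<close>

definition orientation_preserving_at :: "(complex \<Rightarrow> complex) \<Rightarrow> complex \<Rightarrow> bool"
  where "orientation_preserving_at f z \<longleftrightarrow>
    (\<forall>\<^sub>F r in at_right 0. winding_number (f \<circ> circlepath z r) (f z) = 1)"

definition chart_into :: "complex set \<Rightarrow> 'a::topological_space set \<Rightarrow> ('a \<Rightarrow> complex) \<Rightarrow> bool"
  where "chart_into H U \<phi> \<longleftrightarrow>
    open U \<and> openin (top_of_set H) (\<phi> ` U) \<and> (\<exists>g. homeomorphism U (\<phi> ` U) \<phi> g)"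

definition orientation_compatible ::
    "'a set \<times> ('a \<Rightarrow> complex) \<Rightarrow> 'a set \<times> ('a \<Rightarrow> complex) \<Rightarrow> bool"
  where "orientation_compatible = (\<lambda>(U, \<phi>) (V, \<psi>).
    \<forall>p \<in> U \<inter> V. \<phi> p \<in> interior (\<phi> ` U) \<longrightarrow>
      orientation_preserving_at (\<psi> \<circ> inv_into U \<phi>) (\<phi> p))"

definition oriented_atlas :: "('a::topological_space set \<times> ('a \<Rightarrow> complex)) set \<Rightarrow> bool"
  where "oriented_atlas Q \<longleftrightarrow>
    (\<forall>(U, \<phi>) \<in> Q. chart_into {z. Im z \<ge> 0} U \<phi>) \<and> (\<Union>(U, \<phi>) \<in> Q. U) = UNIV \<and>
    (\<forall>C \<in> Q. \<forall>D \<in> Q. orientation_compatible C D)"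

definition marked_surface ::
    "('a::t2_space set \<times> ('a \<Rightarrow> complex)) set \<Rightarrow> 'a set \<Rightarrow> bool"
  where "marked_surface Q P \<longleftrightarrow>
    compact (UNIV :: 'a set) \<and> connected (UNIV :: 'a set) \<and> oriented_atlas Q \<and> finite P"


section \<open>Curves, isotopy and intersection numbers\<close>

abbreviation unit_circle :: "complex set"
  where "unit_circle \<equiv> sphere 0 1"

definition parametrizes :: "(complex \<Rightarrow> 'a::topological_space) \<Rightarrow> 'a set \<Rightarrow> bool"
  where "parametrizes g c \<longleftrightarrow> (\<exists>h. homeomorphism unit_circle c g h)"

definition simple_closed_curve :: "'a::topological_space set \<Rightarrow> 'a set \<Rightarrow> bool"
  where "simple_closed_curve P c \<longleftrightarrow> c \<subseteq> - P \<and> (\<exists>g. parametrizes g c)"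

text \<open>Isotopy through embedded circles avoiding the marked points (injective continuous maps
  of the circle into a Hausdorff space are embeddings).\<close>

definition isotopic_curves :: "'a::topological_space set \<Rightarrow> 'a set \<Rightarrow> 'a set \<Rightarrow> bool"
  where "isotopic_curves P c d \<longleftrightarrow>
    (\<exists>g h. parametrizes g c \<and> parametrizes h d \<and>
      homotopic_with_canon (\<lambda>f. inj_on f unit_circle) unit_circle (- P) g h)"

definition null_homotopic_curve :: "'a::topological_space set \<Rightarrow> 'a set \<Rightarrow> bool"
  where "null_homotopic_curve P c \<longleftrightarrow>
    (\<exists>g a. parametrizes g c \<and>
      homotopic_with_canon (\<lambda>_. True) unit_circle (- P) g (\<lambda>_. a))"

text \<open>Isotopic to a puncture: isotopic into every neighbourhood of some marked point.\<close>

definition isotopic_to_puncture :: "'a::topological_space set \<Rightarrow> 'a set \<Rightarrow> bool"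
  where "isotopic_to_puncture P c \<longleftrightarrow>
    (\<exists>p \<in> P. \<forall>U. open U \<and> p \<in> U \<longrightarrow> (\<exists>d \<subseteq> U. isotopic_curves P c d))"

definition essential_curve :: "'a::topological_space set \<Rightarrow> 'a set \<Rightarrow> bool"
  where "essential_curve P c \<longleftrightarrow>
    simple_closed_curve P c \<and> \<not> null_homotopic_curve P c \<and> \<not> isotopic_to_puncture P c"

definition essential_1_manifold :: "'a::topological_space set \<Rightarrow> 'a set \<Rightarrow> bool"
  where "essential_1_manifold P A \<longleftrightarrow>
    compact A \<and> A \<subseteq> - P \<and>
    (\<forall>x \<in> A. \<exists>V. openin (top_of_set A) V \<and> x \<in> V \<and> V homeomorphic (UNIV :: real set)) \<and>
    (\<forall>c \<in> components A. essential_curve P c)"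

text \<open>Finiteness is required because \<open>card\<close> of an infinite set is 0.\<close>

definition geometric_intersection :: "'a::topological_space set \<Rightarrow> 'a set \<Rightarrow> 'a set \<Rightarrow> nat"
  where "geometric_intersection P c d =
    Inf {card (c' \<inter> d') | c' d'.
      isotopic_curves P c c' \<and> isotopic_curves P d d' \<and> finite (c' \<inter> d')}"

text \<open>Topological transversality: near each common point, some chart takes \<open>A\<close> to the real and
  \<open>B\<close> to the imaginary axis.\<close>

definition crosses_in_chart ::
    "'a::topological_space set \<Rightarrow> ('a \<Rightarrow> complex) \<Rightarrow> 'a set \<Rightarrow> 'a set \<Rightarrow> 'a \<Rightarrow> bool"
  where "crosses_in_chart U \<phi> A B p \<longleftrightarrow>
    chart_into UNIV U \<phi> \<and> p \<in> U \<and> \<phi> p = 0 \<and>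
    (\<forall>x \<in> U. (x \<in> A \<longleftrightarrow> Im (\<phi> x) = 0) \<and> (x \<in> B \<longleftrightarrow> Re (\<phi> x) = 0))"

definition transverse :: "'a::topological_space set \<Rightarrow> 'a set \<Rightarrow> bool"
  where "transverse A B \<longleftrightarrow> (\<forall>p \<in> A \<inter> B. \<exists>U \<phi>. crosses_in_chart U \<phi> A B p)"

definition minimal_position :: "'a::topological_space set \<Rightarrow> 'a set \<Rightarrow> 'a set \<Rightarrow> bool"
  where "minimal_position P A B \<longleftrightarrow>
    (\<forall>a \<in> components A. \<forall>b \<in> components B.
      finite (a \<inter> b) \<and> card (a \<inter> b) = geometric_intersection P a b)"

definition fills :: "'a::topological_space set \<Rightarrow> 'a set \<Rightarrow> 'a set \<Rightarrow> bool"
  where "fills P A B \<longleftrightarrow>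
    (\<forall>c. essential_curve P c \<longrightarrow>
      (\<exists>d \<in> components A \<union> components B. geometric_intersection P c d \<noteq> 0))"

text \<open>A parametrization orients its curve counterclockwise. The crossing is positive if in a
  positively oriented chart the curves run in the directions of the real and the imaginary
  axis.\<close>

definition positive_crossing ::
    "('a::topological_space set \<times> ('a \<Rightarrow> complex)) set \<Rightarrow>
      (complex \<Rightarrow> 'a) \<Rightarrow> (complex \<Rightarrow> 'a) \<Rightarrow> 'a \<Rightarrow> bool"
  where "positive_crossing Q g h p \<longleftrightarrow>
    (\<exists>U \<phi>. crosses_in_chart U \<phi> (g ` unit_circle) (h ` unit_circle) p \<and>
      (\<forall>C \<in> Q. orientation_compatible C (U, \<phi>)) \<and>
      (\<exists>w \<in> unit_circle. g w = p \<and> (\<forall>\<^sub>F t in at_right 0. Re (\<phi> (g (w * cis t))) > 0)) \<and>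
      (\<exists>w \<in> unit_circle. h w = p \<and> (\<forall>\<^sub>F t in at_right 0. Im (\<phi> (h (w * cis t))) > 0)))"

definition positively_orientable ::
    "('a::topological_space set \<times> ('a \<Rightarrow> complex)) set \<Rightarrow> 'a set \<Rightarrow> 'a set \<Rightarrow> bool"
  where "positively_orientable Q A B \<longleftrightarrow>
    (\<exists>g. (\<forall>c \<in> components A \<union> components B. parametrizes (g c) c) \<and>
      (\<forall>a \<in> components A. \<forall>b \<in> components B. \<forall>p \<in> a \<inter> b.
        positive_crossing Q (g a) (g b) p))"


section \<open>Mapping classes and Dehn twists\<close>

definition orientation_homeos ::
    "('a::topological_space set \<times> ('a \<Rightarrow> complex)) set \<Rightarrow> 'a set \<Rightarrow> ('a \<Rightarrow> 'a) set"
  where "orientation_homeos Q P =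
    {f. (\<exists>g. homeomorphism UNIV UNIV f g) \<and> f ` P = P \<and>
      (\<forall>(U, \<phi>) \<in> Q. \<forall>(V, \<psi>) \<in> Q. \<forall>p \<in> U.
        f p \<in> V \<and> \<phi> p \<in> interior (\<phi> ` U) \<longrightarrow>
          orientation_preserving_at (\<psi> \<circ> f \<circ> inv_into U \<phi>) (\<phi> p))}"

definition isotopic_homeos ::
    "('a::topological_space set \<times> ('a \<Rightarrow> complex)) set \<Rightarrow> 'a set \<Rightarrow> ('a \<Rightarrow> 'a) \<Rightarrow> ('a \<Rightarrow> 'a) \<Rightarrow> bool"
  where "isotopic_homeos Q P f g \<longleftrightarrow>
    homotopic_with_canon (\<lambda>h. h \<in> orientation_homeos Q P) UNIV UNIV f g"

definition mapping_class_group ::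
    "('a::topological_space set \<times> ('a \<Rightarrow> complex)) set \<Rightarrow> 'a set \<Rightarrow> ('a \<Rightarrow> 'a) set monoid"
  where "mapping_class_group Q P =
    \<lparr>carrier = orientation_homeos Q P // {(f, g). isotopic_homeos Q P f g},
     mult = (\<lambda>m n. {h. \<exists>f \<in> m. \<exists>g \<in> n. isotopic_homeos Q P (f \<circ> g) h}),
     one = {h. isotopic_homeos Q P id h}\<rparr>"

text \<open>Isotopic homeomorphisms induce the same map, so the choice of a representative is
  immaterial.\<close>

definition induced_H1 :: "('a::topological_space \<Rightarrow> 'a) set \<Rightarrow> 'a real_H1 \<Rightarrow> 'a real_H1"
  where "induced_H1 m = H1_map (SOME f. f \<in> m)"

text \<open>The left twist $(\theta,t)\mapsto(\theta+2\pi t,t)$ of $S^1\times[0,1]$, written on the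
  planar annulus $1\le|z|\le 2$ with $t=|z|-1$ and oriented as a subset of the plane. It is
  transplanted by an orientation preserving embedding \<open>\<phi>\<close> with core curve \<open>c\<close>.\<close>

definition left_twist_homeo ::
    "('a::topological_space set \<times> ('a \<Rightarrow> complex)) set \<Rightarrow> 'a set \<Rightarrow> 'a set \<Rightarrow> ('a \<Rightarrow> 'a) \<Rightarrow> bool"
  where "left_twist_homeo Q P c h \<longleftrightarrow>
    (let R = {z::complex. 1 \<le> norm z \<and> norm z \<le> 2} in
     \<exists>\<phi>. (\<exists>\<phi>'. homeomorphism R (\<phi> ` R) \<phi> \<phi>') \<and> \<phi> ` R \<subseteq> - P \<and>
       \<phi> ` {z. norm z = 3/2} = c \<and>
       (\<forall>(V, \<psi>) \<in> Q. \<forall>z \<in> interior R. \<phi> z \<in> V \<longrightarrow> orientation_preserving_at (\<psi> \<circ> \<phi>) z) \<and>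
       (\<forall>z \<in> R. h (\<phi> z) = \<phi> (z * cis (2 * pi * (norm z - 1)))) \<and>
       (\<forall>x. x \<notin> \<phi> ` R \<longrightarrow> h x = x))"

definition positive_dehn_twist ::
    "('a::topological_space set \<times> ('a \<Rightarrow> complex)) set \<Rightarrow> 'a set \<Rightarrow> 'a set \<Rightarrow> ('a \<Rightarrow> 'a) set \<Rightarrow> bool"
  where "positive_dehn_twist Q P c T \<longleftrightarrow>
    T \<in> carrier (mapping_class_group Q P) \<and> (\<exists>h \<in> T. left_twist_homeo Q P c h)"

text \<open>\<open>T\<close> is the product, over the components of \<open>A\<close>, of the positive Dehn twists. (The twists
  commute, so that any enumeration of the components yields the same product.)\<close>

definition positive_multitwist ::
    "('a::topological_space set \<times> ('a \<Rightarrow> complex)) set \<Rightarrow> 'a set \<Rightarrow> 'a set \<Rightarrow> ('a \<Rightarrow> 'a) set \<Rightarrow> bool"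
  where "positive_multitwist Q P A T \<longleftrightarrow>
    (\<exists>cs ts. distinct cs \<and> set cs = components A \<and>
      list_all2 (positive_dehn_twist Q P) cs ts \<and>
      T = foldr (\<lambda>t u. t \<otimes>\<^bsub>mapping_class_group Q P\<^esub> u) ts \<one>\<^bsub>mapping_class_group Q P\<^esub>)"


section \<open>Coxeter groups of graphs of small type\<close>

text \<open>A graph with vertex set the finite type \<open>'n\<close>, possibly with multiple edges, is given by
  the number \<open>m i j\<close> of edges joining \<open>i\<close> and \<open>j\<close>. In \<open>configuration_graph\<close> the vertex \<open>i\<close> is
  the curve \<open>s i\<close>, and an intersection point is an edge joining the two curves through it.\<close>

definition configuration_graph :: "'a set \<Rightarrow> 'a set \<Rightarrow> ('n \<Rightarrow> 'a set) \<Rightarrow> 'n \<Rightarrow> 'n \<Rightarrow> nat"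
  where "configuration_graph A B s i j = card {p \<in> A \<inter> B. {k. p \<in> s k} = {i, j}}"

definition small_type :: "('n \<Rightarrow> 'n \<Rightarrow> nat) \<Rightarrow> bool"
  where "small_type m \<longleftrightarrow> (\<forall>i j. m i j \<le> 1)"

definition adjacency_matrix :: "('n \<Rightarrow> 'n \<Rightarrow> nat) \<Rightarrow> real ^ 'n ^ 'n"
  where "adjacency_matrix m = (\<chi> i j. real (m i j))"

definition coxeter_exponent :: "('n \<Rightarrow> 'n \<Rightarrow> nat) \<Rightarrow> 'n \<Rightarrow> 'n \<Rightarrow> nat"
  where "coxeter_exponent m i j = (if i = j then 1 else if m i j \<noteq> 0 then 3 else 2)"

text \<open>The generators are involutions, so every element is represented by a positive word, and
  the group is the quotient of the free monoid by the congruence generated by the relations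
  \<open>(s\<^sub>i s\<^sub>j) ^ coxeter_exponent m i j = 1\<close>.\<close>

inductive coxeter_equiv :: "('n \<Rightarrow> 'n \<Rightarrow> nat) \<Rightarrow> 'n list \<Rightarrow> 'n list \<Rightarrow> bool" for m
  where
    relation: "coxeter_equiv m (u @ concat (replicate (coxeter_exponent m i j) [i, j]) @ v) (u @ v)"
  | refl: "coxeter_equiv m w w"
  | sym: "coxeter_equiv m v w \<Longrightarrow> coxeter_equiv m w v"
  | trans: "coxeter_equiv m u v \<Longrightarrow> coxeter_equiv m v w \<Longrightarrow> coxeter_equiv m u w"

definition coxeter_group :: "('n \<Rightarrow> 'n \<Rightarrow> nat) \<Rightarrow> 'n list set monoid"
  where "coxeter_group m =
    \<lparr>carrier = UNIV // {(v, w). coxeter_equiv m v w},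
     mult = (\<lambda>x y. {w. \<exists>u \<in> x. \<exists>v \<in> y. coxeter_equiv m (u @ v) w}),
     one = {w. coxeter_equiv m [] w}\<rparr>"

text \<open>The product of the generators in \<open>I\<close>, in some order. It is independent of the order if no
  two vertices in \<open>I\<close> are adjacent.\<close>

definition generator_product :: "('n::finite \<Rightarrow> 'n \<Rightarrow> nat) \<Rightarrow> 'n set \<Rightarrow> 'n list set"
  where "generator_product m I =
    {w. coxeter_equiv m (SOME v. distinct v \<and> set v = I) w}"

definition coxeter_form :: "('n::finite \<Rightarrow> 'n \<Rightarrow> nat) \<Rightarrow> real ^ 'n \<Rightarrow> real ^ 'n \<Rightarrow> real"
  where "coxeter_form m x y = x \<bullet> ((2 *\<^sub>R mat 1 - adjacency_matrix m) *v y)"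

definition coxeter_reflection :: "('n::finite \<Rightarrow> 'n \<Rightarrow> nat) \<Rightarrow> 'n \<Rightarrow> real ^ 'n \<Rightarrow> real ^ 'n"
  where "coxeter_reflection m i x = x - coxeter_form m (axis i 1) x *\<^sub>R axis i 1"

definition word_reflection :: "('n::finite \<Rightarrow> 'n \<Rightarrow> nat) \<Rightarrow> 'n list \<Rightarrow> real ^ 'n \<Rightarrow> real ^ 'n"
  where "word_reflection m w = foldr (\<lambda>i f. coxeter_reflection m i \<circ> f) w id"

text \<open>The geometric representation, on elements of the Coxeter group; see
  \<open>geometric_rep_class\<close> for its independence of the word.\<close>

definition geometric_rep :: "('n::finite \<Rightarrow> 'n \<Rightarrow> nat) \<Rightarrow> 'n list set \<Rightarrow> real ^ 'n \<Rightarrow> real ^ 'n"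
  where "geometric_rep m x = the_elem (word_reflection m ` x)"

lemma coxeter_form_axis:
  "coxeter_form m (axis i 1) (axis j 1) = (if i = j then 2 else 0) - real (m i j)"
  by (simp add: coxeter_form_def inner_axis' matrix_vector_mul_component inner_axis
      adjacency_matrix_def mat_def)

lemma coxeter_form_diff_scale:
  "coxeter_form m x (y - r *\<^sub>R z) = coxeter_form m x y - r * coxeter_form m x z"
  by (simp add: coxeter_form_def matrix_vector_mult_diff_distrib inner_diff_right
      matrix_vector_mult_scaleR)

lemma word_reflection_append:
  "word_reflection m (u @ v) = word_reflection m u \<circ> word_reflection m v"
  unfolding word_reflection_def by (induction u) (auto simp: comp_assoc)

lemma word_reflection_relation:
  assumes "small_type m" "\<And>i j. m i j = m j i" "\<And>i. m i i = 0"
  shows "word_reflection m (concat (replicate (coxeter_exponent m i j) [i, j])) = id"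
proof
  fix x
  let ?f = "coxeter_form m" and ?r = "coxeter_reflection m"
  define e where "e k = (axis k 1 :: real ^ 'a)" for k
  have r: "?r k y = y - ?f (e k) y *\<^sub>R e k" for k y
    by (simp add: coxeter_reflection_def e_def)
  have fd: "?f (e k) (y - t *\<^sub>R e l) = ?f (e k) y - t * ?f (e k) (e l)" for k l y t
    by (rule coxeter_form_diff_scale)
  have f2: "?f (e k) (e k) = 2" for k
    using assms(3)[of k] by (simp add: e_def coxeter_form_axis)
  have rr: "?r k (?r k y) = y" for k y
    by (simp add: r fd f2)
  have "m j i = m i j" "m i j = 0 \<or> m i j = 1"
    using assms(1,2) by (auto simp: small_type_def le_Suc_eq)
  then consider "i = j" | "i \<noteq> j" "m i j = 0" "m j i = 0" | "i \<noteq> j" "m i j = 1" "m j i = 1"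
    by metis
  then show "word_reflection m (concat (replicate (coxeter_exponent m i j) [i, j])) x = id x"
  proof cases
    case 1
    then show ?thesis
      by (simp add: coxeter_exponent_def word_reflection_def rr)
  next
    case 2
    then have f0: "?f (e i) (e j) = 0" "?f (e j) (e i) = 0"
      by (simp_all add: e_def coxeter_form_axis)
    have "?r j (?r i y) = ?r i (?r j y)" for y
      by (simp add: r fd f0)
    then show ?thesis
      using 2 by (simp add: coxeter_exponent_def word_reflection_def rr numeral_2_eq_2)
  next
    case 3
    then have f1: "?f (e i) (e j) = - 1" "?f (e j) (e i) = - 1"
      by (simp_all add: e_def coxeter_form_axis)
    define a b where "a = ?f (e i) x" and "b = ?f (e j) x"
    have ca: "?f (e i) (x - s *\<^sub>R e i - t *\<^sub>R e j) = a - 2 * s + t"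
      and cb: "?f (e j) (x - s *\<^sub>R e i - t *\<^sub>R e j) = b + s - 2 * t" for s t
      by (simp_all add: fd f1 f2 a_def b_def)
    have c: "?r i (x - s *\<^sub>R e i - t *\<^sub>R e j) = x - (a + t - s) *\<^sub>R e i - t *\<^sub>R e j"
      "?r j (x - s *\<^sub>R e i - t *\<^sub>R e j) = x - s *\<^sub>R e i - (b + s - t) *\<^sub>R e j" for s t
      by (simp_all add: r ca cb vec_eq_iff) (simp_all add: algebra_simps)
    have "?r j x = x - 0 *\<^sub>R e i - b *\<^sub>R e j"
      by (simp add: r b_def)
    then have "?r i (?r j (?r i (?r j (?r i (?r j x))))) = x"
      by (simp only: c) simp
    then show ?thesis
      using 3 by (simp add: coxeter_exponent_def word_reflection_def numeral_3_eq_3)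
  qed
qed

lemma word_reflection_cong:
  assumes "small_type m" "\<And>i j. m i j = m j i" "\<And>i. m i i = 0" "coxeter_equiv m v w"
  shows "word_reflection m v = word_reflection m w"
  using assms(4)
proof induction
  case (relation u i j v)
  show ?case
    unfolding word_reflection_append word_reflection_relation[OF assms(1-3)] by simp
qed simp_all

lemma geometric_rep_class:
  assumes "small_type m" "\<And>i j. m i j = m j i" "\<And>i. m i i = 0"
  shows "geometric_rep m {w. coxeter_equiv m v w} = word_reflection m v"
proof -
  have "word_reflection m ` {w. coxeter_equiv m v w} = {word_reflection m v}"
  proof (intro equalityI subsetI)
    fix f assume "f \<in> word_reflection m ` {w. coxeter_equiv m v w}"
    then obtain w where "coxeter_equiv m v w" "f = word_reflection m w" by blast
    with word_reflection_cong[OF assms this(1)] show "f \<in> {word_reflection m v}" by simp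
  qed (use coxeter_equiv.refl[of m v] in blast)
  then show ?thesis
    by (simp add: geometric_rep_def)
qed


section \<open>Spectral radius\<close>

text \<open>\<open>u + \<i> v\<close> is an eigenvector, for the eigenvalue \<open>z\<close>, of the complexification of the
  real linear map \<open>L\<close>.\<close>

definition complex_eigenvalue :: "('v::real_vector \<Rightarrow> 'v) \<Rightarrow> complex \<Rightarrow> bool"
  where "complex_eigenvalue L z \<longleftrightarrow>
    (\<exists>u v. (u \<noteq> 0 \<or> v \<noteq> 0) \<and>
      L u = Re z *\<^sub>R u - Im z *\<^sub>R v \<and> L v = Im z *\<^sub>R u + Re z *\<^sub>R v)"

definition spectral_radius_of :: "('v::real_vector \<Rightarrow> 'v) \<Rightarrow> real"
  where "spectral_radius_of L = Max (norm ` {z. complex_eigenvalue L z})"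

end

theory Submission
  imports Defs "HOL-Complex_Analysis.Riemann_Mapping"
begin

text \<open>The annulus of the twist about a curve \<open>c\<close> collapses onto a circle, by a map of the whole
  surface that is constant off the annulus. If \<open>F\<close> is the winding of the image of a cycle under
  this map, the twist acts on homology by \<open>x \<mapsto> x + F x [c]\<close>, and \<open>F\<close> evaluates to the crossing
  sign on a curve meeting \<open>c\<close> once, by a computation of local degrees in the plane. In a graph of
  small type two curves meet at most once, so that \<open>F\<close> is known on all components.

  Let \<open>\<eta>\<close> send the basis vector of a component \<open>a\<close> of \<open>A\<close> to \<open>[a]\<close> and that of a component \<open>b\<close> of
  \<open>B\<close> to \<open>- [b]\<close>. Then \<open>T_A T_B\<close> lifts along \<open>\<eta>\<close> to \<open>- \<Theta>(\<sigma>_A \<sigma>_B)\<close>. The difference of this lift and the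
  identity depends only on the values of the forms \<open>F\<close> at \<open>\<eta> x\<close>, and so vanishes on the kernel
  of \<open>\<eta>\<close>; on homology it takes values in the range of \<open>\<eta>\<close>. Hence the two spectra agree away
  from 1. As \<open>A \<union> B\<close> fills, the graph has an edge, its squared adjacency matrix has a positive
  eigenvalue \<open>l\<close>, and a root of \<open>z\<^sup>2 - (2 - l) z + 1\<close> is a common eigenvalue other than 1 of modulus
  at least 1; so the eigenvalue 1 does not affect either spectral radius.\<close>

section \<open>Singular paths modulo boundaries\<close>

\<comment> \<open>A twist need not be homotopic to the identity, so no prism compares the two. They
  are compared on each path separately, and the defect is an endpoint term, which cycles do not see,
  plus a multiple of the core. Open paths have no homology class; hence the quotient of all 1-chains
  by boundaries, in which concatenation is addition. Orientation is defined topologically, so signs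
  come from winding numbers of small circles. Whether the annulus coordinate runs along the core in
  the direction of the given parametrization is unknown; the sign \<open>e\<close> that records it
  enters the class of the core and the winding alike, and cancels. A transvection changes its
  coordinates only by neighbour sums, while a product of commuting reflections also negates them;
  the two halves together negate every coordinate, whence the minus sign before \<Theta>. The
  quadratic polynomial is the characteristic polynomial of the lift on the plane spanned by an
  eigenvector on one side of the graph and its image under the adjacency matrix. As the spectral
  radius is a \<open>Max\<close>, finiteness of the spectrum matters; for homology it is inherited
  from the lift.\<close>
quotient_type (overloaded) 'a chain_class =
  "'a::topological_space real_chain" / "\<lambda>c d. c - d \<in> real_boundaries1"
proof (rule equivpI)
  note B = subspace_real_boundaries1
  show "reflp (\<lambda>c d :: 'a real_chain. c - d \<in> real_boundaries1)"
    by (rule reflpI) (simp add: subspace_0[OF B])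
  show "symp (\<lambda>c d :: 'a real_chain. c - d \<in> real_boundaries1)"
  proof (rule sympI)
    fix c d :: "'a real_chain"
    assume "c - d \<in> real_boundaries1"
    then show "d - c \<in> real_boundaries1"
      using subspace_neg[OF B, of "c - d"] by simp
  qed
  show "transp (\<lambda>c d :: 'a real_chain. c - d \<in> real_boundaries1)"
  proof (rule transpI)
    fix c d e :: "'a real_chain"
    assume "c - d \<in> real_boundaries1" "d - e \<in> real_boundaries1"
    then show "c - e \<in> real_boundaries1"
      using subspace_add[OF B, of "c - d" "d - e"] by simp
  qed
qed

instantiation chain_class :: (topological_space) real_vector
begin

lift_definition zero_chain_class :: "'a chain_class" is 0 .

lift_definition plus_chain_class :: "'a chain_class \<Rightarrow> 'a chain_class \<Rightarrow> 'a chain_class" is "(+)"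
  using subspace_add[OF subspace_real_boundaries1] by (fastforce simp: add_diff_add)

lift_definition uminus_chain_class :: "'a chain_class \<Rightarrow> 'a chain_class" is uminus
  using subspace_neg[OF subspace_real_boundaries1] by fastforce

lift_definition minus_chain_class :: "'a chain_class \<Rightarrow> 'a chain_class \<Rightarrow> 'a chain_class" is "(-)"
  subgoal for c d e f
    using subspace_diff[OF subspace_real_boundaries1, of "c - d" "e - f"] by (simp add: algebra_simps)
  done

lift_definition scaleR_chain_class :: "real \<Rightarrow> 'a chain_class \<Rightarrow> 'a chain_class" is "(*\<^sub>R)"
  using subspace_scale[OF subspace_real_boundaries1] by (fastforce simp: scaleR_diff_right[symmetric])

instance
  by standard (transfer; simp add: algebra_simps subspace_0[OF subspace_real_boundaries1])+

end

section \<open>Classes of segments and triangles\<close>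

abbreviation cls :: "'a::topological_space real_chain \<Rightarrow> 'a chain_class"
  where "cls \<equiv> abs_chain_class"

lemma linear_cls: "linear cls"
  by (rule linearI) (simp_all add: plus_chain_class.abs_eq scaleR_chain_class.abs_eq)

lemma cls_eq_iff: "cls c = cls d \<longleftrightarrow> c - d \<in> real_boundaries1"
  using Quotient3_rel[OF Quotient3_chain_class, of c d]
  by (simp add: subspace_0[OF subspace_real_boundaries1])

lemma cls_eq_0_iff: "cls c = 0 \<longleftrightarrow> c \<in> real_boundaries1"
  using cls_eq_iff[of c 0] by (simp add: linear_0[OF linear_cls])

text \<open>The domain is an arbitrary vector space, so that a single map \<open>H\<close> of a
  square, an interval or the plane supplies all paths compared in one argument. Restriction to the
  simplex makes the function extensional, as singular simplices have to be.\<close>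

definition seg :: "('e::real_vector \<Rightarrow> 'a) \<Rightarrow> 'e \<Rightarrow> 'e \<Rightarrow> 'a real_chain"
  where "seg H a b =
    Poly_Mapping.single (restrict (\<lambda>x. H (x 0 *\<^sub>R a + x 1 *\<^sub>R b)) (standard_simplex 1)) 1"

abbreviation path_class :: "('e::real_vector \<Rightarrow> 'a::topological_space) \<Rightarrow> 'e \<Rightarrow> 'e \<Rightarrow> 'a chain_class"
  where "path_class H a b \<equiv> cls (seg H a b)"

definition triangle :: "('e::real_vector \<Rightarrow> 'a) \<Rightarrow> 'e \<Rightarrow> 'e \<Rightarrow> 'e \<Rightarrow> (nat \<Rightarrow> real) \<Rightarrow> 'a"
  where "triangle H a b c =
    restrict (\<lambda>x. H (x 0 *\<^sub>R a + x 1 *\<^sub>R b + x 2 *\<^sub>R c)) (standard_simplex 2)"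

lemma standard_simplex_1_iff:
  "x \<in> standard_simplex 1 \<longleftrightarrow> 0 \<le> x 0 \<and> 0 \<le> x 1 \<and> x 0 + x 1 = 1 \<and> (\<forall>i>1. x i = 0)"
proof
  assume *: "0 \<le> x 0 \<and> 0 \<le> x 1 \<and> x 0 + x 1 = 1 \<and> (\<forall>i>1. x i = 0)"
  have "0 \<le> x i \<and> x i \<le> 1" for i
  proof -
    consider "i = 0" | "i = 1" | "i > 1" by linarith
    then show ?thesis using * by cases simp_all
  qed
  with * show "x \<in> standard_simplex 1"
    unfolding standard_simplex_def by simp
next
  assume "x \<in> standard_simplex 1"
  then have "\<forall>i. 0 \<le> x i" "\<forall>i>1. x i = 0" "sum x {..1} = 1"
    unfolding standard_simplex_def by blast+
  then show "0 \<le> x 0 \<and> 0 \<le> x 1 \<and> x 0 + x 1 = 1 \<and> (\<forall>i>1. x i = 0)"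
    by simp
qed

lemma standard_simplex_2_iff:
  "x \<in> standard_simplex 2 \<longleftrightarrow>
    0 \<le> x 0 \<and> 0 \<le> x 1 \<and> 0 \<le> x 2 \<and> x 0 + x 1 + x 2 = 1 \<and> (\<forall>i>2. x i = 0)"
proof
  assume *: "0 \<le> x 0 \<and> 0 \<le> x 1 \<and> 0 \<le> x 2 \<and> x 0 + x 1 + x 2 = 1 \<and> (\<forall>i>2. x i = 0)"
  have "0 \<le> x i \<and> x i \<le> 1" for i
  proof -
    consider "i = 0" | "i = 1" | "i = 2" | "i > 2" by linarith
    then show ?thesis using * by cases simp_all
  qed
  with * show "x \<in> standard_simplex 2"
    unfolding standard_simplex_def by (simp add: atMost_nat_numeral pred_numeral_simps add.commute add.left_commute)
next
  assume "x \<in> standard_simplex 2"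
  then have "\<forall>i. 0 \<le> x i" "\<forall>i>2. x i = 0" "sum x {..2} = 1"
    unfolding standard_simplex_def by blast+
  moreover have "sum x {..2} = x 0 + x 1 + x 2"
    by (simp add: numeral_2_eq_2)
  ultimately show "0 \<le> x 0 \<and> 0 \<le> x 1 \<and> 0 \<le> x 2 \<and> x 0 + x 1 + x 2 = 1 \<and> (\<forall>i>2. x i = 0)"
    by simp
qed

lemma singular_simplex_iff_continuous_on:
  "singular_simplex p (euclidean :: 'a::topological_space topology) f \<longleftrightarrow>
    continuous_on (standard_simplex p) f \<and> f \<in> extensional (standard_simplex p)"
  by (simp add: singular_simplex_def euclidean_product_topology)

lemma singular_simplex_seg:
  fixes H :: "'e::real_normed_vector \<Rightarrow> 'a::topological_space"
  assumes "continuous_on (closed_segment a b) H"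
  shows "seg H a b \<in> real_chains 1"
proof -
  have "continuous_on (standard_simplex 1) (\<lambda>x. H (x 0 *\<^sub>R a + x 1 *\<^sub>R b))"
  proof (rule continuous_on_compose2[OF assms])
    show "(\<lambda>x. x 0 *\<^sub>R a + x 1 *\<^sub>R b) ` standard_simplex 1 \<subseteq> closed_segment a b"
    proof clarify
      fix x :: "nat \<Rightarrow> real"
      assume "x \<in> standard_simplex 1"
      then have "x 0 = 1 - x 1" "0 \<le> x 1" "x 1 \<le> 1"
        by (simp_all only: standard_simplex_1_iff) linarith+
      then show "x 0 *\<^sub>R a + x 1 *\<^sub>R b \<in> closed_segment a b"
        unfolding closed_segment_def by (intro CollectI exI[of _ "x 1"]) simp
    qed
  qed (intro continuous_intros continuous_on_subset[OF continuous_on_product_coordinates] subset_UNIV)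
  then show ?thesis
    by (simp add: seg_def real_chains_def singular_simplex_iff_continuous_on)
qed

lemma singular_simplex_triangle:
  fixes H :: "'e::real_normed_vector \<Rightarrow> 'a::topological_space"
  assumes "continuous_on K H" "convex K" "a \<in> K" "b \<in> K" "c \<in> K"
  shows "singular_simplex 2 euclidean (triangle H a b c)"
proof -
  have "continuous_on (standard_simplex 2) (\<lambda>x. H (x 0 *\<^sub>R a + x 1 *\<^sub>R b + x 2 *\<^sub>R c))"
  proof (rule continuous_on_compose2[OF assms(1)])
    have "x 0 *\<^sub>R a + x 1 *\<^sub>R b + x 2 *\<^sub>R c \<in> convex hull {a, b, c}" if "x \<in> standard_simplex 2" for x
      using that unfolding convex_hull_3 standard_simplex_2_iff by blast
    then show "(\<lambda>x. x 0 *\<^sub>R a + x 1 *\<^sub>R b + x 2 *\<^sub>R c) ` standard_simplex 2 \<subseteq> K"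
      using hull_minimal[of "{a, b, c}" K convex] assms(2-5) by auto
  qed (intro continuous_intros continuous_on_subset[OF continuous_on_product_coordinates] subset_UNIV)
  then show ?thesis
    by (simp add: triangle_def singular_simplex_iff_continuous_on)
qed

lemma boundary_triangle:
  "real_boundary 2 (Poly_Mapping.single (triangle H a b c) 1) = seg H b c - seg H a c + seg H a b"
proof -
  have face: "singular_face 2 k (triangle H a b c) =
      restrict (\<lambda>x. H (simplical_face k x 0 *\<^sub>R a + simplical_face k x 1 *\<^sub>R b + simplical_face k x 2 *\<^sub>R c))
        (standard_simplex 1)" if "k \<le> 2" for k
    using that simplical_face_in_standard_simplex[of 2 k]
    by (fastforce simp: singular_face_def triangle_def)
  have "singular_face 2 0 (triangle H a b c) =
      restrict (\<lambda>x. H (x 0 *\<^sub>R b + x 1 *\<^sub>R c)) (standard_simplex 1)"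
    "singular_face 2 1 (triangle H a b c) =
      restrict (\<lambda>x. H (x 0 *\<^sub>R a + x 1 *\<^sub>R c)) (standard_simplex 1)"
    "singular_face 2 2 (triangle H a b c) =
      restrict (\<lambda>x. H (x 0 *\<^sub>R a + x 1 *\<^sub>R b)) (standard_simplex 1)"
    by (simp_all add: face simplical_face_def)
  then show ?thesis
    by (simp add: real_boundary_def seg_def numeral_2_eq_2)
qed

text \<open>By convexity the three points span a singular triangle inside \<open>K\<close>, and the
  difference of the two sides is its boundary. Concatenation of paths thus becomes addition of
  classes.\<close>

lemma path_class_triangle:
  fixes H :: "'e::real_normed_vector \<Rightarrow> 'a::topological_space"
  assumes "continuous_on K H" "convex K" "a \<in> K" "b \<in> K" "c \<in> K"
  shows "path_class H a b + path_class H b c = path_class H a c"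
proof -
  have "Poly_Mapping.single (triangle H a b c) 1 \<in> real_chains 2"
    using singular_simplex_triangle[OF assms] by (simp add: real_chains_def)
  then have "seg H b c - seg H a c + seg H a b \<in> real_boundaries1"
    unfolding real_boundaries1_def by (metis boundary_triangle image_eqI)
  then have "cls (seg H b c - seg H a c + seg H a b) = 0"
    by (simp add: cls_eq_0_iff)
  then show ?thesis
    by (simp add: linear_add[OF linear_cls] linear_diff[OF linear_cls] algebra_simps)
qed

text \<open>The degenerate triangle gives x + x = x.\<close>

lemma path_class_trivial:
  fixes H :: "'e::real_normed_vector \<Rightarrow> 'a::topological_space"
  shows "path_class H a a = 0"
  using path_class_triangle[of "{a}" H a a a] by simp

lemma path_class_reverse:
  fixes H :: "'e::real_normed_vector \<Rightarrow> 'a::topological_space"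
  assumes "continuous_on (closed_segment a b) H"
  shows "path_class H b a = - path_class H a b"
  using path_class_triangle[OF assms, of a b a] path_class_trivial[of H a]
  by (simp add: eq_neg_iff_add_eq_0 add.commute)

text \<open>An equality of chains, not only of classes: sides of different squares that trace the
  same path can be identified literally.\<close>

lemma seg_cong:
  assumes "\<And>t. 0 \<le> t \<Longrightarrow> t \<le> 1 \<Longrightarrow> H ((1 - t) *\<^sub>R a + t *\<^sub>R b) = K ((1 - t) *\<^sub>R c + t *\<^sub>R d)"
  shows "seg H a b = seg K c d"
proof -
  have "H (x 0 *\<^sub>R a + x 1 *\<^sub>R b) = K (x 0 *\<^sub>R c + x 1 *\<^sub>R d)" if "x \<in> standard_simplex 1" for x
  proof -
    have "x 0 = 1 - x 1" "0 \<le> x 1" "x 1 \<le> 1"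
      using that unfolding standard_simplex_1_iff by linarith+
    with assms[of "x 1"] show ?thesis by simp
  qed
  then show ?thesis
    unfolding seg_def by (simp add: restrict_def cong: if_cong)
qed

text \<open>Both sums equal the class of the diagonal from \<open>a\<close> to \<open>c\<close>.
  Applied to squares that carry homotopies, this takes the place of the prism operator.\<close>

lemma path_class_square:
  fixes H :: "'e::real_normed_vector \<Rightarrow> 'a::topological_space"
  assumes "continuous_on K H" "convex K" "a \<in> K" "b \<in> K" "c \<in> K" "d \<in> K"
  shows "path_class H a b + path_class H b c = path_class H a d + path_class H d c"
  using path_class_triangle[OF assms(1,2)] assms by metis

lemma chain_map_seg: "real_chain_map 1 f (seg H a b) = seg (f \<circ> H) a b"
  by (simp add: real_chain_map_def seg_def simplex_map_def)
    (rule arg_cong[where f = "\<lambda>\<sigma>. Poly_Mapping.single \<sigma> 1"], auto simp: fun_eq_iff)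

text \<open>The edge is parametrized by \<open>e t\<close>, with barycentric coordinates 1 - t and
  t. Linear identities on chains then need checking on paths over [0, 1] only.\<close>

lemma singular_simplex_1_cases:
  fixes \<sigma> :: "(nat \<Rightarrow> real) \<Rightarrow> 'a::topological_space"
  assumes "singular_simplex 1 euclidean \<sigma>"
  obtains \<gamma> :: "real \<Rightarrow> 'a" where "continuous_on {0..1} \<gamma>" "Poly_Mapping.single \<sigma> 1 = seg \<gamma> 0 1"
proof
  define e :: "real \<Rightarrow> nat \<Rightarrow> real" where "e t = (\<lambda>i. if i = 0 then 1 - t else if i = 1 then t else 0)" for t
  have \<sigma>: "continuous_on (standard_simplex 1) \<sigma>" "\<sigma> \<in> extensional (standard_simplex 1)"
    using assms by (simp_all add: singular_simplex_iff_continuous_on)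
  show "continuous_on {0..1} (\<sigma> \<circ> e)"
  proof (rule continuous_on_compose)
    show "continuous_on {0..1} e"
    proof (rule continuous_on_coordinatewise_then_product)
      show "continuous_on {0..1} (\<lambda>z. e z i)" for i
        unfolding e_def by (cases "i = 0"; cases "i = 1"; cases "i = 2") (auto intro!: continuous_intros)
    qed
    show "continuous_on (e ` {0..1}) \<sigma>"
      by (rule continuous_on_subset[OF \<sigma>(1)]) (auto simp: standard_simplex_1_iff e_def simp del: One_nat_def)
  qed
  have "e (x 1) = x" if "x \<in> standard_simplex 1" for x
  proof
    fix i :: nat
    have x: "1 - x 1 = x 0"
      using that unfolding standard_simplex_1_iff by linarith
    have x': "x i = 0" if "i > 1"
      using that \<open>x \<in> standard_simplex 1\<close> unfolding standard_simplex_1_iff by blast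
    consider "i = 0" | "i = 1" | "i > 1" by linarith
    then show "e (x 1) i = x i"
      using x x' unfolding e_def by cases simp_all
  qed
  then have "restrict (\<lambda>x. (\<sigma> \<circ> e) (x 1)) (standard_simplex 1) x = \<sigma> x" for x
    unfolding comp_def by (metis \<sigma>(2) extensional_arb restrict_apply)
  then have "restrict (\<lambda>x. (\<sigma> \<circ> e) (x 1)) (standard_simplex 1) = \<sigma>"
    by blast
  then show "Poly_Mapping.single \<sigma> 1 = seg (\<sigma> \<circ> e) 0 1"
    by (simp add: seg_def)
qed

text \<open>The standard simplex is identified with the triangle 0, 1, \<i> of the plane, a
  contractible set on which circle-valued maps have lifts.\<close>

lemma singular_simplex_2_cases:
  fixes \<sigma> :: "(nat \<Rightarrow> real) \<Rightarrow> 'a::topological_space"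
  assumes "singular_simplex 2 euclidean \<sigma>"
  obtains H :: "complex \<Rightarrow> 'a" where "continuous_on (convex hull {0, 1, \<i>}) H" "\<sigma> = triangle H 0 1 \<i>"
proof
  define e :: "complex \<Rightarrow> nat \<Rightarrow> real" where "e z =
    (\<lambda>i. if i = 0 then 1 - Re z - Im z else if i = 1 then Re z else if i = 2 then Im z else 0)" for z
  have \<sigma>: "continuous_on (standard_simplex 2) \<sigma>" "\<sigma> \<in> extensional (standard_simplex 2)"
    using assms by (simp_all add: singular_simplex_iff_continuous_on)
  have "e z \<in> standard_simplex 2" if "z \<in> convex hull {0, 1, \<i>}" for z
    using that by (auto simp: standard_simplex_2_iff e_def convex_hull_3)
  then have sub: "e ` (convex hull {0, 1, \<i>}) \<subseteq> standard_simplex 2"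
    by blast
  show "continuous_on (convex hull {0, 1, \<i>}) (\<sigma> \<circ> e)"
  proof (rule continuous_on_compose)
    show "continuous_on (convex hull {0, 1, \<i>}) e"
    proof (rule continuous_on_coordinatewise_then_product)
      show "continuous_on (convex hull {0, 1, \<i>}) (\<lambda>z. e z i)" for i
        unfolding e_def by (cases "i = 0"; cases "i = 1"; cases "i = 2") (auto intro!: continuous_intros)
    qed
    show "continuous_on (e ` (convex hull {0, 1, \<i>})) \<sigma>"
      by (rule continuous_on_subset[OF \<sigma>(1) sub])
  qed
  have "e (x 0 *\<^sub>R 0 + x 1 *\<^sub>R 1 + x 2 *\<^sub>R \<i>) = x" if "x \<in> standard_simplex 2" for x
  proof
    fix i :: nat
    have x: "1 - x 1 - x 2 = x 0"
      using that unfolding standard_simplex_2_iff by linarith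
    have x': "x i = 0" if "i > 2"
      using that \<open>x \<in> standard_simplex 2\<close> unfolding standard_simplex_2_iff by blast
    consider "i = 0" | "i = 1" | "i = 2" | "i > 2" by linarith
    then show "e (x 0 *\<^sub>R 0 + x 1 *\<^sub>R 1 + x 2 *\<^sub>R \<i>) i = x i"
      using x x' unfolding e_def by cases simp_all
  qed
  note e_eq = this
  show "\<sigma> = triangle (\<sigma> \<circ> e) 0 1 \<i>"
  proof
    fix x
    show "\<sigma> x = triangle (\<sigma> \<circ> e) 0 1 \<i> x"
    proof (cases "x \<in> standard_simplex 2")
      case True
      have "triangle (\<sigma> \<circ> e) 0 1 \<i> x = \<sigma> (e (x 0 *\<^sub>R 0 + x 1 *\<^sub>R 1 + x 2 *\<^sub>R \<i>))"
        unfolding triangle_def comp_def by (rule restrict_apply'[OF True])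
      also have "\<dots> = \<sigma> x"
        by (rule arg_cong[OF e_eq[OF True]])
      finally show ?thesis ..
    next
      case False
      then show ?thesis
        unfolding triangle_def restrict_def using extensional_arb[OF \<sigma>(2) False] by (simp only: if_False)
    qed
  qed
qed

declare One_nat_def [simp del]

section \<open>Linear maps on chains and cycles\<close>

lemma real_chain_expansion:
  fixes c :: "'b \<Rightarrow>\<^sub>0 real"
  shows "(\<Sum>x\<in>Poly_Mapping.keys c. Poly_Mapping.lookup c x *\<^sub>R Poly_Mapping.single x 1) = c"
proof (rule poly_mapping_eqI)
  fix y
  have "Poly_Mapping.lookup (\<Sum>x\<in>Poly_Mapping.keys c. Poly_Mapping.lookup c x *\<^sub>R Poly_Mapping.single x 1) y
      = (\<Sum>x\<in>Poly_Mapping.keys c. if x = y then Poly_Mapping.lookup c x else 0)"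
    unfolding lookup_sum by (intro sum.cong) (simp_all add: lookup_single when_def)
  also have "\<dots> = Poly_Mapping.lookup c y"
    by (simp add: in_keys_iff)
  finally show "Poly_Mapping.lookup (\<Sum>x\<in>Poly_Mapping.keys c. Poly_Mapping.lookup c x *\<^sub>R Poly_Mapping.single x 1) y
      = Poly_Mapping.lookup c y" .
qed

lemma linear_eq_on_chain:
  fixes c :: "'b \<Rightarrow>\<^sub>0 real"
  assumes "linear F" "linear G"
    and "\<And>x. x \<in> Poly_Mapping.keys c \<Longrightarrow> F (Poly_Mapping.single x 1) = G (Poly_Mapping.single x 1)"
  shows "F c = G c"
proof -
  have "F (\<Sum>x\<in>Poly_Mapping.keys c. Poly_Mapping.lookup c x *\<^sub>R Poly_Mapping.single x 1) =
      G (\<Sum>x\<in>Poly_Mapping.keys c. Poly_Mapping.lookup c x *\<^sub>R Poly_Mapping.single x 1)"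
    unfolding linear_sum[OF assms(1)] linear_sum[OF assms(2)] linear_scale[OF assms(1)] linear_scale[OF assms(2)]
    by (rule sum.cong) (simp_all add: assms(3))
  then show ?thesis
    by (simp add: real_chain_expansion)
qed

lemma boundary_seg:
  "real_boundary 1 (seg H a b) =
    Poly_Mapping.single (\<lambda>x\<in>standard_simplex 0. H b) 1 - Poly_Mapping.single (\<lambda>x\<in>standard_simplex 0. H a) 1"
proof -
  have x0: "x 0 = 1" if "x \<in> standard_simplex 0" for x
    using that by (simp add: standard_simplex_0)
  have face: "singular_face 1 k (\<lambda>x\<in>standard_simplex 1. H (x 0 *\<^sub>R a + x 1 *\<^sub>R b)) =
      restrict (\<lambda>x. H (simplical_face k x 0 *\<^sub>R a + simplical_face k x 1 *\<^sub>R b)) (standard_simplex 0)" if "k \<le> 1" for k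
    using that simplical_face_in_standard_simplex[of 1 k]
    by (fastforce simp: singular_face_def)
  have "singular_face 1 0 (\<lambda>x\<in>standard_simplex 1. H (x 0 *\<^sub>R a + x 1 *\<^sub>R b)) = (\<lambda>x\<in>standard_simplex 0. H b)"
    unfolding face[OF le0] by (rule restrict_ext) (simp add: simplical_face_def x0)
  moreover have "singular_face 1 1 (\<lambda>x\<in>standard_simplex 1. H (x 0 *\<^sub>R a + x 1 *\<^sub>R b)) = (\<lambda>x\<in>standard_simplex 0. H a)"
    unfolding face[OF order_refl] by (rule restrict_ext) (simp add: simplical_face_def x0)
  moreover have "{..1} = {0, 1::nat}"
    by auto
  ultimately show ?thesis
    by (simp add: real_boundary_def seg_def)
qed

lemma seg_in_cycles:
  fixes H :: "'e::real_normed_vector \<Rightarrow> 'a::topological_space"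
  assumes "continuous_on (closed_segment a b) H" "H a = H b"
  shows "seg H a b \<in> real_cycles1"
  using singular_simplex_seg[OF assms(1)] assms(2) by (simp add: real_cycles1_def boundary_seg)

text \<open>The endpoint formula makes \<Psi> factor through the boundary map. Homotopy invariance
  and the twist formula are both obtained by exhibiting a suitable \<open>E\<close>.\<close>

lemma linear_vanishes_on_cycles:
  fixes \<Psi> :: "'a::topological_space real_chain \<Rightarrow> 'v::real_vector"
  assumes \<Psi>: "linear \<Psi>"
    and E: "\<And>\<gamma> :: real \<Rightarrow> 'a. continuous_on {0..1} \<gamma> \<Longrightarrow> \<Psi> (seg \<gamma> 0 1) = E (\<gamma> 1) - E (\<gamma> 0)"
    and c: "c \<in> real_cycles1"
  shows "\<Psi> c = 0"
proof -
  \<comment> \<open>A 0-simplex is a function on a one-point set, and \<open>v\<close> evaluates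
    \<open>E\<close> at its only value.\<close>
  define v where "v = linear_extension (\<lambda>\<tau>. E (\<tau> (\<lambda>j::nat. if j = 0 then 1 else (0::real))))"
  have v: "linear v"
    by (simp add: v_def linear_linear_extension)
  have "\<Psi> c = (v \<circ> real_boundary 1) c"
  proof (rule linear_eq_on_chain[OF \<Psi> linear_compose[OF linear_real_boundary v]])
    fix \<sigma> assume "\<sigma> \<in> Poly_Mapping.keys c"
    then have "singular_simplex 1 euclidean \<sigma>"
      using c by (auto simp: real_cycles1_def real_chains_def)
    then obtain \<gamma> :: "real \<Rightarrow> 'a" where \<gamma>: "continuous_on {0..1} \<gamma>" "Poly_Mapping.single \<sigma> 1 = seg \<gamma> 0 1"
      by (rule singular_simplex_1_cases)
    show "\<Psi> (Poly_Mapping.single \<sigma> 1) = (v \<circ> real_boundary 1) (Poly_Mapping.single \<sigma> 1)"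
      unfolding \<gamma>(2) comp_def boundary_seg linear_diff[OF v] E[OF \<gamma>(1)]
      by (simp add: v_def standard_simplex_0)
  qed
  also have "\<dots> = 0"
    using c by (simp add: real_cycles1_def linear_0[OF v])
  finally show ?thesis .
qed

text \<open>The inclusion of homology into chains modulo boundaries. Identities between homology
  classes are proved after applying it, where open paths are available.\<close>

definition H1_class :: "'a::topological_space real_H1 \<Rightarrow> 'a chain_class"
  where "H1_class x = cls (rep_real_H1 x)"

lemma real_H1_cases:
  fixes x :: "'a::topological_space real_H1"
  obtains c where "c \<in> real_cycles1" "x = abs_real_H1 c"
  using Quotient3_rep_reflp[OF Quotient3_real_H1, of x] Quotient3_abs_rep[OF Quotient3_real_H1, of x]
  by (metis real_homologous_def)

lemma abs_real_H1_eq_iff: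
  assumes "c \<in> real_cycles1" "d \<in> real_cycles1"
  shows "abs_real_H1 c = abs_real_H1 d \<longleftrightarrow> cls c = cls d"
  using Quotient3_rel[OF Quotient3_real_H1, of c d] assms
  by (simp add: real_homologous_refl cls_eq_iff) (simp add: real_homologous_def)

lemma H1_class_abs: "c \<in> real_cycles1 \<Longrightarrow> H1_class (abs_real_H1 c) = cls c"
  using rep_abs_rsp_left[OF Quotient3_real_H1 real_homologous_refl, of c]
  by (simp add: H1_class_def cls_eq_iff) (simp add: real_homologous_def)

lemma H1_class_inject: "H1_class x = H1_class y \<longleftrightarrow> x = y"
  by (metis real_H1_cases H1_class_abs abs_real_H1_eq_iff)

lemma abs_real_H1_add:
  "c \<in> real_cycles1 \<Longrightarrow> d \<in> real_cycles1 \<Longrightarrow> abs_real_H1 c + abs_real_H1 d = abs_real_H1 (c + d)"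
  by (rule plus_real_H1.abs_eq) (simp_all add: real_homologous_refl)

lemma abs_real_H1_scaleR: "c \<in> real_cycles1 \<Longrightarrow> r *\<^sub>R abs_real_H1 c = abs_real_H1 (r *\<^sub>R c)"
  by (rule scaleR_real_H1.abs_eq) (simp_all add: real_homologous_refl)

lemma linear_on_H1:
  fixes \<Psi> :: "'a::topological_space real_H1 \<Rightarrow> 'v::real_vector"
  assumes "linear F" "\<And>c. c \<in> real_cycles1 \<Longrightarrow> \<Psi> (abs_real_H1 c) = F c"
  shows "linear \<Psi>"
proof (rule linearI)
  fix x y :: "'a real_H1" and r :: real
  obtain c d where c: "c \<in> real_cycles1" "x = abs_real_H1 c" and d: "d \<in> real_cycles1" "y = abs_real_H1 d"
    by (metis real_H1_cases)
  show "\<Psi> (x + y) = \<Psi> x + \<Psi> y"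
    using c d by (simp add: abs_real_H1_add assms(2) linear_add[OF assms(1)]
        subspace_add[OF subspace_real_cycles1])
  show "\<Psi> (r *\<^sub>R x) = r *\<^sub>R \<Psi> x"
    using c by (simp add: abs_real_H1_scaleR assms(2) linear_scale[OF assms(1)]
        subspace_scale[OF subspace_real_cycles1])
qed

lemma linear_H1_class: "linear H1_class"
  by (rule linear_on_H1[OF linear_cls H1_class_abs])

lemma real_chain_map_in_cycles:
  assumes "continuous_on UNIV f" "c \<in> real_cycles1"
  shows "real_chain_map 1 f c \<in> real_cycles1"
  using assms real_chain_map_in_chains[of f c 1] real_boundary_chain_map[of c 1 f]
  by (simp add: real_cycles1_def linear_0[OF linear_real_chain_map])

lemma H1_class_map:
  assumes "continuous_on UNIV f" "c \<in> real_cycles1"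
  shows "H1_class (H1_map f (abs_real_H1 c)) = cls (real_chain_map 1 f c)"
  using assms by (simp add: H1_map_abs H1_class_abs real_chain_map_in_cycles)

lemma real_chain_map_comp: "real_chain_map p (f \<circ> g) c = real_chain_map p f (real_chain_map p g c)"
proof -
  have "real_chain_map p (f \<circ> g) c = (real_chain_map p f \<circ> real_chain_map p g) c"
    by (rule linear_eq_on_chain[OF linear_real_chain_map linear_compose[OF linear_real_chain_map linear_real_chain_map]])
      (auto simp: real_chain_map_def simplex_map_def intro!: arg_cong[where f = "\<lambda>\<sigma>. Poly_Mapping.single \<sigma> 1"])
  then show ?thesis by simp
qed

lemma H1_map_comp:
  fixes f :: "'b::topological_space \<Rightarrow> 'c::topological_space" and g :: "'a::topological_space \<Rightarrow> 'b"
  assumes "continuous_on UNIV f" "continuous_on UNIV g"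
  shows "H1_map (f \<circ> g) = H1_map f \<circ> H1_map g"
proof
  fix x :: "'a real_H1"
  obtain c where c: "c \<in> real_cycles1" "x = abs_real_H1 c"
    by (rule real_H1_cases)
  have "continuous_on UNIV (f \<circ> g)"
    by (rule continuous_on_compose) (use assms in \<open>auto intro: continuous_on_subset\<close>)
  then show "H1_map (f \<circ> g) x = (H1_map f \<circ> H1_map g) x"
    using assms c by (simp add: H1_map_abs real_chain_map_in_cycles real_chain_map_comp)
qed

lemma H1_map_id: "H1_map id = id"
proof
  fix x :: "'a real_H1"
  obtain c where c: "c \<in> real_cycles1" "x = abs_real_H1 c"
    by (rule real_H1_cases)
  have "real_chain_map 1 id c = id c"
  proof (rule linear_eq_on_chain[OF linear_real_chain_map linear_id])
    fix \<sigma> assume "\<sigma> \<in> Poly_Mapping.keys c"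
    then have "\<sigma> \<in> extensional (standard_simplex 1)"
      using c by (auto simp: real_cycles1_def real_chains_def singular_simplex_def)
    then show "real_chain_map 1 id (Poly_Mapping.single \<sigma> 1) = id (Poly_Mapping.single \<sigma> 1)"
      by (simp add: real_chain_map_def simplex_map_def extensional_restrict)
  qed
  then show "H1_map id x = id x"
    using c by (simp add: H1_map_abs[OF continuous_on_id'] id_def[symmetric] H1_map_abs)
qed

text \<open>The endpoint term is the track of a point under the homotopy: by the square over
  \<gamma>, the paths \<open>g \<circ> \<gamma>\<close> and \<open>f \<circ> \<gamma>\<close> differ
  by the tracks of the two ends.\<close>

lemma H1_map_homotopic:
  fixes f g :: "'a::topological_space \<Rightarrow> 'b::topological_space"
  assumes "homotopic_with_canon Q UNIV UNIV f g"
  shows "H1_map f = H1_map g"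
proof
  fix x :: "'a real_H1"
  obtain c where c: "c \<in> real_cycles1" "x = abs_real_H1 c"
    by (rule real_H1_cases)
  have top_prod: "prod_topology (top_of_set {0..1}) (euclidean :: 'a topology) =
      top_of_set ({0..1::real} \<times> UNIV)"
    by (metis prod_topology_subtopology_eu subtopology_UNIV)
  obtain h :: "real \<times> 'a \<Rightarrow> 'b" where h: "continuous_on ({0..1} \<times> UNIV) h"
    "\<And>x. h (0, x) = f x" "\<And>x. h (1, x) = g x"
    using assms unfolding homotopic_with_def subtopology_UNIV top_prod by auto
  have "continuous_map euclidean euclidean f" "continuous_map euclidean euclidean g"
    using homotopic_with_imp_continuous_maps[OF assms] by simp_all
  then have fg: "continuous_on UNIV f" "continuous_on UNIV g"
    by simp_all
  define E where "E p = path_class (\<lambda>s. h (s, p)) 0 (1::real)" for p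
  have "cls (real_chain_map 1 g c) - cls (real_chain_map 1 f c) = 0"
  proof (rule linear_vanishes_on_cycles[OF _ _ c(1)])
    show "linear (\<lambda>c :: 'a real_chain. cls (real_chain_map 1 g c) - cls (real_chain_map 1 f c))"
      by (intro linear_compose_sub linear_compose[OF linear_real_chain_map linear_cls, unfolded comp_def])
    fix \<gamma> :: "real \<Rightarrow> 'a"
    assume \<gamma>: "continuous_on {0..1} \<gamma>"
    define K where "K z = h (fst z, \<gamma> (snd z))" for z :: "real \<times> real"
    have "continuous_on ({0..1} \<times> {0..1}) K"
      unfolding K_def
      by (rule continuous_on_compose2[OF h(1)]) (auto intro!: continuous_intros continuous_on_compose2[OF \<gamma>])
    then have "path_class K (0,0) (0,1) + path_class K (0,1) (1,1) =
        path_class K (0,0) (1,0) + path_class K (1,0) (1,1)"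
      by (rule path_class_square) (auto intro: convex_Times)
    moreover have "seg K (0,0) (0,1) = seg (f \<circ> \<gamma>) 0 1" "seg K (1,0) (1,1) = seg (g \<circ> \<gamma>) 0 1"
      "seg K (0,0) (1,0) = seg (\<lambda>s. h (s, \<gamma> 0)) 0 (1::real)" "seg K (0,1) (1,1) = seg (\<lambda>s. h (s, \<gamma> 1)) 0 (1::real)"
      by (rule seg_cong; simp add: K_def h)+
    ultimately show "cls (real_chain_map 1 g (seg \<gamma> 0 1)) - cls (real_chain_map 1 f (seg \<gamma> 0 1)) = E (\<gamma> 1) - E (\<gamma> 0)"
      unfolding E_def chain_map_seg by (simp add: algebra_simps)
  qed
  then have "H1_class (H1_map f x) = H1_class (H1_map g x)"
    using c fg by (simp add: H1_class_map)
  then show "H1_map f x = H1_map g x"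
    by (simp add: H1_class_inject)
qed

text \<open>The piece from 0 to \<open>a\<close> and its translate by one period are the same chain,
  so the base point of the loop can be moved.\<close>

lemma path_class_periodic:
  fixes \<gamma> :: "real \<Rightarrow> 'a::topological_space"
  assumes "continuous_on UNIV \<gamma>" "\<And>t. \<gamma> (t + 1) = \<gamma> t"
  shows "path_class \<gamma> a (a + 1) = path_class \<gamma> 0 1"
proof -
  have "seg \<gamma> 0 a = seg \<gamma> 1 (a + 1)"
  proof (rule seg_cong)
    fix t :: real
    show "\<gamma> ((1 - t) *\<^sub>R 0 + t *\<^sub>R a) = \<gamma> ((1 - t) *\<^sub>R 1 + t *\<^sub>R (a + 1))"
      using assms(2)[of "t * a"] by (simp add: algebra_simps)
  qed
  then show ?thesis
    using path_class_triangle[OF assms(1), of 0 a "a + 1"] path_class_triangle[OF assms(1), of 0 1 "a + 1"]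
    by simp (metis add.commute add_right_cancel)
qed

section \<open>Winding of cycles under a map to the circle\<close>

text \<open>Two lifts of the same circle-valued map differ by such a \<open>D\<close>; this is the
  uniqueness of lifts used throughout.\<close>

lemma constant_on_if_integer:
  fixes D :: "'e::topological_space \<Rightarrow> real"
  assumes "connected S" "continuous_on S D" "\<And>x. x \<in> S \<Longrightarrow> D x \<in> \<int>"
  shows "\<exists>n. \<forall>x\<in>S. D x = of_int n"
proof (cases "S = {}")
  case False
  then obtain x0 where x0: "x0 \<in> S" by blast
  have "D constant_on S"
  proof (rule continuous_discrete_range_constant[OF assms(1,2)])
    fix x assume "x \<in> S"
    have "1 \<le> norm (D y - D x)" if "y \<in> S" "D y \<noteq> D x" for y
      using assms(3)[OF \<open>x \<in> S\<close>] assms(3)[OF that(1)] that(2)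
      by (metis Ints_diff Ints_nonzero_abs_ge1 eq_iff_diff_eq_0 real_norm_def)
    then show "\<exists>e>0. \<forall>y. y \<in> S \<and> D y \<noteq> D x \<longrightarrow> e \<le> norm (D y - D x)"
      by (meson zero_less_one)
  qed
  then show ?thesis
    using assms(3)[OF x0] x0 by (metis Ints_cases constant_on_def)
qed simp

lemma cis_2pi_eq_iff: "cis (2 * pi * x) = cis (2 * pi * y) \<longleftrightarrow> x - y \<in> \<int>"
proof
  assume "cis (2 * pi * x) = cis (2 * pi * y)"
  then have "cos (2 * pi * (x - y)) = 1"
    by (simp add: right_diff_distrib cos_diff cis.ctr complex_eq_iff flip: power2_eq_square)
  then obtain n :: int where "2 * pi * (x - y) = of_int n * 2 * pi"
    by (auto simp: cos_one_2pi_int)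
  then have "x - y = of_int n"
    by simp
  then show "x - y \<in> \<int>" by simp
next
  assume "x - y \<in> \<int>"
  then obtain n :: int where "x = y + of_int n"
    by (metis Ints_cases add.commute diff_add_cancel)
  then show "cis (2 * pi * x) = cis (2 * pi * y)"
    by (simp add: distrib_left cis_mult[symmetric] cis_multiple_2pi)
qed

text \<open>A continuous logarithm exists on a contractible set. Its real part vanishes on values of
  modulus 1, so its imaginary part is a lift up to the factor 2 \<pi>.\<close>

lemma circle_lift:
  fixes f :: "'e::real_normed_vector \<Rightarrow> complex"
  assumes "continuous_on S f" "contractible S" "\<And>x. x \<in> S \<Longrightarrow> norm (f x) = 1"
  obtains L :: "'e \<Rightarrow> real" where "continuous_on S L" "\<And>x. x \<in> S \<Longrightarrow> f x = cis (2 * pi * L x)"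
proof -
  obtain g where g: "continuous_on S g" "\<And>x. x \<in> S \<Longrightarrow> f x = exp (g x)"
    using continuous_logarithm_on_contractible[OF assms(1,2)] assms(3) by (metis norm_zero zero_neq_one)
  show ?thesis
  proof
    show "continuous_on S (\<lambda>x. Im (g x) / (2 * pi))"
      by (intro continuous_intros g) simp
    fix x assume x: "x \<in> S"
    have "Re (g x) = 0"
      using assms(3)[OF x] g(2)[OF x] by simp
    then show "f x = cis (2 * pi * (Im (g x) / (2 * pi)))"
      using g(2)[OF x] by (simp add: exp_eq_polar)
  qed
qed

text \<open>Well defined since lifts differ by a constant; without a continuous lift the value is
  unspecified.\<close>

definition lift_increment :: "(real \<Rightarrow> complex) \<Rightarrow> real"
  where "lift_increment f = (THE d. \<exists>L. continuous_on {0..1} L \<and>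
    (\<forall>t\<in>{0..1}. f t = cis (2 * pi * L t)) \<and> d = L 1 - L (0::real))"

lemma lift_increment_eq:
  assumes L: "continuous_on {0..1} L" "\<And>t. t \<in> {0..1} \<Longrightarrow> f t = cis (2 * pi * L t)"
  shows "lift_increment f = L 1 - L 0"
  unfolding lift_increment_def
proof (rule the_equality)
  fix d assume "\<exists>L. continuous_on {0..1} L \<and> (\<forall>t\<in>{0..1}. f t = cis (2 * pi * L t)) \<and> d = L 1 - L (0::real)"
  then obtain M where M: "continuous_on {0..1} M" "\<And>t. t \<in> {0..1} \<Longrightarrow> f t = cis (2 * pi * M t)" "d = M 1 - M 0"
    by blast
  have "\<exists>n. \<forall>t\<in>{0..1}. M t - L t = of_int n"
    by (rule constant_on_if_integer)
      (use L M in \<open>auto intro!: continuous_intros simp flip: cis_2pi_eq_iff\<close>)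
  then have "M 1 - L 1 = M 0 - L 0"
    by (metis atLeastAtMost_iff order_refl zero_le_one)
  then show "d = L 1 - L 0"
    using M(3) by simp
qed (use L in blast)

text \<open>A singular 1-cochain: the pullback under \<open>q\<close> of a cochain representing a
  generator of the first cohomology of the circle. The inner function runs through the standard
  1-simplex as t goes from 0 to 1.\<close>

definition winding :: "('a \<Rightarrow> complex) \<Rightarrow> 'a real_chain \<Rightarrow> real"
  where "winding q = linear_extension (\<lambda>\<sigma>. lift_increment (\<lambda>t. q (\<sigma> (\<lambda>i. if i = 0 then 1 - t else if i = 1 then t else 0))))"

lemma linear_winding: "linear (winding q)"
  by (simp add: winding_def linear_linear_extension)

lemma winding_seg:
  assumes "continuous_on {0..1} L" "\<And>t. t \<in> {0..1} \<Longrightarrow> q (H ((1 - t) *\<^sub>R a + t *\<^sub>R b)) = cis (2 * pi * L t)"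
  shows "winding q (seg H a b) = L 1 - L 0"
proof -
  have "(\<lambda>i. if i = 0 then 1 - t else if i = 1 then t else 0) \<in> standard_simplex 1" if "t \<in> {0..1}" for t :: real
    using that by (auto simp: standard_simplex_1_iff simp del: One_nat_def)
  then show ?thesis
    unfolding winding_def seg_def linear_extension_single scaleR_one using assms
    by (intro lift_increment_eq) simp_all
qed

text \<open>On a singular triangle \<open>q \<circ> H\<close> has one lift \<open>L\<close> for all
  three edges, so their increments telescope to 0.\<close>

lemma winding_boundary:
  fixes q :: "'a::topological_space \<Rightarrow> complex"
  assumes q: "continuous_on UNIV q" "\<And>x. norm (q x) = 1" and c: "c \<in> real_boundaries1"
  shows "winding q c = 0"
proof -
  obtain e where e: "e \<in> real_chains 2" "c = real_boundary 2 e"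
    using c by (auto simp: real_boundaries1_def)
  have "(winding q \<circ> real_boundary 2) e = (\<lambda>_. 0) e"
  proof (rule linear_eq_on_chain[OF linear_compose[OF linear_real_boundary linear_winding] linear_zero])
    fix \<sigma> assume "\<sigma> \<in> Poly_Mapping.keys e"
    then have "singular_simplex 2 euclidean \<sigma>"
      using e by (auto simp: real_chains_def)
    then obtain H :: "complex \<Rightarrow> 'a" where H: "continuous_on (convex hull {0, 1, \<i>}) H" "\<sigma> = triangle H 0 1 \<i>"
      by (rule singular_simplex_2_cases)
    have "continuous_on (convex hull {0, 1, \<i>}) (\<lambda>z. q (H z))"
      by (rule continuous_on_compose2[OF q(1) H(1)]) simp
    then obtain L where L: "continuous_on (convex hull {0, 1, \<i>}) L"
      "\<And>z. z \<in> convex hull {0, 1, \<i>} \<Longrightarrow> q (H z) = cis (2 * pi * L z)"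
      using circle_lift[of "convex hull {0, 1, \<i>}" "\<lambda>z. q (H z)"] q(2) convex_imp_contractible[OF convex_convex_hull]
      by metis
    have w: "winding q (seg H a b) = L b - L a" if "a \<in> {0, 1, \<i>}" "b \<in> {0, 1, \<i>}" for a b
    proof -
      have ab: "a \<in> convex hull {0, 1, \<i>}" "b \<in> convex hull {0, 1, \<i>}"
        using that by (auto intro: hull_inc)
      have in_hull: "(1 - t) *\<^sub>R a + t *\<^sub>R b \<in> convex hull {0, 1, \<i>}" if "t \<in> {0..1}" for t
        using that ab convex_convex_hull[of "{0, 1, \<i>}"] by (simp add: convexD_alt)
      have "winding q (seg H a b) = L ((1 - 1) *\<^sub>R a + 1 *\<^sub>R b) - L ((1 - 0) *\<^sub>R a + 0 *\<^sub>R b)"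
        by (rule winding_seg) (auto intro!: continuous_on_compose2[OF L(1)] continuous_intros in_hull simp: L(2)[OF in_hull])
      then show ?thesis by simp
    qed
    show "(winding q \<circ> real_boundary 2) (Poly_Mapping.single \<sigma> 1) = 0"
      unfolding H(2) comp_def boundary_triangle
      by (simp add: linear_add[OF linear_winding] linear_diff[OF linear_winding] w)
  qed
  then show ?thesis
    by (simp add: e(2))
qed

definition H1_winding :: "('a::topological_space \<Rightarrow> complex) \<Rightarrow> 'a real_H1 \<Rightarrow> real"
  where "H1_winding q x = winding q (rep_real_H1 x)"

lemma H1_winding_abs:
  assumes q: "continuous_on UNIV q" "\<And>x. norm (q x) = 1" and c: "c \<in> real_cycles1"
  shows "H1_winding q (abs_real_H1 c) = winding q c"
proof -
  have "cls (rep_real_H1 (abs_real_H1 c)) = cls c"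
    using H1_class_abs[OF c] by (simp add: H1_class_def)
  then have "winding q (rep_real_H1 (abs_real_H1 c) - c) = 0"
    by (simp add: cls_eq_iff winding_boundary[OF q])
  then show ?thesis
    by (simp add: H1_winding_def linear_diff[OF linear_winding])
qed

lemma linear_H1_winding:
  assumes "continuous_on UNIV q" "\<And>x. norm (q x) = 1"
  shows "linear (H1_winding q)"
  by (rule linear_on_H1[OF linear_winding H1_winding_abs[OF assms]])

section \<open>Collapse and twist of an embedded annulus\<close>

definition closed_ring :: "complex set"
  where "closed_ring = {z. 1 \<le> norm z \<and> norm z \<le> 2}"

definition open_ring :: "complex set"
  where "open_ring = {z. 1 < norm z \<and> norm z < 2}"

lemma compact_closed_ring: "compact closed_ring"
proof -
  have "closed_ring = cball 0 2 - ball 0 1"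
    by (auto simp: closed_ring_def)
  then show ?thesis
    by (metis compact_cball compact_diff open_ball)
qed

lemma open_open_ring: "open open_ring"
  unfolding open_ring_def by (intro open_Collect_conj open_Collect_less continuous_intros)

lemma open_ring_subset: "open_ring \<subseteq> closed_ring"
  by (auto simp: open_ring_def closed_ring_def)

lemma mult_cis_closed_ring [simp]: "z * cis a \<in> closed_ring \<longleftrightarrow> z \<in> closed_ring"
  by (simp add: closed_ring_def norm_mult)

text \<open>In a mere Hausdorff space \<open>open_interior\<close> does not follow from
  \<open>homeo\<close>. It makes the complement of the open annulus closed, so that maps given on
  the annulus can be glued to maps given outside.\<close>

locale embedded_annulus =
  fixes \<phi> :: "complex \<Rightarrow> 'a::t2_space" and \<phi>' :: "'a \<Rightarrow> complex"
  assumes homeo: "homeomorphism closed_ring (\<phi> ` closed_ring) \<phi> \<phi>'"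
    and open_interior: "open (\<phi> ` open_ring)"
begin

text \<open>As the radius grows from 1 to 2 the value runs once around the circle. Both boundary
  circles go to 1, which makes the extension continuous, and the fibre over -1 is the core.\<close>

definition collapse :: "'a \<Rightarrow> complex"
  where "collapse p = (if p \<in> \<phi> ` closed_ring then cis (2 * pi * (norm (\<phi>' p) - 1)) else 1)"

definition core :: "real \<Rightarrow> 'a"
  where "core t = \<phi> (3 / 2 * cis (2 * pi * t))"

definition rot :: "'a \<Rightarrow> real \<Rightarrow> 'a"
  where "rot p a = (if p \<in> \<phi> ` closed_ring then \<phi> (\<phi>' p * cis (2 * pi * a)) else p)"

text \<open>The principal value in (-1/2, 1/2]. This lift of \<open>collapse\<close> is 0 off the
  annulus and continuous off the core.\<close>

definition angle :: "'a \<Rightarrow> real"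
  where "angle p = Arg (collapse p) / (2 * pi)"

lemma inv_phi [simp]: "z \<in> closed_ring \<Longrightarrow> \<phi>' (\<phi> z) = z"
  using homeo by (simp add: homeomorphism_def)

lemma phi_inv: "p \<in> \<phi> ` closed_ring \<Longrightarrow> \<phi> (\<phi>' p) = p"
  using homeomorphism_apply2[OF homeo] .

lemma inv_in: "p \<in> \<phi> ` closed_ring \<Longrightarrow> \<phi>' p \<in> closed_ring"
  by auto

lemma continuous_phi: "continuous_on closed_ring \<phi>"
  using homeo by (simp add: homeomorphism_def)

lemma continuous_inv: "continuous_on (\<phi> ` closed_ring) \<phi>'"
  using homeo by (simp add: homeomorphism_def)

lemma phi_in_interior_iff: "z \<in> closed_ring \<Longrightarrow> \<phi> z \<in> \<phi> ` open_ring \<longleftrightarrow> z \<in> open_ring"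
  using open_ring_subset inv_phi by (metis image_iff subsetD)

lemma closed_image: "closed (\<phi> ` closed_ring)"
  by (intro compact_imp_closed compact_continuous_image continuous_phi compact_closed_ring)

lemma boundary_norm:
  assumes "p \<in> \<phi> ` closed_ring" "p \<notin> \<phi> ` open_ring"
  shows "norm (\<phi>' p) = 1 \<or> norm (\<phi>' p) = 2"
proof -
  have "\<phi>' p \<in> closed_ring" "\<phi>' p \<notin> open_ring"
    using assms phi_in_interior_iff[of "\<phi>' p"] by (auto simp: phi_inv)
  then show ?thesis
    by (auto simp: closed_ring_def open_ring_def)
qed

text \<open>The closed annulus and the complement of the open one are closed and cover the surface.
  They overlap only in the two boundary circles, and only there must the formulas agree.\<close>

lemma continuous_ring_cases:
  fixes p :: "'e::topological_space \<Rightarrow> 'a" and F :: "'e \<Rightarrow> 'b::topological_space"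
  assumes p: "continuous_on K p"
    and F: "continuous_on {k \<in> K. p k \<in> \<phi> ` closed_ring} F" and G: "continuous_on K G"
    and eq: "\<And>k. k \<in> K \<Longrightarrow> p k \<in> \<phi> ` closed_ring \<Longrightarrow> p k \<notin> \<phi> ` open_ring \<Longrightarrow> F k = G k"
  shows "continuous_on K (\<lambda>k. if p k \<in> \<phi> ` closed_ring then F k else G k)"
proof -
  let ?S = "K \<inter> p -` (\<phi> ` closed_ring)" and ?T = "K \<inter> p -` (- \<phi> ` open_ring)"
  have K: "?S \<union> ?T = K"
    using open_ring_subset by blast
  have "continuous_on (?S \<union> ?T) (\<lambda>k. if p k \<in> \<phi> ` closed_ring then F k else G k)"
  proof (rule continuous_on_cases_local)
    show "closedin (top_of_set (?S \<union> ?T)) ?S"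
      unfolding K by (rule continuous_closedin_preimage[OF p closed_image])
    show "closedin (top_of_set (?S \<union> ?T)) ?T"
      unfolding K by (rule continuous_closedin_preimage[OF p]) (simp add: open_interior closed_Compl)
    show "continuous_on ?S F"
      using F by (rule continuous_on_subset) auto
    show "continuous_on ?T G"
      using G by (rule continuous_on_subset) auto
  qed (use eq in auto)
  then show ?thesis
    unfolding K .
qed

lemma continuous_inv_comp:
  assumes "continuous_on K p"
  shows "continuous_on {k \<in> K. p k \<in> \<phi> ` closed_ring} (\<lambda>k. \<phi>' (p k))"
  by (rule continuous_on_compose2[OF continuous_inv continuous_on_subset[OF assms]]) auto

lemma continuous_collapse: "continuous_on UNIV collapse"
proof -
  have "continuous_on UNIV (\<lambda>p. if p \<in> \<phi> ` closed_ring then cis (2 * pi * (norm (\<phi>' p) - 1)) else 1)"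
  proof (rule continuous_ring_cases)
    show "continuous_on {p \<in> UNIV. p \<in> \<phi> ` closed_ring} (\<lambda>p. cis (2 * pi * (norm (\<phi>' p) - 1)))"
      by (intro continuous_intros continuous_inv_comp)
    show "cis (2 * pi * (norm (\<phi>' p) - 1)) = 1" if "p \<in> \<phi> ` closed_ring" "p \<notin> \<phi> ` open_ring" for p
      using boundary_norm[OF that] by auto
  qed (auto intro: continuous_intros)
  then show ?thesis
    by (simp add: collapse_def[abs_def])
qed

lemma norm_collapse [simp]: "norm (collapse p) = 1"
  by (simp add: collapse_def)

text \<open>The amount of rotation may vary with the parameter \<open>k\<close>, not only with the
  point; it has to vanish off the open annulus to fit the identity there.\<close>

lemma continuous_rot:
  fixes p :: "'e::topological_space \<Rightarrow> 'a"
  assumes p: "continuous_on K p" and a: "continuous_on K a"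
    and "\<And>k. k \<in> K \<Longrightarrow> p k \<notin> \<phi> ` open_ring \<Longrightarrow> a k = 0"
  shows "continuous_on K (\<lambda>k. rot (p k) (a k))"
  unfolding rot_def
proof (rule continuous_ring_cases[OF p _ p])
  show "continuous_on {k \<in> K. p k \<in> \<phi> ` closed_ring} (\<lambda>k. \<phi> (\<phi>' (p k) * cis (2 * pi * a k)))"
    by (rule continuous_on_compose2[OF continuous_phi])
      (auto intro!: continuous_intros continuous_inv_comp[OF p] continuous_on_subset[OF a])
qed (use assms(3) in \<open>auto simp: phi_inv\<close>)

lemma cis_angle: "cis (2 * pi * angle p) = collapse p"
proof -
  have "collapse p \<noteq> 0"
    using norm_collapse[of p] by force
  then show ?thesis
    by (simp add: angle_def cis_Arg sgn_eq)
qed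

lemma angle_bounds: "- 1 / 2 < angle p" "angle p \<le> 1 / 2"
  using Arg_bounded[of "collapse p"] by (simp_all add: angle_def field_simps)

lemma collapse_eq_minus_one_iff: "collapse p = - 1 \<longleftrightarrow> (\<exists>z. norm z = 3 / 2 \<and> p = \<phi> z)"
proof
  assume *: "collapse p = - 1"
  then have p: "p \<in> \<phi> ` closed_ring"
    by (auto simp: collapse_def split: if_splits)
  then have "cis (2 * pi * (norm (\<phi>' p) - 1)) = cis (2 * pi * (1 / 2))"
    using * by (simp add: collapse_def)
  \<comment> \<open>This number lies in [-1/2, 1/2], which leaves only the integer 0.\<close>
  then have "norm (\<phi>' p) - 1 - 1 / 2 \<in> \<int>"
    by (simp only: cis_2pi_eq_iff)
  then obtain n :: int where n: "norm (\<phi>' p) - 1 - 1 / 2 = of_int n"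
    by (auto elim: Ints_cases)
  moreover have "1 \<le> norm (\<phi>' p)" "norm (\<phi>' p) \<le> 2"
    using inv_in[OF p] by (simp_all add: closed_ring_def)
  ultimately have "n = 0" by linarith
  with n have "norm (\<phi>' p) = 3 / 2" by simp
  then show "\<exists>z. norm z = 3 / 2 \<and> p = \<phi> z"
    using phi_inv[OF p] by metis
next
  assume "\<exists>z. norm z = 3 / 2 \<and> p = \<phi> z"
  then obtain z where z: "norm z = 3 / 2" "p = \<phi> z" by blast
  then have "z \<in> closed_ring"
    by (simp add: closed_ring_def)
  moreover have "2 * pi * (norm z - 1) = pi"
    unfolding z(1) by simp
  moreover have "collapse p = cis (2 * pi * (norm z - 1))"
    using z(2) \<open>z \<in> closed_ring\<close> by (simp add: collapse_def)
  ultimately show "collapse p = - 1"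
    by (metis cis_pi)
qed

lemma collapse_nonpos_iff: "collapse p \<in> \<real>\<^sub>\<le>\<^sub>0 \<longleftrightarrow> collapse p = - 1"
proof
  assume "collapse p \<in> \<real>\<^sub>\<le>\<^sub>0"
  then obtain r where r: "collapse p = of_real r" "r \<le> 0"
    by (auto elim: nonpos_Reals_cases)
  with norm_collapse[of p] have "r = - 1"
    by simp
  with r show "collapse p = - 1" by simp
qed simp

lemma continuous_angle:
  assumes "continuous_on K p" "\<And>k. k \<in> K \<Longrightarrow> collapse (p k) \<noteq> - 1"
  shows "continuous_on K (\<lambda>k. angle (p k))"
  unfolding angle_def
  by (intro continuous_intros continuous_on_compose2[OF continuous_collapse assms(1)])
    (use assms(2) in \<open>auto simp: collapse_nonpos_iff\<close>)

lemma rot_0 [simp]: "rot p 0 = p"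
  by (simp add: rot_def phi_inv)

lemma angle_outside: "p \<notin> \<phi> ` open_ring \<Longrightarrow> angle p = 0"
proof -
  assume p: "p \<notin> \<phi> ` open_ring"
  have "collapse p = 1"
    using boundary_norm[OF _ p] by (auto simp: collapse_def)
  then show ?thesis
    by (simp add: angle_def)
qed

lemma continuous_core: "continuous_on UNIV core"
  unfolding core_def
  by (rule continuous_on_compose2[OF continuous_phi])
    (auto intro!: continuous_intros simp: closed_ring_def norm_mult)

lemma cis_shift: "cis (2 * pi * (t + 1)) = cis (2 * pi * t)"
  by (simp add: cis_2pi_eq_iff)

text \<open>The ring between radius \<open>r\<close> and the core, cut open along a ray, is a
  square. Its two radial sides are the same path and cancel.\<close>

lemma circle_class:
  assumes "r \<in> {1..2}"
  shows "path_class (\<lambda>t. \<phi> (of_real r * cis (2 * pi * t))) 0 (1::real) = path_class core 0 1"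
proof -
  define K where "K z = \<phi> (of_real (fst z) * cis (2 * pi * snd z))" for z :: "real \<times> real"
  have "continuous_on ({1..2} \<times> UNIV) K"
    unfolding K_def
    by (rule continuous_on_compose2[OF continuous_phi])
      (auto intro!: continuous_intros simp: closed_ring_def norm_mult)
  then have "path_class K (r,0) (r,1) + path_class K (r,1) (3/2,1) =
      path_class K (r,0) (3/2,0) + path_class K (3/2,0) (3/2,1)"
    by (rule path_class_square) (use assms in \<open>auto intro: convex_Times\<close>)
  moreover have *: "(1 - t) *\<^sub>R (x, 0) + t *\<^sub>R (x, 1) = (x, t)" for x t :: real
    by (simp add: algebra_simps)
  have "seg K (r,0) (r,1) = seg (\<lambda>t. \<phi> (of_real r * cis (2 * pi * t))) 0 (1::real)"
    "seg K (3/2,0) (3/2,1) = seg core 0 1"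
    by (rule seg_cong; unfold *; simp add: K_def core_def)+
  moreover have "seg K (r,1) (3/2,1) = seg K (r,0) (3/2,0)"
    by (rule seg_cong) (simp add: K_def)
  ultimately show ?thesis
    by simp
qed

lemma circle_class_integer:
  assumes "r \<in> {1..2}" "n \<in> {0, 1}"
  shows "path_class (\<lambda>t. \<phi> (of_real r * cis (2 * pi * t))) a (a + n) = n *\<^sub>R path_class core 0 1"
proof -
  have "continuous_on UNIV (\<lambda>t. \<phi> (of_real r * cis (2 * pi * t)))"
    by (rule continuous_on_compose2[OF continuous_phi])
      (use assms in \<open>auto intro!: continuous_intros simp: closed_ring_def norm_mult\<close>)
  then have "path_class (\<lambda>t. \<phi> (of_real r * cis (2 * pi * t))) a (a + 1) = path_class core 0 1"
    using path_class_periodic[of "\<lambda>t. \<phi> (of_real r * cis (2 * pi * t))" a] circle_class[OF assms(1)]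
    by (simp add: cis_shift)
  then show ?thesis
    using assms(2) by (auto simp: path_class_trivial)
qed

text \<open>Both rotations end at the same point, so the arcs differ by an integral number of turns.
  With the principal angle in (-1/2, 1/2] and \<open>norm - 1\<close> in (0, 1), this number is 0 up
  to the core or 1 beyond it.\<close>

lemma rot_path_class:
  assumes "p \<in> \<phi> ` open_ring"
  shows "path_class (\<lambda>s. rot p (s * (norm (\<phi>' p) - 1))) 0 (1::real) =
    path_class (\<lambda>s. rot p (s * angle p)) 0 (1::real) + (norm (\<phi>' p) - 1 - angle p) *\<^sub>R path_class core 0 1"
proof -
  define z where "z = \<phi>' p"
  have p: "p \<in> \<phi> ` closed_ring"
    using assms open_ring_subset by blast
  have z: "1 < norm z" "norm z < 2"
    using assms open_ring_subset by (auto simp: z_def open_ring_def closed_ring_def)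
  define u where "u = Arg z / (2 * pi)"
  define C where "C t = \<phi> (of_real (norm z) * cis (2 * pi * t))" for t
  have zu: "z = of_real (norm z) * cis (2 * pi * u)"
    using rcis_cmod_Arg[of z] by (simp add: rcis_def u_def)
  have rot: "rot p a = C (u + a)" for a
    using p by (simp add: rot_def C_def z_def[symmetric] distrib_left cis_mult[symmetric] mult.assoc[symmetric] zu[symmetric])
  have seg: "seg (\<lambda>s. rot p (s * a)) 0 (1::real) = seg C u (u + a)" for a
    by (rule seg_cong) (simp add: rot algebra_simps)
  have C: "continuous_on UNIV C"
    unfolding C_def by (rule continuous_on_compose2[OF continuous_phi])
      (use z in \<open>auto intro!: continuous_intros simp: closed_ring_def norm_mult\<close>)
  define n where "n = norm z - 1 - angle p"
  have "cis (2 * pi * (norm z - 1)) = cis (2 * pi * angle p)"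
    using p by (simp add: cis_angle collapse_def z_def)
  then have "n \<in> \<int>"
    by (simp add: n_def cis_2pi_eq_iff)
  moreover have "- 1 / 2 < n" "n < 3 / 2"
    using angle_bounds[of p] z by (simp_all add: n_def)
  ultimately have n01: "n \<in> {0, 1}"
    by (elim Ints_cases) auto
  have "path_class C u (u + angle p) + path_class C (u + angle p) (u + angle p + n) =
      path_class C u (u + angle p + n)"
    by (rule path_class_triangle[OF C]) auto
  moreover have "path_class C (u + angle p) (u + angle p + n) = n *\<^sub>R path_class core 0 1"
    unfolding C_def by (rule circle_class_integer) (use z n01 in auto)
  moreover have "u + angle p + n = u + (norm z - 1)"
    by (simp add: n_def)
  ultimately show ?thesis
    unfolding z_def[symmetric] seg n_def[symmetric] by simp
qed

text \<open>Off the core the twist is isotopic to the identity by rotations through the principal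
  \<open>angle\<close>, and near the core by rotations through \<open>norm - 1\<close>. The two rotations trace different
  arcs, which accounts for the multiple of the core.\<close>

lemma twist_path:
  fixes \<gamma> :: "real \<Rightarrow> 'a"
  assumes h: "continuous_on UNIV h" "\<And>p. h p = rot p (angle p)"
    and \<gamma>: "continuous_on {0..1} \<gamma>"
    and L: "continuous_on {0..1} L" "\<And>t. t \<in> {0..1} \<Longrightarrow> collapse (\<gamma> t) = cis (2 * pi * L t)"
  defines "D \<equiv> \<lambda>p. path_class (\<lambda>s. rot p (s * angle p)) 0 (1::real)"
  shows "path_class (h \<circ> \<gamma>) 0 1 - path_class \<gamma> 0 1 = D (\<gamma> 1) - D (\<gamma> 0)
    + ((L 1 - L 0) - (angle (\<gamma> 1) - angle (\<gamma> 0))) *\<^sub>R path_class core 0 1"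
proof -
  \<comment> \<open>The claim on a subinterval, vacuous unless it lies in [0, 1]:
    \<open>Bolzano\<close> quantifies over all short intervals around a point, also over those
    leaving [0, 1].\<close>
  define P where "P a b \<longleftrightarrow> (0 \<le> a \<and> a \<le> b \<and> b \<le> 1 \<longrightarrow>
    path_class (h \<circ> \<gamma>) a b - path_class \<gamma> a b = D (\<gamma> b) - D (\<gamma> a)
    + ((L b - L a) - (angle (\<gamma> b) - angle (\<gamma> a))) *\<^sub>R path_class core 0 1)" for a b
  have h\<gamma>: "continuous_on {0..1} (h \<circ> \<gamma>)"
    by (intro continuous_on_compose \<gamma> continuous_on_subset[OF h(1)]) simp
  \<comment> \<open>Rotation through \<open>s * \<alpha> t\<close> is a homotopy from \<gamma> to
    \<open>h \<circ> \<gamma>\<close>, for any continuous choice \<alpha> of the amount of rotation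
    over the subinterval.\<close>
  have square: "path_class \<gamma> a b + path_class (\<lambda>s. rot (\<gamma> b) (s * \<alpha> b)) 0 (1::real) =
      path_class (\<lambda>s. rot (\<gamma> a) (s * \<alpha> a)) 0 (1::real) + path_class (h \<circ> \<gamma>) a b"
    if ab: "a \<le> b" "{a..b} \<subseteq> {0..1}" and \<alpha>: "continuous_on {a..b} \<alpha>"
      "\<And>t. t \<in> {a..b} \<Longrightarrow> rot (\<gamma> t) (\<alpha> t) = h (\<gamma> t)"
      "\<And>t. t \<in> {a..b} \<Longrightarrow> \<gamma> t \<notin> \<phi> ` open_ring \<Longrightarrow> \<alpha> t = 0" for a b \<alpha>
  proof -
    define K where "K z = rot (\<gamma> (snd z)) (fst z * \<alpha> (snd z))" for z :: "real \<times> real"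
    have "continuous_on ({0..1} \<times> {a..b}) K"
      unfolding K_def
      by (rule continuous_rot)
        (use \<alpha>(3) ab in \<open>auto intro!: continuous_intros continuous_on_compose2[OF \<gamma>] continuous_on_compose2[OF \<alpha>(1)]\<close>)
    then have "path_class K (0,a) (0,b) + path_class K (0,b) (1,b) =
        path_class K (0,a) (1,a) + path_class K (1,a) (1,b)"
      by (rule path_class_square) (use ab in \<open>auto intro: convex_Times\<close>)
    moreover have "seg K (0,a) (0,b) = seg \<gamma> a b"
      "seg K (0,a) (1,a) = seg (\<lambda>s. rot (\<gamma> a) (s * \<alpha> a)) 0 (1::real)"
      "seg K (0,b) (1,b) = seg (\<lambda>s. rot (\<gamma> b) (s * \<alpha> b)) 0 (1::real)"
      by (rule seg_cong; simp add: K_def algebra_simps)+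
    moreover have "seg K (1,a) (1,b) = seg (h \<circ> \<gamma>) a b"
    proof (rule seg_cong)
      fix t :: real assume "0 \<le> t" "t \<le> 1"
      then have "(1 - t) *\<^sub>R a + t *\<^sub>R b \<in> {a..b}"
        using ab convexD_alt[of "{a..b}" a b t] by simp
      from \<alpha>(2)[OF this] show "K ((1 - t) *\<^sub>R (1, a) + t *\<^sub>R (1, b)) = (h \<circ> \<gamma>) ((1 - t) *\<^sub>R a + t *\<^sub>R b)"
        by (simp add: K_def)
    qed
    ultimately show ?thesis
      by simp
  qed
  have local_open: "\<exists>d>0. \<forall>t\<in>{0..1}. dist t x < d \<longrightarrow> \<gamma> t \<in> U"
    if "open U" "x \<in> {0..1}" "\<gamma> x \<in> U" for U x
    using continuous_openin_preimage_gen[OF \<gamma> \<open>open U\<close>] that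
    unfolding openin_euclidean_subtopology_iff by blast
  have "P 0 1"
  proof (rule Bolzano)
    fix a b c :: real
    assume *: "P a b" "P b c" "a \<le> b" "b \<le> c"
    show "P a c"
    proof (cases "0 \<le> a \<and> c \<le> 1")
      case True
      have "path_class \<gamma> a b + path_class \<gamma> b c = path_class \<gamma> a c"
        "path_class (h \<circ> \<gamma>) a b + path_class (h \<circ> \<gamma>) b c = path_class (h \<circ> \<gamma>) a c"
        by (rule path_class_triangle[OF \<gamma>] path_class_triangle[OF h\<gamma>]; use True * in simp)+
      then have "path_class (h \<circ> \<gamma>) a c - path_class \<gamma> a c =
          (path_class (h \<circ> \<gamma>) a b - path_class \<gamma> a b) + (path_class (h \<circ> \<gamma>) b c - path_class \<gamma> b c)"
        by (simp add: algebra_simps flip: \<open>path_class \<gamma> a b + path_class \<gamma> b c = path_class \<gamma> a c\<close>)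
      also have "\<dots> = D (\<gamma> c) - D (\<gamma> a)
          + ((L c - L a) - (angle (\<gamma> c) - angle (\<gamma> a))) *\<^sub>R path_class core 0 1"
        using * True by (simp add: P_def scaleR_left_diff_distrib)
      finally show ?thesis
        by (simp add: P_def)
    next
      case False
      with * show ?thesis
        unfolding P_def by (meson order_trans)
    qed
  next
    fix x :: real assume x: "0 \<le> x" "x \<le> 1"
    show "\<exists>d>0. \<forall>a b. a \<le> x \<and> x \<le> b \<and> b - a < d \<longrightarrow> P a b"
    proof (cases "collapse (\<gamma> x) = - 1")
      \<comment> \<open>Off the core the principal angle is a continuous choice. There
        \<open>L - angle\<close> is a constant integer, so the coefficient of the core is 0.\<close>
      case False
      have "open {p. collapse p \<noteq> - 1}"
        by (intro open_Collect_neq continuous_collapse continuous_intros)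
      then obtain d where d: "d > 0" "\<And>t. t \<in> {0..1} \<Longrightarrow> dist t x < d \<Longrightarrow> collapse (\<gamma> t) \<noteq> - 1"
        using local_open[of "{p. collapse p \<noteq> - 1}" x] False x by auto
      have "P a b" if ab: "a \<le> x" "x \<le> b" "b - a < d" for a b
        unfolding P_def
      proof
        assume ab': "0 \<le> a \<and> a \<le> b \<and> b \<le> 1"
        have off: "collapse (\<gamma> t) \<noteq> - 1" if "t \<in> {a..b}" for t
          using that ab ab' by (intro d(2)) (auto simp: dist_real_def)
        have \<gamma>ab: "continuous_on {a..b} \<gamma>" and Lab: "continuous_on {a..b} L"
          using ab' by (auto intro: continuous_on_subset[OF \<gamma>] continuous_on_subset[OF L(1)])
        have cont: "continuous_on {a..b} (\<lambda>t. angle (\<gamma> t))"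
          by (rule continuous_angle[OF \<gamma>ab off])
        have "path_class \<gamma> a b + D (\<gamma> b) = D (\<gamma> a) + path_class (h \<circ> \<gamma>) a b"
          unfolding D_def using ab' by (intro square cont) (auto simp: h(2) angle_outside)
        moreover have "\<exists>n. \<forall>t\<in>{a..b}. L t - angle (\<gamma> t) = of_int n"
        proof (rule constant_on_if_integer)
          fix t assume "t \<in> {a..b}"
          with ab' L(2)[of t] show "L t - angle (\<gamma> t) \<in> \<int>"
            by (simp add: cis_angle flip: cis_2pi_eq_iff)
        qed (auto intro!: continuous_intros Lab cont)
        then have "L b - angle (\<gamma> b) = L a - angle (\<gamma> a)"
          using ab' by auto
        ultimately show "path_class (h \<circ> \<gamma>) a b - path_class \<gamma> a b = D (\<gamma> b) - D (\<gamma> a)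
            + ((L b - L a) - (angle (\<gamma> b) - angle (\<gamma> a))) *\<^sub>R path_class core 0 1"
          by (simp add: algebra_simps)
      qed
      with d(1) show ?thesis by blast
    next
      \<comment> \<open>At the core the radius gives the continuous choice. It lifts
        \<open>collapse\<close> too, hence has the increment of \<open>L\<close>, and
        \<open>rot_path_class\<close> turns its end tracks into those for the principal
        angle.\<close>
      case True
      then have "\<gamma> x \<in> \<phi> ` open_ring"
        by (auto simp: collapse_eq_minus_one_iff open_ring_def)
      then obtain d where d: "d > 0" "\<And>t. t \<in> {0..1} \<Longrightarrow> dist t x < d \<Longrightarrow> \<gamma> t \<in> \<phi> ` open_ring"
        using local_open[OF open_interior, of x] x by auto
      have "P a b" if ab: "a \<le> x" "x \<le> b" "b - a < d" for a b
        unfolding P_def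
      proof
        assume ab': "0 \<le> a \<and> a \<le> b \<and> b \<le> 1"
        define r where "r t = norm (\<phi>' (\<gamma> t)) - 1" for t
        have inside: "\<gamma> t \<in> \<phi> ` open_ring" if "t \<in> {a..b}" for t
          using that ab ab' by (intro d(2)) (auto simp: dist_real_def)
        have inside': "\<gamma> t \<in> \<phi> ` closed_ring" if "t \<in> {a..b}" for t
          using inside[OF that] open_ring_subset by blast
        have \<gamma>ab: "continuous_on {a..b} \<gamma>" and Lab: "continuous_on {a..b} L"
          using ab' by (auto intro: continuous_on_subset[OF \<gamma>] continuous_on_subset[OF L(1)])
        have cont: "continuous_on {a..b} r"
          unfolding r_def
          by (intro continuous_intros continuous_on_compose2[OF continuous_inv \<gamma>ab]) (use inside' in auto)
        have collapse_r: "collapse (\<gamma> t) = cis (2 * pi * r t)" if "t \<in> {a..b}" for t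
          using inside'[OF that] by (simp add: collapse_def r_def)
        have rot_r: "rot (\<gamma> t) (r t) = h (\<gamma> t)" if "t \<in> {a..b}" for t
          using inside'[OF that] collapse_r[OF that] by (simp add: h(2) rot_def cis_angle)
        define D' where "D' t = path_class (\<lambda>s. rot (\<gamma> t) (s * r t)) 0 (1::real)" for t
        have "path_class \<gamma> a b + D' b = D' a + path_class (h \<circ> \<gamma>) a b"
          unfolding D'_def using ab' inside by (intro square cont rot_r) auto
        then have "path_class (h \<circ> \<gamma>) a b - path_class \<gamma> a b = D' b - D' a"
          by (simp add: algebra_simps)
        moreover have D': "D' t = D (\<gamma> t) + (r t - angle (\<gamma> t)) *\<^sub>R path_class core 0 1" if "t \<in> {a..b}" for t
          unfolding D'_def D_def r_def using rot_path_class[OF inside[OF that]] by simp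
        have "D' a = D (\<gamma> a) + (r a - angle (\<gamma> a)) *\<^sub>R path_class core 0 1"
          "D' b = D (\<gamma> b) + (r b - angle (\<gamma> b)) *\<^sub>R path_class core 0 1"
          using ab' by (auto intro: D')
        moreover have "\<exists>n. \<forall>t\<in>{a..b}. L t - r t = of_int n"
        proof (rule constant_on_if_integer)
          fix t assume "t \<in> {a..b}"
          with ab' L(2)[of t] collapse_r[of t] show "L t - r t \<in> \<int>"
            by (simp flip: cis_2pi_eq_iff)
        qed (auto intro!: continuous_intros Lab cont)
        then obtain n where "\<forall>t\<in>{a..b}. L t - r t = of_int n"
          by blast
        then have "L a - r a = of_int n" "L b - r b = of_int n"
          using ab' by auto
        then have "L b - L a = r b - r a"
          by simp
        ultimately show "path_class (h \<circ> \<gamma>) a b - path_class \<gamma> a b = D (\<gamma> b) - D (\<gamma> a)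
            + ((L b - L a) - (angle (\<gamma> b) - angle (\<gamma> a))) *\<^sub>R path_class core 0 1"
          by (simp only: scaleR_left_diff_distrib) simp
      qed
      with d(1) show ?thesis by blast
    qed
  qed simp
  then show ?thesis
    by (simp add: P_def)
qed

definition core_H1 :: "'a real_H1"
  where "core_H1 = abs_real_H1 (seg core 0 1)"

lemma core_in_cycles: "seg core 0 1 \<in> real_cycles1"
  by (rule seg_in_cycles) (rule continuous_on_subset[OF continuous_core], simp, simp add: core_def)

lemma H1_map_twist:
  assumes h: "continuous_on UNIV h"
    and twist: "\<And>z. z \<in> closed_ring \<Longrightarrow> h (\<phi> z) = \<phi> (z * cis (2 * pi * (norm z - 1)))"
    and outside: "\<And>x. x \<notin> \<phi> ` closed_ring \<Longrightarrow> h x = x"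
  shows "H1_map h x = x + H1_winding collapse x *\<^sub>R core_H1"
proof -
  obtain c where c: "c \<in> real_cycles1" "x = abs_real_H1 c"
    by (rule real_H1_cases)
  have h_rot: "h p = rot p (angle p)" for p
    using twist outside by (auto simp: rot_def cis_angle collapse_def)
  \<comment> \<open>End tracks and principal angles depend on the endpoints only. Collected in
    \<open>E\<close> they drop out on cycles, and the winding remains.\<close>
  define E where "E p = path_class (\<lambda>s. rot p (s * angle p)) 0 (1::real) - angle p *\<^sub>R path_class core 0 1" for p
  define \<Psi> where "\<Psi> c = cls (real_chain_map 1 h c) - cls c - winding collapse c *\<^sub>R path_class core 0 1" for c
  have "\<Psi> c = 0"
  proof (rule linear_vanishes_on_cycles[OF _ _ c(1)])
    have "linear (\<lambda>c. winding collapse c *\<^sub>R path_class core 0 1)"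
      using linear_compose[OF linear_winding[of collapse] linear_scaleR_left[of "path_class core 0 1"]] by (simp add: comp_def)
    then show "linear \<Psi>"
      unfolding \<Psi>_def
      by (intro linear_compose_sub linear_compose[OF linear_real_chain_map linear_cls, unfolded comp_def] linear_cls)
    fix \<gamma> :: "real \<Rightarrow> 'a"
    assume \<gamma>: "continuous_on {0..1} \<gamma>"
    have "continuous_on {0..1} (\<lambda>t. collapse (\<gamma> t))"
      by (rule continuous_on_compose2[OF continuous_collapse \<gamma>]) simp
    then obtain L where L: "continuous_on {0..1} L" "\<And>t. t \<in> {0..1} \<Longrightarrow> collapse (\<gamma> t) = cis (2 * pi * L t)"
      by (rule circle_lift) (auto intro: convex_imp_contractible)
    have w: "winding collapse (seg \<gamma> 0 1) = L 1 - L 0"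
      by (rule winding_seg[OF L(1)]) (use L(2) in simp)
    show "\<Psi> (seg \<gamma> 0 1) = E (\<gamma> 1) - E (\<gamma> 0)"
      unfolding \<Psi>_def E_def chain_map_seg w
      using twist_path[OF h h_rot \<gamma> L] by (simp add: scaleR_left_diff_distrib)
  qed
  then have "H1_class (H1_map h x) = H1_class (x + H1_winding collapse x *\<^sub>R core_H1)"
    using c h by (simp add: \<Psi>_def H1_class_map linear_add[OF linear_H1_class] linear_scale[OF linear_H1_class]
        H1_class_abs core_H1_def core_in_cycles H1_winding_abs[OF continuous_collapse norm_collapse] algebra_simps)
  then show ?thesis
    by (simp add: H1_class_inject)
qed

lemmas linear_collapse_winding = linear_H1_winding[OF continuous_collapse norm_collapse]

end

section \<open>Local degree in the plane\<close>

text \<open>Two continuous logarithms of the same path differ by a constant, so any explicit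
  logarithm computes the winding number.\<close>

lemma winding_number_log:
  assumes q: "path q" and p: "\<And>t. t \<in> {0..1} \<Longrightarrow> p t = \<zeta> + exp (q t)"
  shows "2 * of_real pi * \<i> * winding_number p \<zeta> = q 1 - q 0"
proof -
  have cont: "continuous_on {0..1} p"
    using q by (subst continuous_on_cong[OF HOL.refl p]) (auto simp: path_def intro!: continuous_intros)
  then have "path p" "\<zeta> \<notin> path_image p"
    using p by (auto simp: path_def path_image_def)
  then obtain l where l: "path l" "pathfinish l - pathstart l = 2 * of_real pi * \<i> * winding_number p \<zeta>"
    "\<And>t. t \<in> {0..1} \<Longrightarrow> p t = \<zeta> + exp (l t)"
    by (rule winding_number_as_continuous_log) blast
  have exp: "exp (l t) = exp (q t)" if "t \<in> {0..1}" for t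
    using l(3)[OF that] p[OF that] by simp
  have "\<exists>n. \<forall>t\<in>{0..1}. Im (l t - q t) / (2 * pi) = of_int n"
  proof (rule constant_on_if_integer)
    fix t :: real assume "t \<in> {0..1}"
    from exp[OF this] obtain n :: int where "l t = q t + of_int (2 * n) * of_real pi * \<i>"
      by (auto simp: exp_eq)
    then show "Im (l t - q t) / (2 * pi) \<in> \<int>"
      by simp
  qed (use q l(1) in \<open>auto simp: path_def intro!: continuous_intros\<close>)
  then obtain n where n: "\<forall>t\<in>{0..1}. Im (l t - q t) / (2 * pi) = of_int n" ..
  have "Im (l 1 - q 1) / (2 * pi) = Im (l 0 - q 0) / (2 * pi)"
    by (rule HOL.trans[OF bspec[OF n] bspec[OF n, symmetric]]) simp_all
  then have "Im (l 1 - q 1) = Im (l 0 - q 0)"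
    by simp
  moreover have "Re (l t) = Re (q t)" if "t \<in> {0..1}" for t
    using exp[OF that] by (metis norm_exp_eq_Re exp_inj_iff)
  then have "Re (l 1) = Re (q 1)" "Re (l 0) = Re (q 0)"
    by simp_all
  ultimately have "l 1 - l 0 = q 1 - q 0"
    by (simp add: complex_eq_iff)
  then show ?thesis
    using l(2) by (simp add: pathstart_def pathfinish_def)
qed

lemma winding_number_circle:
  assumes "c \<noteq> 0"
  shows "winding_number (\<lambda>t. w + c * exp (2 * of_real pi * \<i> * of_real t)) w = 1"
proof -
  have "2 * of_real pi * \<i> * winding_number (\<lambda>t. w + c * exp (2 * of_real pi * \<i> * of_real t)) w
      = (Ln c + 2 * of_real pi * \<i> * of_real 1) - (Ln c + 2 * of_real pi * \<i> * of_real 0)"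
    by (rule winding_number_log[where q = "\<lambda>t. Ln c + 2 * of_real pi * \<i> * of_real t"])
      (auto simp: path_def exp_add assms intro!: continuous_intros)
  then show ?thesis by simp
qed

lemma winding_number_reversed_circle:
  assumes "c \<noteq> 0"
  shows "winding_number (\<lambda>t. w + c * exp (- (2 * of_real pi * \<i> * of_real t))) w = - 1"
proof -
  have "2 * of_real pi * \<i> * winding_number (\<lambda>t. w + c * exp (- (2 * of_real pi * \<i> * of_real t))) w
      = (Ln c - 2 * of_real pi * \<i> * of_real 1) - (Ln c - 2 * of_real pi * \<i> * of_real 0)"
    by (rule winding_number_log[where q = "\<lambda>t. Ln c - 2 * of_real pi * \<i> * of_real t"])
      (auto simp: path_def exp_add[of "Ln c" "- _", simplified] assms intro!: continuous_intros)
  then have "2 * of_real pi * \<i> * winding_number (\<lambda>t. w + c * exp (- (2 * of_real pi * \<i> * of_real t))) w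
      = 2 * of_real pi * \<i> * (- 1)"
    by simp
  then show ?thesis
    by (simp only: mult_cancel_left) simp
qed

lemma eventually_at_right_0_small:
  assumes "0 < (d::real)"
  shows "\<forall>\<^sub>F r in at_right 0. 0 < r \<and> r < d"
  using eventually_at_right_real[OF assms] by simp

lemma orientation_preserving_at_radius:
  assumes "orientation_preserving_at f z" "0 < d"
  obtains r where "0 < r" "r < d" "winding_number (f \<circ> circlepath z r) (f z) = 1"
proof -
  have "\<forall>\<^sub>F r in at_right 0. (0 < r \<and> r < d) \<and> winding_number (f \<circ> circlepath z r) (f z) = 1"
    using eventually_conj[OF eventually_at_right_0_small[OF assms(2)]] assms(1)
    by (simp only: orientation_preserving_at_def)
  then have "\<exists>r. (0 < r \<and> r < d) \<and> winding_number (f \<circ> circlepath z r) (f z) = 1"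
    using eventually_happens by fastforce
  then show ?thesis
    using that by blast
qed

lemma orientation_preserving_at_cong:
  assumes "d > 0" "\<And>x. x \<in> ball z d \<Longrightarrow> f x = g x" "orientation_preserving_at f z"
  shows "orientation_preserving_at g z"
proof -
  have "\<forall>\<^sub>F r in at_right 0. 0 < r \<and> r < d"
    using assms(1) by (rule eventually_at_right_0_small)
  moreover have "\<forall>\<^sub>F r in at_right 0. winding_number (f \<circ> circlepath z r) (f z) = 1"
    using assms(3) by (simp add: orientation_preserving_at_def)
  ultimately show ?thesis
    unfolding orientation_preserving_at_def
  proof eventually_elim
    case (elim r)
    have "f \<circ> circlepath z r = g \<circ> circlepath z r"
      using assms(2) elim by (auto simp: circlepath dist_norm norm_mult fun_eq_iff)
    moreover have "f z = g z"
      using assms(1,2) by simp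
    ultimately show ?case
      using elim by simp
  qed
qed

lemma path_comp_circlepath:
  assumes "continuous_on (cball z r) f" "0 \<le> r"
  shows "path (f \<circ> circlepath z r)" "pathfinish (f \<circ> circlepath z r) = pathstart (f \<circ> circlepath z r)"
proof -
  have "circlepath z r ` {0..1} \<subseteq> cball z r"
    using assms(2) by (auto simp: circlepath dist_norm norm_mult)
  then show "path (f \<circ> circlepath z r)"
    using path_circlepath[of z r] unfolding path_def
    by (intro continuous_on_compose) (auto intro: continuous_on_subset[OF assms(1)])
  show "pathfinish (f \<circ> circlepath z r) = pathstart (f \<circ> circlepath z r)"
    by (simp add: pathfinish_def pathstart_def circlepath exp_eq_1)
qed

text \<open>On a small circle the error of the linear approximation is at most half the size of the
  linear term, so the image loop winds like the circle \<open>g\<close>.\<close>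

lemma orientation_preserving_at_deriv:
  assumes f: "d > 0" "continuous_on (ball z d) f" "(f has_field_derivative c) (at z)" "c \<noteq> 0"
  shows "orientation_preserving_at f z"
proof -
  have "\<forall>\<^sub>F y in nhds z. norm (f y - f z - c * (y - z)) \<le> norm c / 2 * norm (y - z)"
    using f(3,4) unfolding has_field_derivative_def has_derivative_within_alt2
    by (auto simp: mult.commute dest!: spec[of _ "norm c / 2"] simp: eventually_at_filter elim!: eventually_mono)
  then obtain e where e: "e > 0"
    "\<And>y. dist y z < e \<Longrightarrow> norm (f y - f z - c * (y - z)) \<le> norm c / 2 * norm (y - z)"
    unfolding eventually_nhds_metric by blast
  have "\<forall>\<^sub>F r in at_right 0. 0 < r \<and> r < min d e"
    using f(1) e(1) by (intro eventually_at_right_0_small) simp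
  then show ?thesis
    unfolding orientation_preserving_at_def
  proof eventually_elim
    case (elim r)
    define g where "g t = f z + c * of_real r * exp (2 * of_real pi * \<i> * of_real t)" for t
    have "winding_number (f \<circ> circlepath z r) (f z) = winding_number g (f z)"
    proof (rule winding_number_nearby_loops_eq)
      show "path (f \<circ> circlepath z r)" "pathfinish (f \<circ> circlepath z r) = pathstart (f \<circ> circlepath z r)"
        using elim by (auto intro!: path_comp_circlepath continuous_on_subset[OF f(2)])
      show "path g" "pathfinish g = pathstart g"
        by (auto simp: g_def path_def pathfinish_def pathstart_def exp_eq_1 intro!: continuous_intros)
      fix t :: real
      define y where "y = circlepath z r t"
      have y: "norm (y - z) = r"
        using elim by (simp add: y_def circlepath norm_mult)
      have "norm ((f \<circ> circlepath z r) t - g t) = norm (f y - f z - c * (y - z))"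
        by (simp add: g_def y_def circlepath algebra_simps)
      also have "\<dots> \<le> norm c / 2 * r"
        using e(2)[of y] y elim by (simp add: dist_norm)
      also have "\<dots> < norm (g t - f z)"
        using f(4) elim by (simp add: g_def norm_mult)
      finally show "norm ((f \<circ> circlepath z r) t - g t) < norm (g t - f z)" .
    qed
    then show ?case
      using winding_number_circle[of "c * of_real r" "f z"] f(4) elim by (simp add: g_def[abs_def])
  qed
qed

text \<open>The radial retraction \<open>\<rho>\<close> of the punctured plane onto the punctured
  disc carries the homotopy into the disc and fixes both loops. Maps defined only near
  \<open>w\<close> can then be applied to the homotopy.\<close>

lemma homotopic_loops_in_punctured_disc:
  fixes w :: complex
  assumes "homotopic_loops (- {w}) p q" "0 < s"
    and "path_image p \<subseteq> cball w s" "path_image q \<subseteq> cball w s"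
  shows "homotopic_loops (cball w s - {w}) p q"
proof -
  define m where "m x = min 1 (s / norm (x - w))" for x
  define \<rho> where "\<rho> x = w + of_real (m x) * (x - w)" for x
  have m: "0 < m x" "m x * norm (x - w) \<le> s" if "x \<noteq> w" for x
  proof -
    show "0 < m x"
      using that assms(2) by (simp add: m_def)
    have "m x \<le> s / norm (x - w)"
      by (simp add: m_def)
    then show "m x * norm (x - w) \<le> s"
      using that by (simp add: le_divide_eq)
  qed
  have fixed: "\<rho> x = x" if "x \<in> cball w s" "x \<noteq> w" for x
  proof -
    have "1 \<le> s / norm (x - w)"
      using that by (simp add: le_divide_eq dist_norm norm_minus_commute)
    then show ?thesis
      by (simp add: \<rho>_def m_def min_def)
  qed
  have loops: "homotopic_loops (cball w s - {w}) (\<rho> \<circ> p) (\<rho> \<circ> q)"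
  proof (rule homotopic_loops_continuous_image[OF assms(1)])
    show "continuous_on (- {w}) \<rho>"
      unfolding \<rho>_def m_def by (intro continuous_intros) auto
    have "\<rho> x \<noteq> w" "dist w (\<rho> x) \<le> s" if "x \<noteq> w" for x
      using m[OF that] that by (simp_all add: \<rho>_def dist_norm norm_mult)
    then show "\<rho> \<in> - {w} \<rightarrow> cball w s - {w}"
      by auto
  qed
  have *: "w \<notin> path_image p" "w \<notin> path_image q"
    using homotopic_loops_imp_subset[OF assms(1)] by auto
  have retract: "homotopic_loops (cball w s - {w}) r (\<rho> \<circ> r)"
    if "path r" "pathfinish r = pathstart r" "w \<notin> path_image r" "path_image r \<subseteq> cball w s" for r
  proof (rule homotopic_loops_eq[OF that(1) _ that(2)])
    show "path_image r \<subseteq> cball w s - {w}"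
      using that by blast
    fix t :: real assume "t \<in> {0..1}"
    then have "r t \<in> path_image r" by (simp add: path_image_def)
    then have "\<rho> (r t) = r t"
      using that by (intro fixed) auto
    then show "r t = (\<rho> \<circ> r) t" by simp
  qed
  have "homotopic_loops (cball w s - {w}) p (\<rho> \<circ> p)" "homotopic_loops (cball w s - {w}) q (\<rho> \<circ> q)"
    using homotopic_loops_imp_path[OF assms(1)] homotopic_loops_imp_loop[OF assms(1)] * assms(3,4)
    by (auto intro!: retract)
  then show ?thesis
    using loops by (meson homotopic_loops_sym homotopic_loops_trans)
qed

text \<open>The image of a small circle under \<open>f\<close> has winding number 1 about
  \<open>f z\<close>, hence is homotopic in the punctured plane to a round circle. Pushed into a
  disc on which \<open>g\<close> is injective, the homotopy is carried by \<open>g\<close> to one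
  that avoids \<open>g (f z)\<close>.\<close>

lemma orientation_preserving_at_comp:
  assumes f: "d > 0" "continuous_on (ball z d) f" "inj_on f (ball z d)"
    and g: "e > 0" "continuous_on (ball (f z) e) g" "inj_on g (ball (f z) e)"
    and orient_f: "orientation_preserving_at f z" and orient_g: "orientation_preserving_at g (f z)"
  shows "orientation_preserving_at (g \<circ> f) z"
proof -
  define w where "w = f z"
  obtain s where s: "0 < s" "s < e" "winding_number (g \<circ> circlepath w s) (g w) = 1"
    using orientation_preserving_at_radius[OF orient_g g(1)] unfolding w_def .
  have "continuous (at z) f"
    using f(1,2) by (simp add: continuous_on_eq_continuous_at)
  then obtain d' where d': "d' > 0" "\<And>x. dist x z < d' \<Longrightarrow> dist (f x) w < s"
    using s(1) unfolding continuous_at_eps_delta w_def by blast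
  have "\<forall>\<^sub>F r in at_right 0. 0 < r \<and> r < min d d'"
    using f(1) d'(1) by (intro eventually_at_right_0_small) simp
  moreover have "\<forall>\<^sub>F r in at_right 0. winding_number (f \<circ> circlepath z r) w = 1"
    using orient_f by (simp add: orientation_preserving_at_def w_def)
  ultimately show ?thesis
    unfolding orientation_preserving_at_def
  proof eventually_elim
    case (elim r)
    define p where "p = f \<circ> circlepath z r"
    have p: "path p" "pathfinish p = pathstart p"
      using elim unfolding p_def by (auto intro!: path_comp_circlepath continuous_on_subset[OF f(2)])
    have pim: "path_image p \<subseteq> cball w s - {w}"
    proof
      fix y assume "y \<in> path_image p"
      then obtain x where x: "y = f x" "dist x z = r"
        using elim by (auto simp: p_def path_image_compose path_image_circlepath_nonneg dist_commute)
      then have "x \<in> ball z d" "x \<noteq> z" "z \<in> ball z d"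
        using elim f(1) by (auto simp: dist_commute)
      then have "f x \<noteq> w"
        using f(3) by (auto simp: w_def dest: inj_onD)
      then show "y \<in> cball w s - {w}"
        using d'(2)[of x] x elim by (auto simp: dist_commute)
    qed
    have cim: "path_image (circlepath w s) \<subseteq> cball w s - {w}"
      using s(1) by auto
    have "winding_number p w = winding_number (circlepath w s) w"
      using elim s(1) by (simp add: p_def winding_number_circlepath_centre)
    then have "homotopic_loops (- {w}) p (circlepath w s)"
      using p pim cim by (subst (asm) winding_number_homotopic_loops_eq) auto
    then have "homotopic_loops (cball w s - {w}) p (circlepath w s)"
      by (rule homotopic_loops_in_punctured_disc) (use s(1) pim cim in auto)
    then have "homotopic_loops (- {g w}) (g \<circ> p) (g \<circ> circlepath w s)"
    proof (rule homotopic_loops_continuous_image)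
      show "continuous_on (cball w s - {w}) g"
        by (rule continuous_on_subset[OF g(2)]) (use s(2) in \<open>auto simp: w_def\<close>)
      show "g \<in> cball w s - {w} \<rightarrow> - {g w}"
        using inj_onD[OF g(3)] s(2) g(1) by (fastforce simp: w_def)
    qed
    then have "winding_number (g \<circ> p) (g w) = 1"
      using winding_number_homotopic_loops s(3) by metis
    then show ?case
      by (simp add: p_def w_def comp_assoc)
  qed
qed

section \<open>Signs on the two sides of an axis under a map of local degree one\<close>

lemma zero_in_segmentD:
  assumes "0 \<in> closed_segment a (b :: complex)"
  shows "Im a * Im b \<le> 0" "Re a * Re b \<le> 0" "Re a * Im b = Re b * Im a"
proof -
  obtain u where u: "0 \<le> u" "u \<le> 1" "(1 - u) *\<^sub>R a + u *\<^sub>R b = 0"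
    using assms by (auto simp: closed_segment_def)
  have a: "(1 - u) * Re a = - (u * Re b)" "(1 - u) * Im a = - (u * Im b)"
    using arg_cong[OF u(3), of Re] arg_cong[OF u(3), of Im] by (simp_all add: add_eq_0_iff)
  have "b = 0 \<or> (\<exists>l\<ge>0. Re a = - l * Re b \<and> Im a = - l * Im b)"
  proof (cases "u = 1")
    case True
    then show ?thesis using u(3) by simp
  next
    case False
    then have "Re a = - (u / (1 - u)) * Re b" "Im a = - (u / (1 - u)) * Im b"
      using a by (simp_all add: field_simps)
    then show ?thesis
      using u False by (intro disjI2 exI[of _ "u / (1 - u)"]) simp
  qed
  then show "Im a * Im b \<le> 0" "Re a * Re b \<le> 0" "Re a * Im b = Re b * Im a"
    by (auto simp: mult.assoc)
qed

lemma constant_sign: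
  fixes f :: "'e::topological_space \<Rightarrow> real"
  assumes "connected S" "continuous_on S f" "\<And>x. x \<in> S \<Longrightarrow> f x \<noteq> 0"
  obtains s where "s \<in> {1, - 1}" "\<And>x. x \<in> S \<Longrightarrow> 0 < s * f x"
proof -
  have "(\<lambda>x. sgn (f x)) constant_on S"
  proof (rule continuous_discrete_range_constant[OF assms(1)])
    show "continuous_on S (\<lambda>x. sgn (f x))"
      by (rule continuous_on_sgn[OF assms(2)]) (use assms(3) in blast)
    fix x assume "x \<in> S"
    show "\<exists>e>0. \<forall>y. y \<in> S \<and> sgn (f y) \<noteq> sgn (f x) \<longrightarrow> e \<le> norm (sgn (f y) - sgn (f x))"
      by (rule exI[of _ 1]) (auto simp: sgn_if)
  qed
  then obtain s where s: "\<And>x. x \<in> S \<Longrightarrow> sgn (f x) = s"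
    by (auto simp: constant_on_def)
  show ?thesis
  proof (cases "S = {}")
    case True
    then show ?thesis using that[of 1] by simp
  next
    case False
    then have "s \<in> {1, - 1}"
      using s assms(3) by (metis ex_in_conv insertCI sgn_if)
    moreover have "0 < s * f x" if "x \<in> S" for x
      using s[OF that, symmetric] assms(3)[OF that] by (simp add: sgn_if)
    ultimately show ?thesis by (rule that)
  qed
qed

text \<open>\<open>F\<close> has a constant sign on each half of the real axis (\<open>sR\<close>,
  \<open>sL\<close>) and on each side of it (\<open>sU\<close>, \<open>sD\<close>). If one of the
  relations \<open>sL = - sR\<close>, \<open>sD = - sU\<close>, \<open>sU = sR\<close> failed,
  straight segments avoiding 0 would deform the image of a small circle into a constant loop or a
  reversed circle, of winding number 0 or -1.\<close>

lemma side_orientation: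
  assumes d: "d > 0" and F: "continuous_on (ball 0 d) F"
    and real: "\<And>z. z \<in> ball 0 d \<Longrightarrow> Im (F z) = 0 \<longleftrightarrow> Im z = 0"
    and zero: "\<And>z. z \<in> ball 0 d \<Longrightarrow> F z = 0 \<longleftrightarrow> z = 0"
    and orient: "orientation_preserving_at F 0"
  obtains e :: real where "e \<in> {1, - 1}"
    "\<And>x. x \<noteq> 0 \<Longrightarrow> \<bar>x\<bar> < d \<Longrightarrow> 0 < e * x * Re (F (of_real x))"
    "\<And>z. z \<in> ball 0 d \<Longrightarrow> Im z \<noteq> 0 \<Longrightarrow> 0 < e * Im z * Im (F z)"
proof -
  have re: "Re (F (of_real x)) \<noteq> 0" if "x \<noteq> 0" "\<bar>x\<bar> < d" for x
    using that real[of "of_real x"] zero[of "of_real x"] by (auto simp: complex_eq_iff)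
  have contR: "continuous_on S (\<lambda>x. Re (F (of_real x)))" if "S \<subseteq> {- d<..<d}" for S
    by (intro continuous_intros continuous_on_compose2[OF F]) (use that in \<open>auto simp: subset_eq abs_less_iff\<close>)
  have contI: "continuous_on S (\<lambda>z. Im (F z))" if "S \<subseteq> ball 0 d" for S
    by (intro continuous_intros continuous_on_subset[OF F that])
  have contR': "continuous_on {0<..<d} (\<lambda>x. Re (F (of_real x)))" "continuous_on {- d<..<0} (\<lambda>x. Re (F (of_real x)))"
    by (rule contR; use d in auto)+
  obtain sR where sR: "sR \<in> {1, - 1}" "\<And>x. x \<in> {0<..<d} \<Longrightarrow> 0 < sR * Re (F (of_real x))"
    by (rule constant_sign[of "{0<..<d}" "\<lambda>x. Re (F (of_real x))"]) (use re contR' in auto)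
  obtain sL where sL: "sL \<in> {1, - 1}" "\<And>x. x \<in> {- d<..<0} \<Longrightarrow> 0 < sL * Re (F (of_real x))"
    by (rule constant_sign[of "{- d<..<0}" "\<lambda>x. Re (F (of_real x))"]) (use re contR' in auto)
  obtain sU where sU: "sU \<in> {1, - 1}" "\<And>z. z \<in> ball 0 d \<inter> {z. Im z > 0} \<Longrightarrow> 0 < sU * Im (F z)"
    by (rule constant_sign[of "ball 0 d \<inter> {z. Im z > 0}" "\<lambda>z. Im (F z)"])
      (use real contI in \<open>auto intro!: convex_connected convex_Int convex_halfspace_Im_gt\<close>)
  obtain sD where sD: "sD \<in> {1, - 1}" "\<And>z. z \<in> ball 0 d \<inter> {z. Im z < 0} \<Longrightarrow> 0 < sD * Im (F z)"
    by (rule constant_sign[of "ball 0 d \<inter> {z. Im z < 0}" "\<lambda>z. Im (F z)"])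
      (use real contI in \<open>auto intro!: convex_connected convex_Int convex_halfspace_Im_lt\<close>)
  have "F 0 = 0"
    using zero[of 0] d by simp
  then obtain r where r: "0 < r" "r < d" "winding_number (F \<circ> circlepath 0 r) 0 = 1"
    using orientation_preserving_at_radius[OF orient d] by metis
  have path: "path (F \<circ> circlepath 0 r)" "pathfinish (F \<circ> circlepath 0 r) = pathstart (F \<circ> circlepath 0 r)"
    using r by (auto intro!: path_comp_circlepath continuous_on_subset[OF F])
  have compare: "winding_number (\<lambda>t. G (circlepath 0 r t)) 0 = 1"
    if "continuous_on UNIV G" "\<And>z. norm z = r \<Longrightarrow> 0 \<notin> closed_segment (F z) (G z)" for G
  proof -
    have "winding_number (G \<circ> circlepath 0 r) 0 = winding_number (F \<circ> circlepath 0 r) 0"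
    proof (rule winding_number_loops_linear_eq[OF path(1) _ path(2)])
      show "path (G \<circ> circlepath 0 r)" "pathfinish (G \<circ> circlepath 0 r) = pathstart (G \<circ> circlepath 0 r)"
        by (rule path_comp_circlepath; use r in \<open>auto intro: continuous_on_subset[OF that(1)]\<close>)+
      show "0 \<notin> closed_segment ((F \<circ> circlepath 0 r) t) ((G \<circ> circlepath 0 r) t)" for t
        using that(2)[of "circlepath 0 r t"] r by (simp add: circlepath norm_mult)
    qed
    then show ?thesis
      using r by (simp add: comp_def)
  qed
  have cases: "(Im z = 0 \<and> Im (F z) = 0 \<and> (z = of_real r \<and> 0 < sR * Re (F z) \<or> z = of_real (- r) \<and> 0 < sL * Re (F z))) \<or>
      (0 < Im z \<and> 0 < sU * Im (F z)) \<or> (Im z < 0 \<and> 0 < sD * Im (F z))" if "norm z = r" for z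
  proof -
    have z: "z \<in> ball 0 d" using that r by simp
    show ?thesis
    proof (cases "Im z = 0")
      case True
      then have "\<bar>Re z\<bar> = r" using that by (simp add: norm_complex_def)
      then have "z = of_real r \<or> z = of_real (- r)"
        using True by (auto simp: complex_eq_iff)
      then show ?thesis
        using True real[OF z] sR(2)[of r] sL(2)[of "- r"] r by auto
    next
      case False
      then show ?thesis
        using sU(2)[of z] sD(2)[of z] z by (cases "0 < Im z") auto
    qed
  qed
  have "sL = - sR"
  proof (rule ccontr)
    assume "sL \<noteq> - sR"
    then have eq: "sL = sR" using sR(1) sL(1) by auto
    have "winding_number (\<lambda>t. of_real sR) 0 = 1"
    proof (rule compare[of "\<lambda>_. of_real sR"])
      fix z :: complex assume "norm z = r"
      from cases[OF this] show "0 \<notin> closed_segment (F z) (of_real sR)"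
        using zero_in_segmentD[of "F z" "of_real sR"] sR(1) eq by (auto simp: mult.commute)
    qed simp
    moreover have "winding_number (\<lambda>t. complex_of_real sR) 0 = 0"
      by (rule winding_number_zero_const) (use sR(1) in auto)
    ultimately show False by simp
  qed
  moreover have "sD = - sU"
  proof (rule ccontr)
    assume "sD \<noteq> - sU"
    then have eq: "sD = sU" using sD(1) sU(1) by auto
    have "winding_number (\<lambda>t. \<i> * of_real sU) 0 = 1"
    proof (rule compare[of "\<lambda>_. \<i> * of_real sU"])
      fix z :: complex assume z: "norm z = r"
      show "0 \<notin> closed_segment (F z) (\<i> * of_real sU)"
      proof
        assume "0 \<in> closed_segment (F z) (\<i> * of_real sU)"
        from zero_in_segmentD[OF this] cases[OF z] eq show False
          using sU(1) by (auto simp: mult.commute)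
      qed
    qed simp
    moreover have "winding_number (\<lambda>t. \<i> * complex_of_real sU) 0 = 0"
      by (rule winding_number_zero_const) (use sU(1) in auto)
    ultimately show False by simp
  qed
  moreover have "sU = sR"
  proof (rule ccontr)
    assume "sU \<noteq> sR"
    \<comment> \<open>With the other two relations known, this choice gives \<open>F\<close> the
      signs of \<open>sR * cnj z\<close> on the circle, and \<open>cnj\<close> reverses the
      circle.\<close>
    then have eq: "sU = - sR" using sU(1) sR(1) by auto
    have "winding_number (\<lambda>t. of_real sR * cnj (circlepath 0 r t)) 0 = 1"
    proof (rule compare[of "\<lambda>z. of_real sR * cnj z"])
      fix z :: complex assume z: "norm z = r"
      show "0 \<notin> closed_segment (F z) (of_real sR * cnj z)"
      proof
        assume "0 \<in> closed_segment (F z) (of_real sR * cnj z)"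
        from zero_in_segmentD[OF this] have seg: "Im (F z) * (sR * Im z) \<ge> 0" "Re (F z) * (sR * Re z) \<le> 0"
          by simp_all
        from cases[OF z] show False
        proof (elim disjE conjE)
          assume "0 < Im z" "0 < sU * Im (F z)"
          then have "0 < (sU * Im (F z)) * Im z" by simp
          with seg eq show False by (simp add: mult_ac)
        next
          assume "Im z < 0" "0 < sD * Im (F z)"
          then have "(sD * Im (F z)) * Im z < 0" by (rule mult_pos_neg[rotated])
          with seg eq \<open>sD = - sU\<close> show False by (simp add: mult_ac)
        next
          assume "z = of_real r" "0 < sR * Re (F z)"
          then have "0 < (sR * Re (F z)) * Re z" using r by simp
          with seg show False by (simp add: mult_ac)
        next
          assume "z = of_real (- r)" "0 < sL * Re (F z)"
          then have "(sL * Re (F z)) * Re z < 0" using r by (simp add: mult_pos_neg)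
          with seg \<open>sL = - sR\<close> show False by (simp add: mult_ac)
        qed
      qed
    qed (intro continuous_intros)
    moreover have "(\<lambda>t. of_real sR * cnj (circlepath 0 r t)) =
        (\<lambda>t. 0 + of_real (sR * r) * exp (- (2 * of_real pi * \<i> * of_real t)))"
      by (simp add: circlepath exp_cnj fun_eq_iff)
    ultimately show False
      using winding_number_reversed_circle[of "of_real (sR * r)" 0] sR(1) r by auto
  qed
  ultimately have signs: "sL = - sR" "sU = sR" "sD = - sR" by simp_all
  show ?thesis
  proof
    show "sR \<in> {1, - 1}" by (rule sR(1))
    show "0 < sR * x * Re (F (of_real x))" if "x \<noteq> 0" "\<bar>x\<bar> < d" for x
    proof (cases "x > 0")
      case True
      then have "0 < (sR * Re (F (of_real x))) * x" using sR(2)[of x] that by simp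
      then show ?thesis by (simp add: mult_ac)
    next
      case False
      then have "0 < (sL * Re (F (of_real x))) * (- x)"
        using that by (intro mult_pos_pos[OF sL(2)]) auto
      then show ?thesis by (simp add: signs mult_ac)
    qed
    show "0 < sR * Im z * Im (F z)" if "z \<in> ball 0 d" "Im z \<noteq> 0" for z
    proof (cases "Im z > 0")
      case True
      then have "0 < (sU * Im (F z)) * Im z" using sU(2)[of z] that by simp
      then show ?thesis by (simp add: signs mult_ac)
    next
      case False
      then have "0 < (sD * Im (F z)) * (- Im z)"
        using that by (intro mult_pos_pos[OF sD(2)]) auto
      then show ?thesis by (simp add: signs mult_ac)
    qed
  qed
qed

section \<open>Real lifts of paths on the circle\<close>

lemma segment_image_real:
  fixes f :: "real \<Rightarrow> real"
  assumes "continuous_on S f" "connected S" "a \<in> S" "b \<in> S" "y \<in> closed_segment (f a) (f b)"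
  shows "\<exists>x\<in>S. f x = y"
proof -
  have "convex (f ` S)"
    using connected_continuous_image[OF assms(1,2)] by (simp add: is_interval_connected_1 flip: is_interval_convex_1)
  then have "closed_segment (f a) (f b) \<subseteq> f ` S"
    using assms(3,4) by (intro closed_segment_subset) auto
  then show ?thesis
    using assms(5) by blast
qed

lemma between_integers:
  fixes f :: "real \<Rightarrow> real"
  assumes "continuous_on S f" "connected S" "\<And>x. x \<in> S \<Longrightarrow> f x \<notin> \<int>"
  obtains j :: int where "\<And>x. x \<in> S \<Longrightarrow> of_int j < f x" "\<And>x. x \<in> S \<Longrightarrow> f x < of_int j + 1"
proof (cases "S = {}")
  case False
  then obtain a where a: "a \<in> S" by blast
  define j where "j = \<lfloor>f a\<rfloor>"
  have j: "of_int j \<le> f a" "f a \<le> of_int (j + 1)"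
    unfolding j_def by linarith+
  have "of_int j < f x \<and> f x < of_int j + 1" if x: "x \<in> S" for x
  proof (rule ccontr)
    assume "\<not> (of_int j < f x \<and> f x < of_int j + 1)"
    then have "of_int j \<in> closed_segment (f a) (f x) \<or> of_int (j + 1) \<in> closed_segment (f a) (f x)"
      using j by (auto simp: closed_segment_eq_real_ivl)
    then have "\<exists>y\<in>S. f y \<in> \<int>"
      using segment_image_real[OF assms(1,2) a x] by (metis Ints_of_int)
    then show False
      using assms(3) by blast
  qed
  then show ?thesis
    using that by blast
qed (use that in auto)

text \<open>The negative sine just after 0 puts \<open>N\<close> below 0, and it is confined to (-1,
  0) since it avoids integers. The positive sine just before 1 means that it approaches its final
  integer from above; the only such integer is -1.\<close>

lemma increment_of_crossing:
  fixes N :: "real \<Rightarrow> real"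
  assumes N: "continuous_on {0..1} N" "N 0 = 0" "N 1 \<in> \<int>"
    and off: "\<And>t. 0 < t \<Longrightarrow> t < 1 \<Longrightarrow> N t \<notin> \<int>"
    and e: "0 < e"
    and start: "\<And>t. 0 < t \<Longrightarrow> t < e \<Longrightarrow> sin (2 * pi * N t) < 0"
    and finish: "\<And>t. 1 - e < t \<Longrightarrow> t < 1 \<Longrightarrow> 0 < sin (2 * pi * N t)"
  shows "N 1 = - 1"
proof -
  obtain j :: int where j: "\<And>t. 0 < t \<Longrightarrow> t < 1 \<Longrightarrow> of_int j < N t" "\<And>t. 0 < t \<Longrightarrow> t < 1 \<Longrightarrow> N t < of_int j + 1"
    by (rule between_integers[of "{0<..<1}" N]) (use continuous_on_subset[OF N(1)] off in \<open>auto simp: subset_eq\<close>)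
  have near: "\<exists>d>0. \<forall>t\<in>{0..1}. \<bar>t - x\<bar> < d \<longrightarrow> \<bar>N t - N x\<bar> < 1 / 2" if "x \<in> {0..1}" for x
    using bspec[OF N(1)[unfolded continuous_on_iff] that, rule_format, of "1 / 2"] by (auto simp: dist_real_def)
  obtain d0 where d0: "d0 > 0" "\<And>t. t \<in> {0..1} \<Longrightarrow> \<bar>t - 0\<bar> < d0 \<Longrightarrow> \<bar>N t - N 0\<bar> < 1 / 2"
    using near[of 0] by auto
  obtain d1 where d1: "d1 > 0" "\<And>t. t \<in> {0..1} \<Longrightarrow> \<bar>t - 1\<bar> < d1 \<Longrightarrow> \<bar>N t - N 1\<bar> < 1 / 2"
    using near[of 1] by auto
  have sin_sign: "sin (2 * pi * x) < 0 \<longleftrightarrow> x < 0" "0 < sin (2 * pi * x) \<longleftrightarrow> 0 < x" if "\<bar>x\<bar> < 1 / 2" for x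
  proof -
    have x: "\<bar>2 * pi * x\<bar> < pi"
      using that by (simp add: abs_mult)
    consider "x < 0" | "x = 0" | "0 < x" by linarith
    then have "x < 0 \<and> sin (2 * pi * x) < 0 \<or> x = 0 \<and> sin (2 * pi * x) = 0 \<or> 0 < x \<and> 0 < sin (2 * pi * x)"
    proof cases
      case 1
      then have "0 < sin (- (2 * pi * x))"
        using x by (intro sin_gt_zero) (auto simp: mult_pos_neg)
      with 1 show ?thesis by simp
    next
      case 3
      then have "0 < sin (2 * pi * x)"
        using x by (intro sin_gt_zero) auto
      with 3 show ?thesis by simp
    qed simp
    then show "sin (2 * pi * x) < 0 \<longleftrightarrow> x < 0" "0 < sin (2 * pi * x) \<longleftrightarrow> 0 < x"
      by auto
  qed
  define t0 where "t0 = min (min d0 e) 1 / 2"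
  have t0: "0 < t0" "t0 < 1" "t0 < d0" "t0 < e"
    using d0(1) e by (auto simp: t0_def)
  then have "\<bar>N t0\<bar> < 1 / 2"
    using d0(2)[of t0] N(2) by simp
  then have "N t0 < 0" "- 1 / 2 < N t0"
    using sin_sign start[of t0] t0 by auto
  then have "j = - 1"
    using j[of t0] t0 by linarith
  obtain n :: int where n: "N 1 = of_int n"
    using N(3) by (auto elim: Ints_cases)
  define t1 where "t1 = 1 - min (min d1 e) 1 / 2"
  have t1: "0 < t1" "t1 < 1" "1 - t1 < d1" "1 - e < t1"
    using d1(1) e by (auto simp: t1_def)
  then have small: "\<bar>N t1 - of_int n\<bar> < 1 / 2"
    using d1(2)[of t1] n by simp
  have "sin (2 * pi * (N t1 - of_int n)) = sin (2 * pi * N t1)"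
    using arg_cong[of "cis (2 * pi * (N t1 - of_int n))" "cis (2 * pi * N t1)" Im] by (simp add: cis_2pi_eq_iff)
  then have "0 < sin (2 * pi * (N t1 - of_int n))"
    using finish[of t1] t1 by simp
  then have "0 < N t1 - of_int n" "N t1 - of_int n < 1 / 2"
    using sin_sign(2)[OF small] small by linarith+
  moreover have "- 1 < N t1" "N t1 < 0"
    using j[of t1] t1 \<open>j = - 1\<close> by auto
  ultimately have "n = - 1"
    by linarith
  then show ?thesis
    using n by simp
qed

text \<open>\<open>L\<close> is confined to an open interval of length 1 between half-integers,
  where 0 is the only possible integral increment.\<close>

lemma increment_without_crossing:
  fixes L :: "real \<Rightarrow> real"
  assumes L: "continuous_on {0..1} L" "L 1 - L 0 \<in> \<int>" and off: "\<And>t. t \<in> {0..1} \<Longrightarrow> L t - 1 / 2 \<notin> \<int>"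
  shows "L 1 = L 0"
proof -
  obtain j :: int where j: "\<And>t. t \<in> {0..1} \<Longrightarrow> of_int j < L t - 1 / 2" "\<And>t. t \<in> {0..1} \<Longrightarrow> L t - 1 / 2 < of_int j + 1"
    by (rule between_integers[of "{0..1}" "\<lambda>t. L t - 1 / 2"]) (use L off in \<open>auto intro!: continuous_intros\<close>)
  obtain n :: int where n: "L 1 - L 0 = of_int n"
    using L(2) by (auto elim: Ints_cases)
  have "n = 0"
    using n j[of 0] j[of 1] by auto
  then show ?thesis
    using n by simp
qed

text \<open>Injectivity modulo 1 and the intermediate value theorem force the degree of the lift to
  be 1 or -1 and the lift to be strictly monotone.\<close>

lemma circle_homeomorphism_lift:
  fixes f :: "real \<Rightarrow> complex"
  assumes f: "continuous_on UNIV f" "\<And>t. norm (f t) = 1" "\<And>s t. f s = f t \<longleftrightarrow> s - t \<in> \<int>"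
  obtains k e where "continuous_on UNIV k" "e \<in> {1, - 1 :: real}" "\<And>t. f t = cis (2 * pi * k t)"
    "\<And>t. k (t + 1) = k t + e" "\<And>s t. s < t \<Longrightarrow> 0 < e * (k t - k s)"
proof -
  obtain k where k: "continuous_on UNIV k" "\<And>t. f t = cis (2 * pi * k t)"
    using circle_lift[of UNIV f] f(1,2) convex_imp_contractible[OF convex_UNIV] by (metis UNIV_I)
  have k_int: "k s - k t \<in> \<int> \<longleftrightarrow> s - t \<in> \<int>" for s t
    using f(3)[of s t] by (simp add: k(2) cis_2pi_eq_iff)
  have "\<exists>n. \<forall>t\<in>UNIV. k (t + 1) - k t = of_int n"
    by (rule constant_on_if_integer)
      (auto intro!: continuous_intros continuous_on_compose2[OF k(1)] simp: k_int)
  then obtain n :: int where n: "\<And>t. k (t + 1) = k t + of_int n"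
    by (metis UNIV_I diff_add_cancel add.commute)
  have nat: "k (t + of_nat m) = k t + of_nat m * of_int n" for t m
  proof (induction m)
    case (Suc m)
    have "k (t + of_nat (Suc m)) = k ((t + of_nat m) + 1)"
      by (simp add: add_ac)
    then show ?case
      by (simp add: n Suc distrib_right)
  qed simp
  have seg: "\<exists>x. a \<le> x \<and> x \<le> b \<and> k x = y" if "a \<le> b" "y \<in> closed_segment (k a) (k b)" for a b y
    using segment_image_real[of "{a..b}" k a b y] continuous_on_subset[OF k(1), of "{a..b}"] that by auto
  have "n \<noteq> 0"
  proof
    assume "n = 0"
    then have k1: "k 1 = k 0" using n[of 0] by simp
    \<comment> \<open>In degree 0 the lift takes this value once on each half of the period, at
      parameters that are not congruent modulo 1.\<close>
    define y where "y = (k 0 + k (1 / 2)) / 2"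
    have y: "y \<in> closed_segment (k 0) (k (1 / 2))" "y \<in> closed_segment (k (1 / 2)) (k 1)"
      by (auto simp: k1 y_def closed_segment_eq_real_ivl)
    have "k (1 / 2) - k 0 \<notin> \<int>"
      unfolding k_int by (auto elim!: Ints_cases) 
    then have ne: "k (1 / 2) \<noteq> k 0" by auto
    obtain x1 where x1: "0 \<le> x1" "x1 \<le> 1 / 2" "k x1 = y"
      using seg[OF _ y(1)] by auto
    obtain x2 where x2: "1 / 2 \<le> x2" "x2 \<le> 1" "k x2 = y"
      using seg[OF _ y(2)] by auto
    have yne: "y \<noteq> k 0" "y \<noteq> k (1 / 2)"
      using ne by (auto simp: y_def)
    have "x1 \<noteq> 0" "x1 \<noteq> 1 / 2" "x2 \<noteq> 1 / 2" "x2 \<noteq> 1"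
      using x1(3) x2(3) yne k1 by metis+
    then have "x1 < 1 / 2" "0 < x1" "1 / 2 < x2" "x2 < 1"
      using x1 x2 by simp_all
    moreover have "x2 - x1 \<in> \<int>"
      using k_int[of x2 x1] x1(3) x2(3) by simp
    then obtain z :: int where "x2 - x1 = of_int z"
      by (rule Ints_cases)
    ultimately have "0 < real_of_int z" "real_of_int z < 1"
      by linarith+
    then show False
      by simp
  qed
  have "inj k"
  proof (rule injI)
    have *: "s = t" if "k s = k t" "t \<le> s" for s t
    proof -
      have "s - t \<in> \<int>"
        using k_int[of s t] that(1) by simp
      then obtain z :: int where z: "s - t = of_int z"
        by (rule Ints_cases)
      then have "0 \<le> real_of_int z"
        using \<open>t \<le> s\<close> by linarith
      then obtain m where "z = int m"
        using nonneg_int_cases by auto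
      with z have m: "s = t + of_nat m"
        by simp
      then show ?thesis
        using nat[of t m] that \<open>n \<noteq> 0\<close> by simp
    qed
    fix s t assume "k s = k t"
    then show "s = t"
      using *[of s t] *[of t s] by (cases "t \<le> s") auto
  qed
  then have mono: "strict_mono k \<or> strict_antimono_on UNIV k"
    using injective_eq_monotone_map[of UNIV k] k(1) by simp
  have unit: "\<bar>n\<bar> = 1"
  proof (rule ccontr)
    assume "\<bar>n\<bar> \<noteq> 1"
    with \<open>n \<noteq> 0\<close> have n2: "2 \<le> \<bar>n\<bar>" by linarith
    \<comment> \<open>In degree at least 2 in modulus the lift passes this value strictly inside the
      period, which repeats the point of the circle at parameter 0.\<close>
    define y where "y = k 0 + of_int (sgn n)"
    have "y \<in> closed_segment (k 0) (k 1)"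
      using n[of 0] n2 by (auto simp: y_def closed_segment_eq_real_ivl sgn_if)
    then obtain x where x: "0 \<le> x" "x \<le> 1" "k x = y"
      using seg[of 0 1 y] by auto
    then have "x - 0 \<in> \<int>"
      using k_int[of x 0] by (simp add: y_def)
    then have "x = 0 \<or> x = 1"
      using x by (auto elim!: Ints_cases)
    then show False
      using x(3) n[of 0] n2 by (auto simp: y_def sgn_if split: if_splits)
  qed
  show ?thesis
  proof (rule that[of k "of_int n"])
    show "real_of_int n \<in> {1, - 1}"
      using unit by auto
    show "0 < of_int n * (k t - k s)" if "s < t" for s t
    proof -
      have "(s < t \<longrightarrow> k s < k t) \<and> k 0 < k 1 \<or> (s < t \<longrightarrow> k t < k s) \<and> k 1 < k 0"
        using mono by (auto simp: monotone_on_def strict_mono_def)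
      then show ?thesis
        using that n[of 0] unit by (auto simp: abs_if split: if_splits)
    qed
  qed (use k n in auto)
qed

section \<open>Charts of a surface\<close>

lemma atlas_chart:
  fixes Q :: "('a::t2_space set \<times> ('a \<Rightarrow> complex)) set"
  assumes "oriented_atlas Q"
  obtains V \<psi> where "(V, \<psi>) \<in> Q" "p \<in> V"
proof -
  have "p \<in> (\<Union>(U, \<phi>)\<in>Q. U)"
    using assms by (simp add: oriented_atlas_def)
  then show ?thesis
    using that by blast
qed

lemma atlas_chartD:
  fixes Q :: "('a::t2_space set \<times> ('a \<Rightarrow> complex)) set"
  assumes "oriented_atlas Q" "(V, \<psi>) \<in> Q"
  shows "open V" "continuous_on V \<psi>" "inj_on \<psi> V" "continuous_on (\<psi> ` V) (inv_into V \<psi>)"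
proof -
  obtain g where g: "open V" "homeomorphism V (\<psi> ` V) \<psi> g"
    using bspec[OF conjunct1[OF assms(1)[unfolded oriented_atlas_def]] assms(2)]
    unfolding chart_into_def by blast
  show "open V" by (rule g(1))
  show "continuous_on V \<psi>"
    using g(2) by (simp add: homeomorphism_def)
  show inj: "inj_on \<psi> V"
    using homeomorphism_apply1[OF g(2)] by (metis inj_onI)
  have "g y = inv_into V \<psi> y" if "y \<in> \<psi> ` V" for y
    using that homeomorphism_apply1[OF g(2)] inj by (auto simp: inv_into_f_f)
  moreover have "continuous_on (\<psi> ` V) g"
    using g(2) by (simp add: homeomorphism_def)
  ultimately show "continuous_on (\<psi> ` V) (inv_into V \<psi>)"
    by (metis continuous_on_cong)
qed

text \<open>Charts may take values in a half plane with boundary. Composed with an injective map of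
  an open plane set they become plane maps, to which invariance of domain applies; so the image of
  \<open>D\<close> stays in the interior of the surface.\<close>

lemma surface_chart_image_open:
  fixes g :: "complex \<Rightarrow> 'a::t2_space" and Q :: "('a set \<times> ('a \<Rightarrow> complex)) set"
  assumes Q: "oriented_atlas Q" "(V, \<psi>) \<in> Q"
    and g: "continuous_on D g" "inj_on g D" "open D"
  shows "open ((\<psi> \<circ> g) ` (D \<inter> g -` V))" "open (g ` (D \<inter> g -` V))"
proof -
  note V = atlas_chartD[OF Q]
  have D': "open (D \<inter> g -` V)"
    by (rule continuous_open_preimage[OF g(1,3) V(1)])
  show *: "open ((\<psi> \<circ> g) ` (D \<inter> g -` V))"
  proof (rule invariance_of_domain[OF _ D'])
    show "continuous_on (D \<inter> g -` V) (\<psi> \<circ> g)"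
      by (intro continuous_on_compose continuous_on_subset[OF g(1)] continuous_on_subset[OF V(2)]) auto
    show "inj_on (\<psi> \<circ> g) (D \<inter> g -` V)"
      by (intro comp_inj_on inj_on_subset[OF g(2)] inj_on_subset[OF V(3)]) auto
  qed
  have "g ` (D \<inter> g -` V) = V \<inter> \<psi> -` ((\<psi> \<circ> g) ` (D \<inter> g -` V))"
    using V(3) by (fastforce dest: inj_onD)
  then show "open (g ` (D \<inter> g -` V))"
    using continuous_open_preimage[OF V(2,1) *] by simp
qed

lemma surface_image_interior:
  fixes g :: "complex \<Rightarrow> 'a::t2_space" and Q :: "('a set \<times> ('a \<Rightarrow> complex)) set"
  assumes "oriented_atlas Q" "(V, \<psi>) \<in> Q" "continuous_on D g" "inj_on g D" "open D" "z \<in> D" "g z \<in> V"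
  shows "\<psi> (g z) \<in> interior (\<psi> ` V)"
  by (rule interiorI[OF surface_chart_image_open(1)[OF assms(1-5)]]) (use assms(6,7) in auto)

lemma surface_image_open:
  fixes g :: "complex \<Rightarrow> 'a::t2_space" and Q :: "('a set \<times> ('a \<Rightarrow> complex)) set"
  assumes Q: "oriented_atlas Q" and g: "continuous_on D g" "inj_on g D" "open D"
  shows "open (g ` D)"
proof (subst open_subopen, intro ballI)
  fix p assume "p \<in> g ` D"
  then obtain z where z: "z \<in> D" "p = g z" by blast
  obtain V \<psi> where V: "(V, \<psi>) \<in> Q" "p \<in> V"
    by (rule atlas_chart[OF Q])
  show "\<exists>T. open T \<and> p \<in> T \<and> T \<subseteq> g ` D"
    by (rule exI[of _ "g ` (D \<inter> g -` V)"])
      (use surface_chart_image_open(2)[OF Q V(1) g] z V in auto)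
qed

text \<open>Near \<open>z\<close> the map \<open>T \<circ> g\<close> is the composite of the plane
  maps \<open>\<psi> \<circ> g\<close> and \<open>T \<circ> inv_into V \<psi>\<close>, so that local
  degrees can be composed.\<close>

lemma orientation_preserving_through_chart:
  fixes g :: "complex \<Rightarrow> 'a::t2_space" and Q :: "('a set \<times> ('a \<Rightarrow> complex)) set"
  assumes Q: "oriented_atlas Q" "(V, \<psi>) \<in> Q"
    and g: "continuous_on D g" "inj_on g D" "open D" "z \<in> D" "g z \<in> V"
    and T: "continuous_on U T" "inj_on T U" "open U" "g z \<in> U"
    and og: "orientation_preserving_at (\<psi> \<circ> g) z"
    and oT: "orientation_preserving_at (T \<circ> inv_into V \<psi>) (\<psi> (g z))"
  shows "orientation_preserving_at (T \<circ> g) z"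
proof -
  note V = atlas_chartD[OF Q]
  define D' where "D' = D \<inter> g -` V"
  have D': "open D'" "z \<in> D'"
    unfolding D'_def using continuous_open_preimage[OF g(1,3) V(1)] g by auto
  obtain d where d: "d > 0" "ball z d \<subseteq> D'"
    using D' by (meson openE)
  define W where "W = (\<psi> \<circ> g) ` D'"
  have "open W"
    unfolding W_def D'_def by (rule surface_chart_image_open(1)[OF Q g(1-3)])
  have W: "W \<subseteq> \<psi> ` V"
    by (auto simp: W_def D'_def)
  have inv: "inv_into V \<psi> (\<psi> x) = x" if "x \<in> V" for x
    using that V(3) by simp
  have "open (W \<inter> inv_into V \<psi> -` U)"
    by (rule continuous_open_preimage[OF continuous_on_subset[OF V(4) W] \<open>open W\<close> T(3)])
  moreover have "\<psi> (g z) \<in> W \<inter> inv_into V \<psi> -` U"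
    using D'(2) g(5) T(4) by (auto simp: W_def inv)
  ultimately obtain e where e: "e > 0" "ball (\<psi> (g z)) e \<subseteq> W \<inter> inv_into V \<psi> -` U"
    by (meson openE)
  have "orientation_preserving_at ((T \<circ> inv_into V \<psi>) \<circ> (\<psi> \<circ> g)) z"
  proof (rule orientation_preserving_at_comp[OF d(1) _ _ e(1)])
    show "continuous_on (ball z d) (\<psi> \<circ> g)"
      by (intro continuous_on_compose continuous_on_subset[OF g(1)] continuous_on_subset[OF V(2)])
        (use d(2) in \<open>auto simp: D'_def\<close>)
    show "inj_on (\<psi> \<circ> g) (ball z d)"
      by (intro comp_inj_on inj_on_subset[OF g(2)] inj_on_subset[OF V(3)])
        (use d(2) in \<open>auto simp: D'_def\<close>)
    show "continuous_on (ball ((\<psi> \<circ> g) z) e) (T \<circ> inv_into V \<psi>)"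
      by (intro continuous_on_compose continuous_on_subset[OF V(4)] continuous_on_subset[OF T(1)])
        (use e(2) W in auto)
    have "inj_on (inv_into V \<psi>) (ball (\<psi> (g z)) e)"
      by (rule inj_on_subset[OF inj_on_inv_into[OF order_refl]]) (use e(2) W in auto)
    then show "inj_on (T \<circ> inv_into V \<psi>) (ball ((\<psi> \<circ> g) z) e)"
      by (intro comp_inj_on inj_on_subset[OF T(2)]) (use e(2) in auto)
  qed (use og oT in simp_all)
  then show ?thesis
    by (rule orientation_preserving_at_cong[OF d(1), rotated]) (use d(2) in \<open>auto simp: D'_def inv\<close>)
qed

section \<open>Crossings of curves\<close>

definition curve_path :: "(complex \<Rightarrow> 'a) \<Rightarrow> real \<Rightarrow> 'a"
  where "curve_path g t = g (cis (2 * pi * t))"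

definition curve_class :: "(complex \<Rightarrow> 'a::topological_space) \<Rightarrow> 'a real_H1"
  where "curve_class g = abs_real_H1 (seg (curve_path g) 0 1)"

lemma curve_path_periodic: "curve_path g (t + 1) = curve_path g t"
  unfolding curve_path_def using cis_2pi_eq_iff[of "t + 1" t] by simp

lemma unit_circle_cis:
  assumes "w \<in> unit_circle"
  obtains t where "w = cis (2 * pi * t)"
proof
  show "w = cis (2 * pi * (Arg w / (2 * pi)))"
    using assms cis_Arg[of w] by (force simp: sgn_eq)
qed

lemma parametrizes_curve_path:
  assumes "parametrizes g c"
  shows "continuous_on UNIV (curve_path g)" "range (curve_path g) = c"
    "curve_path g s = curve_path g t \<longleftrightarrow> s - t \<in> \<int>"
proof -
  obtain h where h: "homeomorphism unit_circle c g h"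
    using assms by (auto simp: parametrizes_def)
  have g: "continuous_on unit_circle g" "g ` unit_circle = c"
    using h by (auto simp: homeomorphism_def)
  show "continuous_on UNIV (curve_path g)"
    unfolding curve_path_def by (rule continuous_on_compose2[OF g(1)]) (auto intro!: continuous_intros)
  show "range (curve_path g) = c"
  proof (rule equalityI)
    show "c \<subseteq> range (curve_path g)"
    proof
      fix x assume "x \<in> c"
      then obtain w where "w \<in> unit_circle" "x = g w"
        using g(2) by blast
      then show "x \<in> range (curve_path g)"
        by (metis curve_path_def rangeI unit_circle_cis)
    qed
    show "range (curve_path g) \<subseteq> c"
      using g(2) by (auto simp: curve_path_def)
  qed
  have "inj_on g unit_circle"
    using homeomorphism_apply1[OF h] by (metis inj_onI)
  then show "curve_path g s = curve_path g t \<longleftrightarrow> s - t \<in> \<int>"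
    by (simp add: curve_path_def inj_on_eq_iff cis_2pi_eq_iff)
qed

lemma seg_periodic_in_cycles:
  fixes \<gamma> :: "real \<Rightarrow> 'a::topological_space"
  assumes "continuous_on UNIV \<gamma>" "\<And>t. \<gamma> (t + 1) = \<gamma> t"
  shows "seg \<gamma> a (a + 1) \<in> real_cycles1"
  by (rule seg_in_cycles[OF continuous_on_subset[OF assms(1)]]) (simp_all add: assms(2))

text \<open>Cutting the loop open at a chosen parameter \<open>a\<close> allows a crossing to be
  placed at the ends 0 and 1.\<close>

lemma curve_class_shift:
  assumes "parametrizes g c"
  shows "curve_class g = abs_real_H1 (seg (\<lambda>t. curve_path g (a + t)) 0 1)"
    "seg (\<lambda>t. curve_path g (a + t)) 0 1 \<in> real_cycles1"
proof -
  note cont = parametrizes_curve_path(1)[OF assms]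
  have seg: "seg (\<lambda>t. curve_path g (a + t)) 0 1 = seg (curve_path g) a (a + 1)"
    by (rule seg_cong) (simp add: algebra_simps)
  show cyc: "seg (\<lambda>t. curve_path g (a + t)) 0 1 \<in> real_cycles1"
    unfolding seg by (rule seg_periodic_in_cycles[OF cont curve_path_periodic])
  have "seg (curve_path g) 0 (0 + 1) \<in> real_cycles1"
    by (rule seg_periodic_in_cycles[OF cont curve_path_periodic])
  then show "curve_class g = abs_real_H1 (seg (\<lambda>t. curve_path g (a + t)) 0 1)"
    using cyc path_class_periodic[OF cont curve_path_periodic, of a]
    unfolding curve_class_def by (subst abs_real_H1_eq_iff) (simp_all add: seg)
qed

text \<open>The real axis of the chart has the direction of \<open>g\<close>, and \<open>s\<close> is the sign with which \<open>h\<close>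
  crosses it.\<close>

definition oriented_crossing ::
    "('a::topological_space set \<times> ('a \<Rightarrow> complex)) set \<Rightarrow>
      (complex \<Rightarrow> 'a) \<Rightarrow> (complex \<Rightarrow> 'a) \<Rightarrow> real \<Rightarrow> 'a \<Rightarrow> bool"
  where "oriented_crossing Q g h s p \<longleftrightarrow>
    (\<exists>U \<Phi>. crosses_in_chart U \<Phi> (g ` unit_circle) (h ` unit_circle) p \<and>
      (\<forall>C \<in> Q. orientation_compatible C (U, \<Phi>)) \<and>
      (\<exists>w \<in> unit_circle. g w = p \<and> (\<forall>\<^sub>F t in at_right 0. Re (\<Phi> (g (w * cis t))) > 0)) \<and>
      (\<exists>w \<in> unit_circle. h w = p \<and> (\<forall>\<^sub>F t in at_right 0. s * Im (\<Phi> (h (w * cis t))) > 0)))"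

lemma positive_crossing_imp_oriented: "positive_crossing Q g h p \<Longrightarrow> oriented_crossing Q g h 1 p"
  by (simp add: positive_crossing_def oriented_crossing_def)

lemma chart_intoD:
  assumes "chart_into UNIV U \<phi>"
  shows "open U" "continuous_on U \<phi>" "inj_on \<phi> U" "open (\<phi> ` U)" "continuous_on (\<phi> ` U) (inv_into U \<phi>)"
proof -
  obtain g where g: "open U" "open (\<phi> ` U)" "homeomorphism U (\<phi> ` U) \<phi> g"
    using assms by (auto simp: chart_into_def)
  show "open U" "open (\<phi> ` U)"
    by (fact g)+
  show "continuous_on U \<phi>"
    using g(3) by (simp add: homeomorphism_def)
  show inj: "inj_on \<phi> U"
    using homeomorphism_apply1[OF g(3)] by (metis inj_onI)
  have "g y = inv_into U \<phi> y" if "y \<in> \<phi> ` U" for y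
    using that homeomorphism_apply1[OF g(3)] inj by (auto simp: inv_into_f_f)
  moreover have "continuous_on (\<phi> ` U) g"
    using g(3) by (simp add: homeomorphism_def)
  ultimately show "continuous_on (\<phi> ` U) (inv_into U \<phi>)"
    by (metis continuous_on_cong)
qed

text \<open>The quarter turn takes the imaginary axis to the real axis, which exchanges the roles of
  the two curves at a crossing.\<close>

lemma chart_into_rotate:
  assumes "chart_into UNIV U \<phi>"
  shows "chart_into UNIV U (\<lambda>x. - \<i> * \<phi> x)"
proof -
  obtain g where g: "open U" "open (\<phi> ` U)" "homeomorphism U (\<phi> ` U) \<phi> g"
    using assms by (auto simp: chart_into_def)
  have "homeomorphism (\<phi> ` U) ((\<lambda>z. - \<i> * z) ` \<phi> ` U) (\<lambda>z. - \<i> * z) (\<lambda>z. \<i> * z)"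
    by (auto simp: homeomorphism_def image_image intro!: continuous_intros)
  from homeomorphism_compose[OF g(3) this]
  have "\<exists>g. homeomorphism U ((\<lambda>x. - \<i> * \<phi> x) ` U) (\<lambda>x. - \<i> * \<phi> x) g"
    by (auto simp: image_image comp_def)
  moreover have "open ((\<lambda>x. - \<i> * \<phi> x) ` U)"
  proof -
    have "(\<lambda>x. - \<i> * \<phi> x) ` U = (\<lambda>z. \<i> * z) -` \<phi> ` U"
    proof (intro equalityI subsetI)
      fix x assume "x \<in> (\<lambda>z. \<i> * z) -` \<phi> ` U"
      then obtain u where u: "u \<in> U" "\<i> * x = \<phi> u"
        by auto
      have "x = - \<i> * (\<i> * x)"
        by simp
      then show "x \<in> (\<lambda>x. - \<i> * \<phi> x) ` U"
        unfolding u(2) using u(1) by blast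
    qed auto
    then show ?thesis
      using g(2) by (simp add: open_vimage continuous_intros)
  qed
  ultimately show ?thesis
    using g(1) by (simp add: chart_into_def)
qed

lemma orientation_preserving_at_cmult:
  assumes "c \<noteq> 0"
  shows "orientation_preserving_at (\<lambda>z. c * z) w"
  by (rule orientation_preserving_at_deriv[of 1 _ _ c])
    (use assms in \<open>auto intro!: continuous_intros derivative_eq_intros\<close>)

lemma orientation_compatible_rotate:
  fixes Q :: "('a::t2_space set \<times> ('a \<Rightarrow> complex)) set"
  assumes Q: "oriented_atlas Q" "C \<in> Q" and U: "chart_into UNIV U \<phi>"
    and comp: "orientation_compatible C (U, \<phi>)"
  shows "orientation_compatible C (U, \<lambda>x. - \<i> * \<phi> x)"
proof -
  obtain V \<psi> where C: "C = (V, \<psi>)" by fastforce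
  note V = atlas_chartD[OF Q(1) Q(2)[unfolded C]]
  show ?thesis
    unfolding orientation_compatible_def C split
  proof (intro ballI impI)
    fix p assume p: "p \<in> V \<inter> U" "\<psi> p \<in> interior (\<psi> ` V)"
    define D where "D = interior (\<psi> ` V) \<inter> inv_into V \<psi> -` U"
    have "open D"
      unfolding D_def
      by (rule continuous_open_preimage[OF continuous_on_subset[OF V(4) interior_subset]])
        (simp_all add: chart_intoD(1)[OF U])
    moreover have "\<psi> p \<in> D"
      using p V(3) by (simp add: D_def)
    ultimately obtain d where d: "d > 0" "ball (\<psi> p) d \<subseteq> D"
      by (meson openE)
    have D: "D \<subseteq> \<psi> ` V"
      using interior_subset by (auto simp: D_def)
    have "orientation_preserving_at ((\<lambda>z. - \<i> * z) \<circ> (\<phi> \<circ> inv_into V \<psi>)) (\<psi> p)"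
    proof (rule orientation_preserving_at_comp[OF d(1) _ _ zero_less_one])
      show "continuous_on (ball (\<psi> p) d) (\<phi> \<circ> inv_into V \<psi>)"
        by (intro continuous_on_compose continuous_on_subset[OF V(4)] continuous_on_subset[OF chart_intoD(2)[OF U]])
          (use d(2) D in \<open>auto simp: D_def\<close>)
      have "inj_on (inv_into V \<psi>) (ball (\<psi> p) d)"
        by (rule inj_on_subset[OF inj_on_inv_into[OF order_refl]]) (use d(2) D in auto)
      then show "inj_on (\<phi> \<circ> inv_into V \<psi>) (ball (\<psi> p) d)"
        by (intro comp_inj_on inj_on_subset[OF chart_intoD(3)[OF U]]) (use d(2) in \<open>auto simp: D_def\<close>)
      show "orientation_preserving_at (\<phi> \<circ> inv_into V \<psi>) (\<psi> p)"
        using comp p by (auto simp: orientation_compatible_def C)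
      show "orientation_preserving_at ((*) (- \<i>)) ((\<phi> \<circ> inv_into V \<psi>) (\<psi> p))"
        by (rule orientation_preserving_at_cmult) simp
    qed (auto intro!: continuous_intros inj_onI)
    then show "orientation_preserving_at ((\<lambda>x. - \<i> * \<phi> x) \<circ> inv_into V \<psi>) (\<psi> p)"
      by (simp add: comp_def)
  qed
qed

text \<open>After the quarter turn \<open>h\<close> runs in the positive real and \<open>g\<close>
  in the negative imaginary direction, hence the sign -1.\<close>

lemma positive_crossing_imp_oriented_swap:
  fixes Q :: "('a::t2_space set \<times> ('a \<Rightarrow> complex)) set"
  assumes Q: "oriented_atlas Q" and "positive_crossing Q g h p"
  shows "oriented_crossing Q h g (- 1) p"
proof -
  obtain U \<Phi> where U: "crosses_in_chart U \<Phi> (g ` unit_circle) (h ` unit_circle) p"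
    "\<forall>C \<in> Q. orientation_compatible C (U, \<Phi>)"
    "\<exists>w \<in> unit_circle. g w = p \<and> (\<forall>\<^sub>F t in at_right 0. Re (\<Phi> (g (w * cis t))) > 0)"
    "\<exists>w \<in> unit_circle. h w = p \<and> (\<forall>\<^sub>F t in at_right 0. Im (\<Phi> (h (w * cis t))) > 0)"
    using assms(2) unfolding positive_crossing_def by blast
  have chart: "chart_into UNIV U \<Phi>"
    using U(1) by (simp add: crosses_in_chart_def)
  have "crosses_in_chart U (\<lambda>x. - \<i> * \<Phi> x) (h ` unit_circle) (g ` unit_circle) p"
    using U(1) chart_into_rotate[OF chart] unfolding crosses_in_chart_def by auto
  moreover have "\<forall>C\<in>Q. orientation_compatible C (U, \<lambda>x. - \<i> * \<Phi> x)"
    using orientation_compatible_rotate[OF Q _ chart] U(2) by blast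
  ultimately show ?thesis
    unfolding oriented_crossing_def using U(3,4) by (intro exI[of _ U] exI[of _ "\<lambda>x. - \<i> * \<Phi> x"]) simp
qed

text \<open>A crossing describes the curve only after the crossing point. Injectivity makes the
  coordinate monotone, which gives its sign before the point.\<close>

lemma sign_change_at_zero:
  fixes y :: "real \<Rightarrow> real"
  assumes "continuous_on {- e<..<e} y" "inj_on y {- e<..<e}" "y 0 = 0" "0 < e"
    and "\<And>t. 0 < t \<Longrightarrow> t < e \<Longrightarrow> 0 < y t" and "- e < t" "t < 0"
  shows "y t < 0"
proof -
  have "strict_mono_on {- e<..<e} y \<or> strict_antimono_on {- e<..<e} y"
    using injective_eq_monotone_map[of "{- e<..<e}" y] assms(1,2)
    by (simp add: is_interval_convex_1)
  moreover have "\<not> strict_antimono_on {- e<..<e} y"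
  proof
    assume "strict_antimono_on {- e<..<e} y"
    from monotone_onD[OF this, of 0 "e / 2"] show False
      using assms(5)[of "e / 2"] assms(3,4) by simp
  qed
  ultimately have "strict_mono_on {- e<..<e} y"
    by blast
  from monotone_onD[OF this, of t 0] show ?thesis
    using assms(3,4,6,7) by simp
qed

text \<open>The constant 6 is a convenient number below the period 2 \<pi>.\<close>

lemma exp_i_eq_1:
  assumes "norm z < 6" "exp (\<i> * z) = 1"
  shows "z = 0"
proof -
  obtain n :: int where n: "Im z = 0" "Re z = of_int (2 * n) * pi"
    using assms(2) by (auto simp: exp_eq_1)
  have "\<bar>Re z\<bar> < 6"
    using assms(1) abs_Re_le_cmod[of z] by linarith
  moreover have "6 < 2 * pi"
    using pi_gt3 by simp
  moreover have "\<bar>real_of_int n\<bar> * (2 * pi) = \<bar>Re z\<bar>"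
    by (simp add: n(2) abs_mult)
  ultimately have "\<bar>real_of_int n\<bar> * (2 * pi) < 1 * (2 * pi)"
    by linarith
  then have "\<bar>real_of_int n\<bar> < 1"
    by (rule mult_right_less_imp_less) simp
  then have "n = 0" by linarith
  then show ?thesis
    using n by (simp add: complex_eq_iff)
qed

section \<open>Curves in relation to the core\<close>

context embedded_annulus
begin

definition core_set :: "'a set"
  where "core_set = \<phi> ` {z. norm z = 3 / 2}"

lemma core_set_iff: "z \<in> closed_ring \<Longrightarrow> \<phi> z \<in> core_set \<longleftrightarrow> norm z = 3 / 2"
proof -
  assume z: "z \<in> closed_ring"
  have "norm w = 3 / 2 \<Longrightarrow> w \<in> closed_ring" for w
    by (simp add: closed_ring_def)
  then show ?thesis
    unfolding core_set_def using z inv_phi by (metis (mono_tags) image_iff mem_Collect_eq)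
qed

lemma collapse_core_set: "collapse p = - 1 \<longleftrightarrow> p \<in> core_set"
  by (auto simp: collapse_eq_minus_one_iff core_set_def)

lemma inj_phi: "inj_on \<phi> closed_ring"
  by (metis inj_onI inv_phi)

text \<open>Read in the annulus coordinate, \<open>g\<close> is an injective loop on the circle of
  radius 3/2. The degree \<open>e\<close> tells whether it runs counterclockwise there.\<close>

lemma core_lift:
  assumes g: "parametrizes g core_set"
  obtains k e where "continuous_on UNIV k" "e \<in> {1, - 1 :: real}" "\<And>t. curve_path g t = core (k t)"
    "\<And>t. k (t + 1) = k t + e" "\<And>s t. s < t \<Longrightarrow> 0 < e * (k t - k s)"
proof -
  note gp = parametrizes_curve_path[OF g]
  define f where "f t = \<phi>' (curve_path g t) / (3 / 2)" for t
  have mem: "curve_path g t \<in> \<phi> ` closed_ring" "norm (\<phi>' (curve_path g t)) = 3 / 2" for t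
  proof -
    have "curve_path g t \<in> core_set"
      using gp(2) by blast
    then obtain z where z: "norm z = 3 / 2" "curve_path g t = \<phi> z"
      by (auto simp: core_set_def)
    then have "z \<in> closed_ring" by (simp add: closed_ring_def)
    with z show "curve_path g t \<in> \<phi> ` closed_ring" "norm (\<phi>' (curve_path g t)) = 3 / 2"
      by simp_all
  qed
  have "continuous_on UNIV f"
    unfolding f_def by (intro continuous_intros continuous_on_compose2[OF continuous_inv gp(1)]) (use mem in auto)
  moreover have "norm (f t) = 1" for t
    using mem(2)[of t] by (simp add: f_def norm_divide)
  moreover have "f s = f t \<longleftrightarrow> s - t \<in> \<int>" for s t
    using phi_inv[OF mem(1)[of s]] phi_inv[OF mem(1)[of t]]
    by (simp add: f_def gp(3)[symmetric]) metis
  ultimately obtain k e where k: "continuous_on UNIV k" "e \<in> {1, - 1 :: real}" "\<And>t. f t = cis (2 * pi * k t)"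
    "\<And>t. k (t + 1) = k t + e" "\<And>s t. s < t \<Longrightarrow> 0 < e * (k t - k s)"
    by (rule circle_homeomorphism_lift) blast
  have "curve_path g t = core (k t)" for t
  proof -
    have "\<phi>' (curve_path g t) = 3 / 2 * cis (2 * pi * k t)"
      using k(3)[of t] by (simp add: f_def field_simps)
    then show ?thesis
      unfolding core_def by (metis phi_inv[OF mem(1)])
  qed
  then show ?thesis
    by (rule that[OF k(1,2) _ k(4,5)])
qed

text \<open>The lift \<open>k\<close> is deformed linearly to the uniform motion with the same ends,
  which traverses the core once in the direction \<open>e\<close>.\<close>

lemma core_class:
  assumes g: "parametrizes g core_set"
    and k: "continuous_on UNIV k" "e \<in> {1, - 1 :: real}" "\<And>t. curve_path g t = core (k t)" "k 1 = k 0 + e"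
  shows "core_H1 = e *\<^sub>R curve_class g"
proof -
  have per: "core (t + 1) = core t" for t
    by (simp add: core_def cis_shift)
  define K where "K z = core ((1 - fst z) * k (snd z) + fst z * (k 0 + snd z * e))" for z :: "real \<times> real"
  have "continuous_on UNIV K"
    unfolding K_def
    by (rule continuous_on_compose2[OF continuous_core])
      (auto intro!: continuous_intros continuous_on_compose2[OF k(1)])
  then have "path_class K (0,0) (0,1) + path_class K (0,1) (1,1) =
      path_class K (0,0) (1,0) + path_class K (1,0) (1,1)"
    by (rule path_class_square) auto
  moreover have "seg K (0,0) (0,1) = seg (curve_path g) 0 1"
    by (rule seg_cong) (simp add: K_def k(3))
  moreover have "seg K (1,0) (1,1) = seg core (k 0) (k 0 + e)"
    by (rule seg_cong) (simp add: K_def algebra_simps)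
  \<comment> \<open>The ends do not move during the deformation, so these two sides are constant
    paths.\<close>
  moreover have "seg K (0,0) (1,0) = seg K (0,0) (0,0)" "seg K (0,1) (1,1) = seg K (0,1) (0,1)"
    by (rule seg_cong; simp add: K_def k(4) algebra_simps)+
  ultimately have "path_class (curve_path g) 0 1 = path_class core (k 0) (k 0 + e)"
    by (simp add: path_class_trivial)
  also have "\<dots> = e *\<^sub>R path_class core 0 1"
  proof (cases "e = 1")
    case True
    then show ?thesis
      using path_class_periodic[OF continuous_core per] by simp
  next
    case False
    then have "e = - 1" using k(2) by simp
    moreover have "path_class core (k 0) (k 0 - 1) = - path_class core (k 0 - 1) (k 0)"
      by (rule path_class_reverse) (rule continuous_on_subset[OF continuous_core], simp)
    moreover have "path_class core (k 0 - 1) (k 0 - 1 + 1) = path_class core 0 1"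
      by (rule path_class_periodic[OF continuous_core per])
    ultimately show ?thesis
      by simp
  qed
  finally have "cls (e *\<^sub>R seg (curve_path g) 0 1) = path_class core 0 1"
    using k(2) by (auto simp: linear_scale[OF linear_cls] linear_neg[OF linear_cls])
  moreover have cyc: "seg (curve_path g) 0 1 \<in> real_cycles1"
    using seg_periodic_in_cycles[OF parametrizes_curve_path(1)[OF g] curve_path_periodic, of 0] by simp
  ultimately show ?thesis
    unfolding core_H1_def curve_class_def
    by (simp add: abs_real_H1_scaleR abs_real_H1_eq_iff core_in_cycles subspace_scale[OF subspace_real_cycles1])
qed

lemma winding_of_curve:
  assumes h: "parametrizes h d"
    and L: "continuous_on {0..1} L" "\<And>t. t \<in> {0..1} \<Longrightarrow> collapse (curve_path h (a + t)) = cis (2 * pi * L t)"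
  shows "H1_winding collapse (curve_class h) = L 1 - L 0"
proof -
  have "H1_winding collapse (curve_class h) = winding collapse (seg (\<lambda>t. curve_path h (a + t)) 0 1)"
    unfolding curve_class_shift(1)[OF h, of a]
    by (rule H1_winding_abs[OF continuous_collapse norm_collapse curve_class_shift(2)[OF h]])
  also have "\<dots> = L 1 - L 0"
    by (rule winding_seg[OF L(1)]) (use L(2) in simp)
  finally show ?thesis .
qed

lemma curve_collapse_lift:
  assumes "parametrizes h d"
  obtains L :: "real \<Rightarrow> real" where "continuous_on UNIV L" "\<And>t. collapse (curve_path h (a + t)) = cis (2 * pi * L t)"
proof -
  have "continuous_on UNIV (\<lambda>t. collapse (curve_path h (a + t)))"
    by (rule continuous_on_compose2[OF continuous_collapse])
      (auto intro!: continuous_on_compose2[OF parametrizes_curve_path(1)[OF assms]] continuous_intros)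
  then obtain L :: "real \<Rightarrow> real" where "continuous_on UNIV L" "\<And>t. t \<in> UNIV \<Longrightarrow> collapse (curve_path h (a + t)) = cis (2 * pi * L t)"
    by (rule circle_lift) (auto intro: convex_imp_contractible)
  then show ?thesis using that by simp
qed

lemma cis_half: "cis (2 * pi * (1 / 2)) = - 1"
  by simp

text \<open>The collapsed loop misses -1, so its lift cannot pass a half-integer.\<close>

lemma winding_of_disjoint_curve:
  assumes h: "parametrizes h d" and "d \<inter> core_set = {}"
  shows "H1_winding collapse (curve_class h) = 0"
proof -
  obtain L where L: "continuous_on UNIV L" "\<And>t. collapse (curve_path h (0 + t)) = cis (2 * pi * L t)"
    by (rule curve_collapse_lift[OF h, where a = 0]) blast
  have "L 1 = L 0"
  proof (rule increment_without_crossing)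
    show "continuous_on {0..1} L"
      by (rule continuous_on_subset[OF L(1)]) simp
    show "L 1 - L 0 \<in> \<int>"
      using L(2)[of 0] L(2)[of 1] curve_path_periodic[of h 0] by (simp flip: cis_2pi_eq_iff)
    fix t :: real
    have "collapse (curve_path h t) \<noteq> - 1"
      using assms(2) parametrizes_curve_path(2)[OF h] by (auto simp: collapse_core_set)
    then have "cis (2 * pi * L t) \<noteq> cis (2 * pi * (1 / 2))"
      unfolding cis_half using L(2)[of t] by simp
    then show "L t - 1 / 2 \<notin> \<int>"
      by (simp only: cis_2pi_eq_iff) simp
  qed
  then show ?thesis
    using winding_of_curve[OF h, of L 0] L continuous_on_subset[OF L(1)] by simp
qed

lemma winding_of_core:
  assumes h: "parametrizes h core_set"
  shows "H1_winding collapse (curve_class h) = 0"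
proof -
  have "collapse (curve_path h (0 + t)) = cis (2 * pi * (1 / 2))" for t
    unfolding cis_half collapse_core_set using parametrizes_curve_path(2)[OF h] by auto
  then show ?thesis
    using winding_of_curve[OF h, of "\<lambda>_. 1 / 2" 0] by simp
qed

text \<open>The radius at \<zeta> is 3/2 times exp(- Im \<zeta>). The inner side of the core is thus
  the upper half plane, and \<open>collapse\<close> sends it to the upper half circle.\<close>

lemma collapse_side:
  assumes "norm z0 = 3 / 2" "z0 * exp (\<i> * \<zeta>) \<in> open_ring" "Im \<zeta> \<noteq> 0"
  shows "0 < Im \<zeta> * Im (collapse (\<phi> (z0 * exp (\<i> * \<zeta>))))"
proof -
  define r where "r = norm (z0 * exp (\<i> * \<zeta>))"
  have r: "r = 3 / 2 * exp (- Im \<zeta>)" "1 < r" "r < 2"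
    using assms by (simp_all add: r_def norm_mult open_ring_def)
  have c: "Im (collapse (\<phi> (z0 * exp (\<i> * \<zeta>)))) = sin (2 * pi * (r - 1))"
    using subsetD[OF open_ring_subset assms(2)] by (simp add: collapse_def r_def)
  show ?thesis
  proof (cases "0 < Im \<zeta>")
    case True
    then have "r < 3 / 2"
      by (simp add: r(1))
    then have "0 < sin (2 * pi * (r - 1))"
      using r(2) by (intro sin_gt_zero) simp_all
    with True c show ?thesis by simp
  next
    case False
    then have "Im \<zeta> < 0"
      using assms(3) by simp
    then have "3 / 2 < r"
      by (simp add: r(1))
    then have "sin (2 * pi * (r - 1)) < 0"
      using r(3) by (intro sin_lt_zero) (simp_all add: field_simps)
    with \<open>Im \<zeta> < 0\<close> c show ?thesis by (simp add: mult_neg_neg)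
  qed
qed

end

context embedded_annulus
begin

text \<open>In the coordinate \<open>\<zeta>\<close> with \<open>z = z0 * exp (\<i> * \<zeta>)\<close> the core circle is the real axis, and its
  inner side is the upper half plane.\<close>

lemma crossing_sides:
  assumes chart: "chart_into UNIV U \<Phi>" and core: "\<And>x. x \<in> U \<Longrightarrow> x \<in> core_set \<longleftrightarrow> Im (\<Phi> x) = 0"
    and orient: "\<And>z. z \<in> open_ring \<Longrightarrow> \<phi> z \<in> U \<Longrightarrow> orientation_preserving_at (\<Phi> \<circ> \<phi>) z"
    and z0: "norm z0 = 3 / 2" "\<phi> z0 \<in> U" "\<Phi> (\<phi> z0) = 0"
  defines "E \<equiv> \<lambda>\<zeta>. z0 * exp (\<i> * \<zeta>)"
  obtains d e where "0 < d" "e \<in> {1, - 1 :: real}"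
    "\<And>\<zeta>. norm \<zeta> < d \<Longrightarrow> E \<zeta> \<in> open_ring" "\<And>\<zeta>. norm \<zeta> < d \<Longrightarrow> \<phi> (E \<zeta>) \<in> U"
    "\<And>x. x \<noteq> 0 \<Longrightarrow> \<bar>x\<bar> < d \<Longrightarrow> 0 < e * x * Re (\<Phi> (\<phi> (E (of_real x))))"
    "\<And>\<zeta>. norm \<zeta> < d \<Longrightarrow> Im \<zeta> \<noteq> 0 \<Longrightarrow> 0 < e * Im \<zeta> * Im (\<Phi> (\<phi> (E \<zeta>)))"
    "\<And>\<zeta>. norm \<zeta> < d \<Longrightarrow> Im \<zeta> = 0 \<Longrightarrow> Im (\<Phi> (\<phi> (E \<zeta>))) = 0"
proof -
  note U = chart_intoD[OF chart]
  have z0_ne: "z0 \<noteq> 0"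
    using z0(1) by auto
  have contE: "continuous_on S E" for S
    unfolding E_def by (intro continuous_intros)
  have E0: "E 0 = z0"
    by (simp add: E_def)
  define W where "W = open_ring \<inter> \<phi> -` U"
  have W: "open W" "z0 \<in> W"
    unfolding W_def
    using continuous_open_preimage[OF continuous_on_subset[OF continuous_phi open_ring_subset] open_open_ring U(1)] z0
    by (auto simp: open_ring_def)
  then obtain r where r: "r > 0" "ball z0 r \<subseteq> W"
    by (meson openE)
  have "open (E -` W)"
    using continuous_on_open_vimage[of UNIV E] contE W(1) by simp
  then obtain d0 where d0: "d0 > 0" "ball 0 d0 \<subseteq> E -` W"
    using W(2) E0 by (metis openE vimageI)
  \<comment> \<open>Radius at most 1 keeps differences of two points below the period of the
    exponential, so \<open>E\<close> is injective on the disc.\<close>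
  define d where "d = min d0 1"
  have d: "0 < d" "\<And>\<zeta>. norm \<zeta> < d \<Longrightarrow> E \<zeta> \<in> W" "d \<le> 1"
    using d0 by (auto simp: d_def subset_eq)
  have inj_E: "inj_on E (ball 0 d)"
  proof (rule inj_onI)
    fix x y assume xy: "x \<in> ball 0 d" "y \<in> ball 0 d" "E x = E y"
    then have "exp (\<i> * (x - y)) = 1"
      using z0_ne by (simp add: E_def right_diff_distrib exp_diff)
    moreover have "norm (x - y) < 6"
      using xy d(3) norm_triangle_ineq4[of x y] by simp
    ultimately show "x = y"
      using exp_i_eq_1[of "x - y"] by simp
  qed
  define F where "F = (\<Phi> \<circ> \<phi>) \<circ> E"
  have cont_W: "continuous_on W (\<Phi> \<circ> \<phi>)"
    by (intro continuous_on_compose continuous_on_subset[OF continuous_phi] continuous_on_subset[OF U(2)])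
      (use open_ring_subset in \<open>auto simp: W_def\<close>)
  have inj_W: "inj_on (\<Phi> \<circ> \<phi>) W"
    by (intro comp_inj_on inj_on_subset[OF inj_phi] inj_on_subset[OF U(3)])
      (use open_ring_subset in \<open>auto simp: W_def\<close>)
  have cont_F: "continuous_on (ball 0 d) F"
    unfolding F_def by (intro continuous_on_compose contE continuous_on_subset[OF cont_W]) (use d(2) in auto)
  have real: "Im (F \<zeta>) = 0 \<longleftrightarrow> Im \<zeta> = 0" if "\<zeta> \<in> ball 0 d" for \<zeta>
  proof -
    have W: "E \<zeta> \<in> W"
      using that d(2) by simp
    then have "Im (F \<zeta>) = 0 \<longleftrightarrow> \<phi> (E \<zeta>) \<in> core_set"
      using core by (simp add: W_def F_def)
    also have "\<dots> \<longleftrightarrow> norm (E \<zeta>) = 3 / 2"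
      using W open_ring_subset by (intro core_set_iff) (auto simp: W_def)
    also have "\<dots> \<longleftrightarrow> Im \<zeta> = 0"
      by (simp add: E_def norm_mult z0(1))
    finally show ?thesis .
  qed
  have zero: "F \<zeta> = 0 \<longleftrightarrow> \<zeta> = 0" if "\<zeta> \<in> ball 0 d" for \<zeta>
  proof
    assume "F \<zeta> = 0"
    then have "(\<Phi> \<circ> \<phi>) (E \<zeta>) = (\<Phi> \<circ> \<phi>) (E 0)"
      using z0(3) by (simp add: F_def E0)
    then have "E \<zeta> = E 0"
      using inj_onD[OF inj_W] d(1,2) that by simp
    then show "\<zeta> = 0"
      using inj_onD[OF inj_E] that d(1) by simp
  qed (simp add: F_def E0 z0(3))
  have "orientation_preserving_at F 0"
    unfolding F_def
  proof (rule orientation_preserving_at_comp[OF d(1) contE inj_E])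
    show "0 < r" by (rule r(1))
    show "continuous_on (ball (E 0) r) (\<Phi> \<circ> \<phi>)" "inj_on (\<Phi> \<circ> \<phi>) (ball (E 0) r)"
      using continuous_on_subset[OF cont_W r(2)] inj_on_subset[OF inj_W r(2)] by (simp_all only: E0)
    show "orientation_preserving_at (\<Phi> \<circ> \<phi>) (E 0)"
      unfolding E0 by (rule orient) (use W(2) in \<open>auto simp: W_def\<close>)
    \<comment> \<open>A nonzero complex derivative gives local degree 1.\<close>
    have "(E has_field_derivative z0 * \<i>) (at 0)"
      unfolding E_def by (auto intro!: derivative_eq_intros)
    then show "orientation_preserving_at E 0"
      by (rule orientation_preserving_at_deriv[OF zero_less_one contE]) (use z0_ne in simp)
  qed
  from side_orientation[OF d(1) cont_F real zero this] obtain e :: real where e: "e \<in> {1, - 1}"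
    "\<And>x. x \<noteq> 0 \<Longrightarrow> \<bar>x\<bar> < d \<Longrightarrow> 0 < e * x * Re (F (of_real x))"
    "\<And>z. z \<in> ball 0 d \<Longrightarrow> Im z \<noteq> 0 \<Longrightarrow> 0 < e * Im z * Im (F z)"
    by blast
  show ?thesis
  proof (rule that[OF d(1) e(1)])
    show "E \<zeta> \<in> open_ring" "\<phi> (E \<zeta>) \<in> U" if "norm \<zeta> < d" for \<zeta>
      using d(2)[OF that] by (auto simp: W_def)
    show "0 < e * x * Re (\<Phi> (\<phi> (E (of_real x))))" if "x \<noteq> 0" "\<bar>x\<bar> < d" for x
      using e(2)[OF that] by (simp add: F_def)
    show "0 < e * Im \<zeta> * Im (\<Phi> (\<phi> (E \<zeta>)))" if "norm \<zeta> < d" "Im \<zeta> \<noteq> 0" for \<zeta>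
      using e(3)[of \<zeta>] that by (simp add: F_def)
    show "Im (\<Phi> (\<phi> (E \<zeta>))) = 0" if "norm \<zeta> < d" "Im \<zeta> = 0" for \<zeta>
      using real[of \<zeta>] that by (simp add: F_def)
  qed
qed

text \<open>Cut open at \<open>p\<close>, the curve has a lift that starts at a half-integer, avoids
  half-integers in between and ends at one. The side on which it leaves the core is determined by
  \<open>e\<close> and \<open>s\<close>, and it returns from the opposite side; this fixes the
  increment.\<close>

lemma crossing_winding:
  assumes Q: "oriented_atlas Q"
    and ring_orient: "\<And>V \<psi> z. (V, \<psi>) \<in> Q \<Longrightarrow> z \<in> open_ring \<Longrightarrow> \<phi> z \<in> V \<Longrightarrow> orientation_preserving_at (\<psi> \<circ> \<phi>) z"
    and g: "parametrizes g core_set"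
    and k: "continuous_on UNIV k" "e \<in> {1, - 1 :: real}" "\<And>t. curve_path g t = core (k t)"
      "\<And>s t. s < t \<Longrightarrow> 0 < e * (k t - k s)"
    and h: "parametrizes h c" and inter: "c \<inter> core_set = {p}"
    and cross: "oriented_crossing Q g h s p" and s: "s \<in> {1, - 1}"
  shows "e * H1_winding collapse (curve_class h) = - s"
proof -
  have im: "g ` unit_circle = core_set" "h ` unit_circle = c"
    using g h by (auto simp: parametrizes_def homeomorphism_def)
  obtain U \<Phi> w w' where U: "chart_into UNIV U \<Phi>" "p \<in> U" "\<Phi> p = 0"
    "\<And>x. x \<in> U \<Longrightarrow> x \<in> core_set \<longleftrightarrow> Im (\<Phi> x) = 0" "\<And>x. x \<in> U \<Longrightarrow> x \<in> c \<longleftrightarrow> Re (\<Phi> x) = 0"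
    and compat: "\<And>C. C \<in> Q \<Longrightarrow> orientation_compatible C (U, \<Phi>)"
    and w: "w \<in> unit_circle" "g w = p" "\<forall>\<^sub>F t in at_right 0. Re (\<Phi> (g (w * cis t))) > 0"
    and w': "w' \<in> unit_circle" "h w' = p" "\<forall>\<^sub>F t in at_right 0. s * Im (\<Phi> (h (w' * cis t))) > 0"
    using cross unfolding oriented_crossing_def crosses_in_chart_def im by metis
  note Ud = chart_intoD[OF U(1)]
  obtain t0 where t0: "w = cis (2 * pi * t0)"
    by (rule unit_circle_cis[OF w(1)])
  obtain t1 where t1: "w' = cis (2 * pi * t1)"
    by (rule unit_circle_cis[OF w'(1)])
  define z0 where "z0 = 3 / 2 * cis (2 * pi * k t0)"
  have z0: "norm z0 = 3 / 2"
    by (simp add: z0_def norm_mult)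
  have p: "\<phi> z0 = p"
    using k(3)[of t0] w(2) t0 by (simp add: curve_path_def core_def z0_def)
  have z0_ring: "z0 \<in> open_ring"
    using z0 by (simp add: open_ring_def)
  have cont_phi: "continuous_on open_ring \<phi>" and inj_phi': "inj_on \<phi> open_ring"
    using open_ring_subset by (auto intro: continuous_on_subset[OF continuous_phi] inj_on_subset[OF inj_phi])
  have orient: "orientation_preserving_at (\<Phi> \<circ> \<phi>) z" if z: "z \<in> open_ring" "\<phi> z \<in> U" for z
  proof -
    obtain V \<psi> where V: "(V, \<psi>) \<in> Q" "\<phi> z \<in> V"
      by (rule atlas_chart[OF Q])
    have "\<psi> (\<phi> z) \<in> interior (\<psi> ` V)"
      by (rule surface_image_interior[OF Q V(1) cont_phi inj_phi' open_open_ring z(1) V(2)])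
    then have "orientation_preserving_at (\<Phi> \<circ> inv_into V \<psi>) (\<psi> (\<phi> z))"
      using compat[OF V(1)] V(2) z(2) by (auto simp: orientation_compatible_def)
    then show ?thesis
      by (rule orientation_preserving_through_chart[OF Q V(1) cont_phi inj_phi' open_open_ring z(1) V(2)
          Ud(2,3,1) z(2) ring_orient[OF V(1) z(1) V(2)]])
  qed
  obtain d e' where d: "0 < d" and e': "e' \<in> {1, - 1 :: real}"
    and ring: "\<And>\<zeta>. norm \<zeta> < d \<Longrightarrow> z0 * exp (\<i> * \<zeta>) \<in> open_ring"
    and in_U: "\<And>\<zeta>. norm \<zeta> < d \<Longrightarrow> \<phi> (z0 * exp (\<i> * \<zeta>)) \<in> U"
    and side_re: "\<And>x. x \<noteq> 0 \<Longrightarrow> \<bar>x\<bar> < d \<Longrightarrow> 0 < e' * x * Re (\<Phi> (\<phi> (z0 * exp (\<i> * of_real x))))"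
    and side_im: "\<And>\<zeta>. norm \<zeta> < d \<Longrightarrow> Im \<zeta> \<noteq> 0 \<Longrightarrow> 0 < e' * Im \<zeta> * Im (\<Phi> (\<phi> (z0 * exp (\<i> * \<zeta>))))"
    and side_0: "\<And>\<zeta>. norm \<zeta> < d \<Longrightarrow> Im \<zeta> = 0 \<Longrightarrow> Im (\<Phi> (\<phi> (z0 * exp (\<i> * \<zeta>)))) = 0"
    by (rule crossing_sides[OF U(1,4) orient z0]) (use p U(2,3) in auto)
  \<comment> \<open>Both signs describe the direction of \<open>g\<close> along the core:
    \<open>e\<close> in the annulus coordinate, and \<open>e'\<close> through the chart, whose real
    part is positive just after the crossing.\<close>
  have "e' = e"
  proof -
    obtain b where b: "0 < b" "\<And>t. 0 < t \<Longrightarrow> t < b \<Longrightarrow> Re (\<Phi> (g (w * cis t))) > 0"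
      using w(3) by (auto simp: eventually_at_right_field)
    have "isCont k t0"
      using k(1) by (simp add: continuous_on_eq_continuous_at)
    then obtain b' where b': "0 < b'" "\<And>t. \<bar>t - t0\<bar> < b' \<Longrightarrow> \<bar>k t - k t0\<bar> < d / (2 * pi)"
      using d unfolding continuous_at_eps_delta dist_real_def
      by (metis divide_pos_pos mult_pos_pos pi_gt_zero zero_less_numeral)
    define u where "u = min (b / (2 * pi)) b' / 2"
    have u: "0 < u" "u < b'" "2 * pi * u < b"
    proof -
      show "0 < u" "u < b'"
        using b(1) b'(1) by (auto simp: u_def)
      have "u \<le> b / (2 * pi) / 2"
        by (simp add: u_def)
      then have "2 * pi * u \<le> b / 2"
        by (simp add: field_simps)
      then show "2 * pi * u < b"
        using b(1) by simp
    qed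
    define x where "x = 2 * pi * (k (t0 + u) - k t0)"
    have ex: "0 < e * x"
    proof -
      have "e * x = 2 * pi * (e * (k (t0 + u) - k t0))"
        by (simp add: x_def)
      also have "0 < \<dots>"
        by (rule mult_pos_pos) (use k(4)[of t0 "t0 + u"] u(1) in simp_all)
      finally show ?thesis .
    qed
    have "\<bar>x\<bar> < d"
    proof -
      have "\<bar>k (t0 + u) - k t0\<bar> * (2 * pi) < d"
        using b'(2)[of "t0 + u"] u by (simp add: less_divide_eq)
      then show ?thesis
        by (simp add: x_def abs_mult mult.commute)
    qed
    then have "0 < e' * x * Re (\<Phi> (\<phi> (z0 * exp (\<i> * of_real x))))"
      using ex by (intro side_re) auto
    moreover have "z0 * exp (\<i> * of_real x) = 3 / 2 * cis (2 * pi * k (t0 + u))"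
    proof -
      have "2 * pi * k t0 + x = 2 * pi * k (t0 + u)"
        by (simp add: x_def algebra_simps)
      then show ?thesis
        by (simp add: z0_def mult.assoc cis_mult flip: cis_conv_exp)
    qed
    then have "\<phi> (z0 * exp (\<i> * of_real x)) = curve_path g (t0 + u)"
      unfolding k(3) core_def by (rule arg_cong)
    moreover have "curve_path g (t0 + u) = g (w * cis (2 * pi * u))"
      by (simp add: curve_path_def t0 cis_mult distrib_left)
    moreover have "0 < Re (\<Phi> (g (w * cis (2 * pi * u))))"
      using b(2)[of "2 * pi * u"] u by simp
    ultimately have "0 < e' * x"
      by (simp add: zero_less_mult_iff)
    then show ?thesis
      using ex e' k(2) by auto
  qed
  define \<gamma> where "\<gamma> t = curve_path h (t1 + t)" for t
  note hp = parametrizes_curve_path[OF h]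
  have \<gamma>: "continuous_on S \<gamma>" for S
    unfolding \<gamma>_def by (rule continuous_on_compose2[OF hp(1)]) (auto intro: continuous_intros)
  have \<gamma>0: "\<gamma> 0 = p"
    by (simp add: \<gamma>_def curve_path_def w'(2) flip: t1)
  have \<gamma>_inj: "\<gamma> a = \<gamma> b \<longleftrightarrow> a - b \<in> \<int>" for a b
    using hp(3)[of "t1 + a" "t1 + b"] by (simp add: \<gamma>_def)
  have \<gamma>_c: "\<gamma> t \<in> c" for t
    using hp(2) by (auto simp: \<gamma>_def)
  have \<gamma>_per: "\<gamma> (t + 1) = \<gamma> t" for t
    by (simp add: \<gamma>_inj)
  \<comment> \<open>The coordinate of the curve near the crossing; the principal logarithm is
    continuous there because its argument is 1 at \<open>p\<close>.\<close>
  define \<zeta> where "\<zeta> t = - \<i> * Ln (\<phi>' (\<gamma> t) / z0)" for t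
  have "isCont \<gamma> 0"
    using \<gamma>[of UNIV] by (simp add: continuous_on_eq_continuous_at)
  have p_in: "p \<in> \<phi> ` open_ring"
    using p z0_ring by blast
  have "continuous_on (\<phi> ` open_ring) \<phi>'"
    using open_ring_subset by (intro continuous_on_subset[OF continuous_inv]) auto
  then have "isCont \<phi>' (\<gamma> 0)"
    unfolding \<gamma>0 by (rule bspec[OF iffD1[OF continuous_on_eq_continuous_at[OF open_interior]] p_in])
  have inv_p: "\<phi>' (\<gamma> 0) = z0"
    using z0_ring open_ring_subset p[symmetric] by (auto simp: \<gamma>0)
  have z0_ne: "z0 \<noteq> 0"
    using z0 by auto
  have "isCont (\<lambda>t. \<phi>' (\<gamma> t)) 0"
    by (rule isCont_o2[OF \<open>isCont \<gamma> 0\<close> \<open>isCont \<phi>' (\<gamma> 0)\<close>])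
  then have "isCont \<zeta> 0"
    unfolding \<zeta>_def using inv_p z0_ne by (intro continuous_intros) auto
  then have "\<exists>b1>0. \<forall>t. dist t 0 < b1 \<longrightarrow> dist (\<zeta> t) (\<zeta> 0) < d"
    using d unfolding continuous_at_eps_delta by blast
  moreover have "\<zeta> 0 = 0"
    using inv_p z0_ne by (simp add: \<zeta>_def)
  ultimately obtain b1 where b1: "0 < b1" "\<And>t. \<bar>t\<bar> < b1 \<Longrightarrow> norm (\<zeta> t) < d"
    by auto
  have "open (\<gamma> -` (\<phi> ` open_ring))"
    by (rule open_vimage[OF open_interior \<gamma>])
  then obtain b2 where b2: "0 < b2" "\<And>t. \<bar>t\<bar> < b2 \<Longrightarrow> \<gamma> t \<in> \<phi> ` open_ring"
  proof (rule openE)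
    show "0 \<in> \<gamma> -` (\<phi> ` open_ring)"
      using p_in \<gamma>0 by simp
  qed (auto simp: subset_eq)
  obtain b3 where b3: "0 < b3" "\<And>t. 0 < t \<Longrightarrow> t < b3 \<Longrightarrow> s * Im (\<Phi> (h (w' * cis t))) > 0"
    using w'(3) by (auto simp: eventually_at_right_field)
  \<comment> \<open>The bound 1/2 keeps distinct parameters in (-b, b) incongruent modulo 1; the
    factor 2 \<pi> converts angles into turns.\<close>
  define b where "b = min (min b1 b2) (min (b3 / (2 * pi)) (1 / 2))"
  have b: "0 < b" "b \<le> 1 / 2" "b \<le> b1" "b \<le> b2" "b \<le> b3 / (2 * pi)"
    using b1(1) b2(1) b3(1) by (auto simp: b_def)
  have local: "\<gamma> t = \<phi> (z0 * exp (\<i> * \<zeta> t))" "norm (\<zeta> t) < d" if "\<bar>t\<bar> < b" for t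
  proof -
    have "\<gamma> t \<in> \<phi> ` open_ring"
      using b2(2) that b(4) by simp
    then obtain z where z: "z \<in> open_ring" "\<gamma> t = \<phi> z"
      by blast
    then have "\<phi>' (\<gamma> t) = z" "z \<noteq> 0"
      using open_ring_subset by (auto simp: open_ring_def)
    with z(2) show "\<gamma> t = \<phi> (z0 * exp (\<i> * \<zeta> t))"
      using z0_ne by (simp add: \<zeta>_def)
    show "norm (\<zeta> t) < d"
      using b1(2) that b(3) by simp
  qed
  \<comment> \<open>The signed height of the curve over the core. It determines the point of the
    curve, on which the real part of \<Phi> vanishes.\<close>
  define y where "y t = s * Im (\<Phi> (\<gamma> t))" for t
  have \<gamma>_U: "\<gamma> t \<in> U" if "\<bar>t\<bar> < b" for t
    unfolding local(1)[OF that] by (rule in_U[OF local(2)[OF that]])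
  have y_pos: "0 < y t" if "0 < t" "t < b" for t
  proof -
    have "t < b3 / (2 * pi)"
      using that b(5) by linarith
    then have "t * (2 * pi) < b3"
      by (simp add: less_divide_eq)
    then have "0 < s * Im (\<Phi> (h (w' * cis (2 * pi * t))))"
      using that by (intro b3(2)) (simp_all add: mult.commute)
    then show ?thesis
      by (simp add: y_def \<gamma>_def curve_path_def t1 cis_mult distrib_left)
  qed
  have y_neg: "y t < 0" if "- b < t" "t < 0" for t
  proof (rule sign_change_at_zero[OF _ _ _ b(1) y_pos that])
    show "continuous_on {- b<..<b} y"
      unfolding y_def
      by (intro continuous_intros continuous_on_compose2[OF Ud(2) \<gamma>]) (use \<gamma>_U in \<open>auto simp: abs_less_iff\<close>)
    show "inj_on y {- b<..<b}"
    proof (rule inj_onI)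
      fix a a' assume a: "a \<in> {- b<..<b}" "a' \<in> {- b<..<b}" "y a = y a'"
      then have ab: "\<bar>a\<bar> < b" "\<bar>a'\<bar> < b" by auto
      have "Im (\<Phi> (\<gamma> a)) = Im (\<Phi> (\<gamma> a'))"
        using a(3) s by (auto simp: y_def)
      moreover have "Re (\<Phi> (\<gamma> a)) = 0" "Re (\<Phi> (\<gamma> a')) = 0"
        using U(5)[OF \<gamma>_U[OF ab(1)]] U(5)[OF \<gamma>_U[OF ab(2)]] \<gamma>_c by auto
      ultimately have "\<Phi> (\<gamma> a) = \<Phi> (\<gamma> a')"
        by (simp add: complex_eq_iff)
      then have "\<gamma> a = \<gamma> a'"
        by (rule inj_onD[OF Ud(3) _ \<gamma>_U[OF ab(1)] \<gamma>_U[OF ab(2)]])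
      then obtain n :: int where n: "a - a' = of_int n"
        unfolding \<gamma>_inj by (auto elim: Ints_cases)
      moreover have "\<bar>a - a'\<bar> < 1"
        using ab b(2) by linarith
      ultimately have "n = 0" by linarith
      then show "a = a'" using n by simp
    qed
    show "y 0 = 0"
      by (simp add: y_def \<gamma>0 U(3))
  qed
  \<comment> \<open>The height and the imaginary part of \<open>collapse\<close> are both compared
    in sign with Im \<zeta>, which then cancels as a square.\<close>
  have side: "0 < (e * s) * Im (collapse (\<gamma> t)) * y t" if "\<bar>t\<bar> < b" "y t \<noteq> 0" for t
  proof -
    have Im: "Im (\<zeta> t) \<noteq> 0"
      using side_0[OF local(2)[OF that(1)]] that(2) local(1)[OF that(1)] by (auto simp: y_def)
    have "0 < e * Im (\<zeta> t) * Im (\<Phi> (\<gamma> t))"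
      using side_im[OF local(2)[OF that(1)] Im] local(1)[OF that(1)] \<open>e' = e\<close> by simp
    moreover have "0 < Im (\<zeta> t) * Im (collapse (\<gamma> t))"
      using collapse_side[OF z0 ring[OF local(2)[OF that(1)]] Im] local(1)[OF that(1)] by simp
    ultimately have "0 < (e * Im (\<zeta> t) * Im (\<Phi> (\<gamma> t))) * (Im (\<zeta> t) * Im (collapse (\<gamma> t)))"
      by (rule mult_pos_pos)
    also have "\<dots> = (e * Im (collapse (\<gamma> t)) * Im (\<Phi> (\<gamma> t))) * (Im (\<zeta> t) * Im (\<zeta> t))"
      by (simp add: mult_ac)
    finally have "0 < e * Im (collapse (\<gamma> t)) * Im (\<Phi> (\<gamma> t))"
      by (rule zero_less_mult_pos2) (use Im in \<open>auto simp: zero_less_mult_iff linorder_neq_iff\<close>)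
    also have "\<dots> = (s * s) * (e * Im (collapse (\<gamma> t)) * Im (\<Phi> (\<gamma> t)))"
      using s by auto
    also have "\<dots> = (e * s) * Im (collapse (\<gamma> t)) * y t"
      by (simp add: y_def mult_ac)
    finally show ?thesis .
  qed
  obtain L where L: "continuous_on UNIV L" "\<And>t. collapse (curve_path h (t1 + t)) = cis (2 * pi * L t)"
    by (rule curve_collapse_lift[OF h]) blast
  have L': "collapse (\<gamma> t) = cis (2 * pi * L t)" for t
    using L(2) by (simp add: \<gamma>_def)
  define \<kappa> where "\<kappa> = e * s"
  have \<kappa>: "\<kappa> \<in> {1, - 1}"
    using k(2) s by (auto simp: \<kappa>_def)
  \<comment> \<open>The lift normalized to start at 0 and to be negative at first, as
    \<open>increment_of_crossing\<close> demands.\<close>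
  define N where "N t = \<kappa> * (L t - L 0)" for t
  have L0: "cis (2 * pi * L 0) = - 1"
  proof -
    have "p \<in> core_set"
      using inter by blast
    then show ?thesis
      using L'[of 0] by (simp add: \<gamma>0 flip: collapse_core_set)
  qed
  have sinN: "sin (2 * pi * N t) = - \<kappa> * Im (collapse (\<gamma> t))" for t
  proof -
    have cis: "cis (2 * pi * (L t - L 0)) = - collapse (\<gamma> t)"
      using L0 by (simp add: right_diff_distrib L' flip: cis_divide)
    have sin: "sin (2 * pi * (L t - L 0)) = - Im (collapse (\<gamma> t))"
      using arg_cong[OF cis, of Im] by (simp only: cis.sel uminus_complex.sel)
    consider "\<kappa> = 1" | "\<kappa> = - 1"
      using \<kappa> by blast
    then show ?thesis
    proof cases
      case 1
      then show ?thesis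
        using sin by (simp add: N_def)
    next
      case 2
      then have "2 * pi * N t = - (2 * pi * (L t - L 0))"
        by (simp add: N_def algebra_simps)
      then show ?thesis
        using sin 2 by (simp only: sin_minus)
    qed
  qed
  have N_int: "N t \<in> \<int> \<longleftrightarrow> L t - L 0 \<in> \<int>" for t
    using \<kappa> minus_in_Ints_iff[of "L t - L 0"] by (auto simp: N_def)
  have "N 1 = - 1"
  proof (rule increment_of_crossing[OF _ _ _ _ b(1)])
    show "continuous_on {0..1} N"
      unfolding N_def by (intro continuous_intros continuous_on_subset[OF L(1)]) auto
    show "N 0 = 0"
      by (simp add: N_def)
    have "L 1 - L 0 \<in> \<int>"
      using \<gamma>_per[of 0] L'[of 0] L'[of 1] by (simp flip: cis_2pi_eq_iff)
    then show "N 1 \<in> \<int>"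
      by (simp only: N_int)
    fix t :: real
    show "N t \<notin> \<int>" if t: "0 < t" "t < 1"
    proof
      assume "N t \<in> \<int>"
      then have "L t - L 0 \<in> \<int>"
        by (simp only: N_int)
      then have "collapse (\<gamma> t) = - 1"
        using L0 L'[of t] by (simp flip: cis_2pi_eq_iff)
      then have "\<gamma> t = \<gamma> 0"
        using inter \<gamma>_c[of t] \<gamma>0 by (auto simp: collapse_core_set)
      then obtain n :: int where "t = of_int n"
        unfolding \<gamma>_inj by (auto elim: Ints_cases)
      then show False
        using t by simp
    qed
    show "sin (2 * pi * N t) < 0" if "0 < t" "t < b"
      using side[of t] y_pos[OF that] that by (simp add: sinN \<kappa>_def zero_less_mult_iff)
    show "0 < sin (2 * pi * N t)" if t: "1 - b < t" "t < 1"
    proof -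
      have "0 < (e * s) * Im (collapse (\<gamma> (t - 1))) * y (t - 1)" "y (t - 1) < 0"
        using side[of "t - 1"] y_neg[of "t - 1"] t by auto
      then have "\<kappa> * Im (collapse (\<gamma> (t - 1))) < 0"
        by (auto simp: \<kappa>_def zero_less_mult_iff)
      then show ?thesis
        using \<gamma>_per[of "t - 1"] by (simp add: sinN)
    qed
  qed
  then have "\<kappa> * (L 1 - L 0) = - 1"
    by (simp add: N_def)
  moreover have "H1_winding collapse (curve_class h) = L 1 - L 0"
    by (rule winding_of_curve[OF h, where a = t1]) (use L in \<open>auto intro: continuous_on_subset\<close>)
  ultimately show ?thesis
    using k(2) s by (auto simp: \<kappa>_def)
qed

end

section \<open>The action of multitwists on homology\<close>

text \<open>Invariance of domain in the charts provides openness of the image of the open ring. The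
  orientation condition is available there because the open ring lies in the interior of the closed
  one.\<close>

lemma left_twist_annulus:
  fixes Q :: "('a::t2_space set \<times> ('a \<Rightarrow> complex)) set"
  assumes Q: "oriented_atlas Q" and "left_twist_homeo Q P c h"
  obtains \<phi> \<phi>' where "embedded_annulus \<phi> \<phi>'" "\<phi> ` {z. norm z = 3 / 2} = c" "\<phi> ` closed_ring \<subseteq> - P"
    "\<And>V \<psi> z. (V, \<psi>) \<in> Q \<Longrightarrow> z \<in> open_ring \<Longrightarrow> \<phi> z \<in> V \<Longrightarrow> orientation_preserving_at (\<psi> \<circ> \<phi>) z"
    "\<And>z. z \<in> closed_ring \<Longrightarrow> h (\<phi> z) = \<phi> (z * cis (2 * pi * (norm z - 1)))"
    "\<And>x. x \<notin> \<phi> ` closed_ring \<Longrightarrow> h x = x"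
proof -
  obtain \<phi> \<phi>' where \<phi>: "homeomorphism closed_ring (\<phi> ` closed_ring) \<phi> \<phi>'" "\<phi> ` closed_ring \<subseteq> - P"
    "\<phi> ` {z. norm z = 3 / 2} = c"
    "\<forall>(V, \<psi>) \<in> Q. \<forall>z \<in> interior closed_ring. \<phi> z \<in> V \<longrightarrow> orientation_preserving_at (\<psi> \<circ> \<phi>) z"
    "\<forall>z \<in> closed_ring. h (\<phi> z) = \<phi> (z * cis (2 * pi * (norm z - 1)))"
    "\<forall>x. x \<notin> \<phi> ` closed_ring \<longrightarrow> h x = x"
    using assms(2) unfolding left_twist_homeo_def Let_def closed_ring_def[symmetric] by blast
  have "inj_on \<phi> closed_ring"
    using homeomorphism_apply1[OF \<phi>(1)] by (metis inj_onI)
  then have "open (\<phi> ` open_ring)"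
    using \<phi>(1) open_ring_subset
    by (intro surface_image_open[OF Q _ _ open_open_ring])
      (auto simp: homeomorphism_def intro: continuous_on_subset inj_on_subset)
  then have ann: "embedded_annulus \<phi> \<phi>'"
    using \<phi>(1) by unfold_locales
  have sub: "open_ring \<subseteq> interior closed_ring"
    by (rule interior_maximal[OF open_ring_subset open_open_ring])
  show ?thesis
  proof (rule that[OF ann \<phi>(3,2)])
    show "orientation_preserving_at (\<psi> \<circ> \<phi>) z" if "(V, \<psi>) \<in> Q" "z \<in> open_ring" "\<phi> z \<in> V" for V \<psi> z
      using bspec[OF \<phi>(4) that(1)] that(2,3) sub by blast
  qed (use \<phi>(5,6) in blast)+
qed

text \<open>The linear form \<open>F\<close> is, up to sign, the algebraic intersection with \<open>c\<close>.\<close>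

definition crossing_form ::
    "('a::topological_space set \<times> ('a \<Rightarrow> complex)) set \<Rightarrow> (complex \<Rightarrow> 'a) \<Rightarrow> 'a set \<Rightarrow> ('a real_H1 \<Rightarrow> real) \<Rightarrow> bool"
  where "crossing_form Q g c F \<longleftrightarrow> linear F \<and> F (curve_class g) = 0 \<and>
    (\<forall>h d. parametrizes h d \<and> d \<inter> c = {} \<longrightarrow> F (curve_class h) = 0) \<and>
    (\<forall>h d p s. parametrizes h d \<and> d \<inter> c = {p} \<and> s \<in> {1, - 1} \<and> oriented_crossing Q g h s p \<longrightarrow>
      F (curve_class h) = - s)"

text \<open>The form is \<open>e\<close> times the winding. The second factor \<open>e\<close>
  needed to replace the core by the oriented curve comes from \<open>core_class\<close>, and the two
  signs cancel.\<close>

lemma twist_action: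
  fixes Q :: "('a::t2_space set \<times> ('a \<Rightarrow> complex)) set"
  assumes Q: "oriented_atlas Q" and tw: "left_twist_homeo Q P c f" and f: "continuous_on UNIV f"
    and g: "parametrizes g c"
  shows "\<exists>F. crossing_form Q g c F \<and> H1_map f = (\<lambda>x. x + F x *\<^sub>R curve_class g)"
proof -
  obtain \<phi> \<phi>' where \<phi>: "embedded_annulus \<phi> \<phi>'" "\<phi> ` {z. norm z = 3 / 2} = c"
    "\<And>V \<psi> z. (V, \<psi>) \<in> Q \<Longrightarrow> z \<in> open_ring \<Longrightarrow> \<phi> z \<in> V \<Longrightarrow> orientation_preserving_at (\<psi> \<circ> \<phi>) z"
    "\<And>z. z \<in> closed_ring \<Longrightarrow> f (\<phi> z) = \<phi> (z * cis (2 * pi * (norm z - 1)))"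
    "\<And>x. x \<notin> \<phi> ` closed_ring \<Longrightarrow> f x = x"
    by (rule left_twist_annulus[OF Q tw]) blast
  interpret embedded_annulus \<phi> \<phi>' by (rule \<phi>(1))
  have c: "core_set = c"
    unfolding core_set_def by (rule \<phi>(2))
  have g': "parametrizes g core_set"
    by (simp add: c g)
  obtain k e where k: "continuous_on UNIV k" "e \<in> {1, - 1 :: real}" "\<And>t. curve_path g t = core (k t)"
    "\<And>t. k (t + 1) = k t + e" "\<And>s t. s < t \<Longrightarrow> 0 < e * (k t - k s)"
    by (rule core_lift[OF g']) blast
  have "k 1 = k 0 + e"
    using k(4)[of 0] by simp
  then have core: "core_H1 = e *\<^sub>R curve_class g"
    by (rule core_class[OF g' k(1-3)])
  show ?thesis
  proof (intro exI conjI)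
    show "H1_map f = (\<lambda>x. x + (e * H1_winding collapse x) *\<^sub>R curve_class g)"
      by (rule ext) (simp add: H1_map_twist[OF f \<phi>(4,5)] core mult.commute)
    have "linear (\<lambda>x. e * H1_winding collapse x)"
      using linear_compose_scale_right[OF linear_collapse_winding, of e] by simp
    moreover have "e * H1_winding collapse (curve_class h) = - s"
      if "parametrizes h d" "d \<inter> c = {p}" "s \<in> {1, - 1}" "oriented_crossing Q g h s p" for h d p s
      by (rule crossing_winding[OF Q \<phi>(3) g' k(1-3,5) that(1) _ that(4,3)]) (simp_all add: c that(2))
    ultimately show "crossing_form Q g c (\<lambda>x. e * H1_winding collapse x)"
      using winding_of_core[OF g'] winding_of_disjoint_curve c by (auto simp: crossing_form_def)
  qed
qed

text \<open>\<open>induced_H1\<close> picks an arbitrary representative, so all of them have to be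
  covered; nonemptiness makes the choice meaningful.\<close>

definition induces ::
    "('a::topological_space set \<times> ('a \<Rightarrow> complex)) set \<Rightarrow> 'a set \<Rightarrow> ('a \<Rightarrow> 'a) set \<Rightarrow> ('a real_H1 \<Rightarrow> 'a real_H1) \<Rightarrow> bool"
  where "induces Q P m \<Psi> \<longleftrightarrow> m \<noteq> {} \<and> (\<forall>f\<in>m. f \<in> orientation_homeos Q P \<and> H1_map f = \<Psi>)"

lemma induced_H1_eq: "induces Q P m \<Psi> \<Longrightarrow> induced_H1 m = \<Psi>"
  unfolding induces_def induced_H1_def by (metis some_in_eq)

lemma orientation_homeos_continuous: "f \<in> orientation_homeos Q P \<Longrightarrow> continuous_on UNIV f"
  by (auto simp: orientation_homeos_def homeomorphism_def)

lemma orientation_homeosD: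
  assumes "f \<in> orientation_homeos Q P" "(U, \<phi>) \<in> Q" "(V, \<psi>) \<in> Q" "p \<in> U" "f p \<in> V" "\<phi> p \<in> interior (\<phi> ` U)"
  shows "orientation_preserving_at (\<psi> \<circ> f \<circ> inv_into U \<phi>) (\<phi> p)"
proof -
  have *: "\<forall>(U, \<phi>) \<in> Q. \<forall>(V, \<psi>) \<in> Q. \<forall>p \<in> U. f p \<in> V \<and> \<phi> p \<in> interior (\<phi> ` U) \<longrightarrow>
      orientation_preserving_at (\<psi> \<circ> f \<circ> inv_into U \<phi>) (\<phi> p)"
    using assms(1) unfolding orientation_homeos_def by (elim CollectE conjE)
  from bspec[OF * assms(2)] have "\<forall>(V, \<psi>) \<in> Q. \<forall>p \<in> U. f p \<in> V \<and> \<phi> p \<in> interior (\<phi> ` U) \<longrightarrow>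
      orientation_preserving_at (\<psi> \<circ> f \<circ> inv_into U \<phi>) (\<phi> p)"
    unfolding split .
  from bspec[OF this assms(3)] show ?thesis
    unfolding split using assms(4-6) by blast
qed

lemma isotopic_homeosD:
  assumes "isotopic_homeos Q P f g"
  shows "f \<in> orientation_homeos Q P" "g \<in> orientation_homeos Q P" "H1_map f = H1_map g"
  using assms homotopic_with_imp_property[OF assms[unfolded isotopic_homeos_def]] H1_map_homotopic
  by (auto simp: isotopic_homeos_def)

lemma isotopic_homeos_refl: "f \<in> orientation_homeos Q P \<Longrightarrow> isotopic_homeos Q P f f"
  using orientation_homeos_continuous by (simp add: isotopic_homeos_def homotopic_with_refl)

lemma id_in_orientation_homeos:
  fixes Q :: "('a::t2_space set \<times> ('a \<Rightarrow> complex)) set"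
  assumes "oriented_atlas Q"
  shows "id \<in> orientation_homeos Q P"
proof -
  have "orientation_preserving_at (\<psi> \<circ> id \<circ> inv_into U \<phi>) (\<phi> p)"
    if "(U, \<phi>) \<in> Q" "(V, \<psi>) \<in> Q" "p \<in> U" "id p \<in> V \<and> \<phi> p \<in> interior (\<phi> ` U)" for U \<phi> V \<psi> p
    using assms that unfolding oriented_atlas_def orientation_compatible_def by fastforce
  moreover have "\<exists>g. homeomorphism UNIV UNIV (id :: 'a \<Rightarrow> 'a) g"
    by (rule exI[of _ id]) (simp add: homeomorphism_def id_def)
  ultimately show ?thesis
    unfolding orientation_homeos_def by auto
qed

lemma comp_in_orientation_homeos:
  fixes Q :: "('a::t2_space set \<times> ('a \<Rightarrow> complex)) set"
  assumes Q: "oriented_atlas Q" and f: "f \<in> orientation_homeos Q P" and g: "g \<in> orientation_homeos Q P"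
  shows "f \<circ> g \<in> orientation_homeos Q P"
proof -
  obtain f' g' where hom: "homeomorphism UNIV UNIV f f'" "homeomorphism UNIV UNIV g g'"
    using f g by (auto simp: orientation_homeos_def)
  have inj: "inj f" "inj g"
    using homeomorphism_apply1[OF hom(1)] homeomorphism_apply1[OF hom(2)] by (metis UNIV_I injI)+
  have cont: "continuous_on UNIV f" "continuous_on UNIV g"
    using f g orientation_homeos_continuous by blast+
  have "orientation_preserving_at (\<psi> \<circ> (f \<circ> g) \<circ> inv_into U \<phi>) (\<phi> p)"
    if U: "(U, \<phi>) \<in> Q" and V: "(V, \<psi>) \<in> Q" and p: "p \<in> U" "(f \<circ> g) p \<in> V" "\<phi> p \<in> interior (\<phi> ` U)" for U \<phi> V \<psi> p
  proof -
    \<comment> \<open>A chart around \<open>g p\<close> splits the composite into two coordinate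
      maps.\<close>
    obtain W \<xi> where W: "(W, \<xi>) \<in> Q" "g p \<in> W"
      by (rule atlas_chart[OF Q])
    note Ud = atlas_chartD[OF Q U] and Vd = atlas_chartD[OF Q V]
    define D where "D = interior (\<phi> ` U)"
    define G where "G = g \<circ> inv_into U \<phi>"
    have D: "D \<subseteq> \<phi> ` U" "open D"
      by (auto simp: D_def interior_subset[THEN subsetD])
    have G: "continuous_on D G" "inj_on G D" "open D" "\<phi> p \<in> D" "G (\<phi> p) = g p"
    proof -
      show "continuous_on D G"
        unfolding G_def
        by (rule continuous_on_compose[OF continuous_on_subset[OF Ud(4) D(1)] continuous_on_subset[OF cont(2)]]) simp
      show "inj_on G D"
        unfolding G_def
        by (rule comp_inj_on[OF inj_on_inv_into[OF D(1)] inj_on_subset[OF inj(2)]]) simp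
      show "open D" "\<phi> p \<in> D"
        using D(2) p(3) by (simp_all add: D_def)
      show "G (\<phi> p) = g p"
        using Ud(3) p(1) by (simp add: G_def)
    qed
    \<comment> \<open>The orientation condition for \<open>f\<close> is given at interior points
      only; \<open>g\<close> takes interior points to such points.\<close>
    have "\<xi> (g p) \<in> interior (\<xi> ` W)"
      using surface_image_interior[OF Q W(1) G(1-4)] G(5) W(2) by simp
    then have orient_f: "orientation_preserving_at (\<psi> \<circ> f \<circ> inv_into W \<xi>) (\<xi> (g p))"
      using p(2) by (intro orientation_homeosD[OF f W(1) V W(2)]) simp_all
    have orient_g: "orientation_preserving_at (\<xi> \<circ> g \<circ> inv_into U \<phi>) (\<phi> p)"
      by (rule orientation_homeosD[OF g U W(1) p(1) W(2) p(3)])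
    have "orientation_preserving_at ((\<psi> \<circ> f) \<circ> G) (\<phi> p)"
    proof (rule orientation_preserving_through_chart[OF Q W(1) G(1-4)])
      show "G (\<phi> p) \<in> W"
        using G(5) W(2) by simp
      show "continuous_on (f -` V) (\<psi> \<circ> f)"
        by (intro continuous_on_compose continuous_on_subset[OF cont(1)] continuous_on_subset[OF Vd(2)]) auto
      show "inj_on (\<psi> \<circ> f) (f -` V)"
        by (intro comp_inj_on inj_on_subset[OF inj(1)] inj_on_subset[OF Vd(3)]) auto
      show "open (f -` V)"
        by (rule open_vimage[OF Vd(1) cont(1)])
      show "G (\<phi> p) \<in> f -` V"
        using G(5) p(2) by simp
      show "orientation_preserving_at (\<xi> \<circ> G) (\<phi> p)"
        using orient_g by (simp add: G_def comp_assoc)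
      show "orientation_preserving_at (\<psi> \<circ> f \<circ> inv_into W \<xi>) (\<xi> (G (\<phi> p)))"
        using orient_f G(5) by simp
    qed
    then show ?thesis
      by (simp add: G_def comp_assoc)
  qed
  moreover have "\<exists>h. homeomorphism UNIV UNIV (f \<circ> g) h"
    using homeomorphism_compose[OF hom(2,1)] by blast
  moreover have "(f \<circ> g) ` P = P"
  proof -
    have "f ` P = P" "g ` P = P"
      using f g unfolding orientation_homeos_def by blast+
    then show ?thesis
      by (simp only: image_comp[symmetric])
  qed
  ultimately show ?thesis
    unfolding orientation_homeos_def by auto
qed

lemma induces_one:
  fixes Q :: "('a::t2_space set \<times> ('a \<Rightarrow> complex)) set"
  assumes "oriented_atlas Q"
  shows "induces Q P \<one>\<^bsub>mapping_class_group Q P\<^esub> id"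
proof -
  have "isotopic_homeos Q P id id"
    by (rule isotopic_homeos_refl[OF id_in_orientation_homeos[OF assms]])
  moreover have "f \<in> orientation_homeos Q P \<and> H1_map f = id" if "isotopic_homeos Q P id f" for f
    using isotopic_homeosD[OF that] by (simp add: H1_map_id)
  ultimately show ?thesis
    by (auto simp: induces_def mapping_class_group_def)
qed

lemma induces_mult:
  fixes Q :: "('a::t2_space set \<times> ('a \<Rightarrow> complex)) set"
  assumes Q: "oriented_atlas Q" and m: "induces Q P m \<Psi>" and n: "induces Q P n \<Omega>"
  shows "induces Q P (m \<otimes>\<^bsub>mapping_class_group Q P\<^esub> n) (\<Psi> \<circ> \<Omega>)"
proof -
  have "\<exists>f\<in>m. \<exists>g\<in>n. isotopic_homeos Q P (f \<circ> g) (f \<circ> g)"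
    using m n unfolding induces_def
    by (meson comp_in_orientation_homeos[OF Q] isotopic_homeos_refl ex_in_conv)
  moreover have "h \<in> orientation_homeos Q P \<and> H1_map h = \<Psi> \<circ> \<Omega>"
    if "f \<in> m" "g \<in> n" "isotopic_homeos Q P (f \<circ> g) h" for f g h
  proof -
    have "H1_map (f \<circ> g) = H1_map f \<circ> H1_map g"
      using m n that by (intro H1_map_comp orientation_homeos_continuous) (auto simp: induces_def)
    then show ?thesis
      using isotopic_homeosD[OF that(3)] m n that by (simp add: induces_def)
  qed
  ultimately show ?thesis
    unfolding induces_def mapping_class_group_def by fastforce
qed

text \<open>All members of an isotopy class act alike on homology, hence as the one explicit twist
  that the class contains.\<close>

lemma induces_dehn_twist:
  fixes Q :: "('a::t2_space set \<times> ('a \<Rightarrow> complex)) set"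
  assumes Q: "oriented_atlas Q" and T: "positive_dehn_twist Q P c T" and g: "parametrizes g c"
  shows "\<exists>F. crossing_form Q g c F \<and> induces Q P T (\<lambda>x. x + F x *\<^sub>R curve_class g)"
proof -
  obtain h where h: "h \<in> T" "left_twist_homeo Q P c h" and "T \<in> carrier (mapping_class_group Q P)"
    using T by (auto simp: positive_dehn_twist_def)
  then obtain f where T_def: "T = {k. isotopic_homeos Q P f k}"
    by (auto simp: mapping_class_group_def elim!: quotientE)
  have T: "k \<in> orientation_homeos Q P \<and> H1_map k = H1_map h" if "k \<in> T" for k
  proof -
    have iso: "isotopic_homeos Q P f k" "isotopic_homeos Q P f h"
      using that h(1) unfolding T_def by simp_all
    then show ?thesis
      using isotopic_homeosD(2,3)[OF iso(1)] isotopic_homeosD(3)[OF iso(2)] by simp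
  qed
  have "continuous_on UNIV h"
    using T[OF h(1)] orientation_homeos_continuous by blast
  from twist_action[OF Q h(2) this g]
  obtain F where F: "crossing_form Q g c F \<and> H1_map h = (\<lambda>x. x + F x *\<^sub>R curve_class g)" ..
  have "induces Q P T (H1_map h)"
    unfolding induces_def using T h(1) by blast
  then show ?thesis
    using F by (intro exI[of _ F]) simp
qed

text \<open>Induction over the list of twists. Components are disjoint, so each form vanishes on the
  classes of the others and the composite has no cross terms.\<close>

lemma induces_multitwist:
  fixes Q :: "('a::t2_space set \<times> ('a \<Rightarrow> complex)) set"
  assumes Q: "oriented_atlas Q" and T: "positive_multitwist Q P A T"
    and g: "\<And>c. c \<in> components A \<Longrightarrow> parametrizes (g c) c"
  shows "\<exists>F. (\<forall>c\<in>components A. crossing_form Q (g c) c (F c)) \<and>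
    induces Q P T (\<lambda>x. x + (\<Sum>c\<in>components A. F c x *\<^sub>R curve_class (g c)))"
proof -
  obtain cs ts where cs: "distinct cs" "set cs = components A"
    and ts: "list_all2 (positive_dehn_twist Q P) cs ts"
    and T_def: "T = foldr (\<lambda>t u. t \<otimes>\<^bsub>mapping_class_group Q P\<^esub> u) ts \<one>\<^bsub>mapping_class_group Q P\<^esub>"
    using T unfolding positive_multitwist_def by blast
  have "\<exists>F. (\<forall>c\<in>set cs. crossing_form Q (g c) c (F c)) \<and>
      induces Q P (foldr (\<lambda>t u. t \<otimes>\<^bsub>mapping_class_group Q P\<^esub> u) ts \<one>\<^bsub>mapping_class_group Q P\<^esub>)
        (\<lambda>x. x + (\<Sum>c\<in>set cs. F c x *\<^sub>R curve_class (g c)))"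
    if "distinct cs" "set cs \<subseteq> components A"
    using ts that
  proof (induction rule: list_all2_induct)
    case Nil
    show ?case
      using induces_one[OF Q, of P] by (simp add: id_def)
  next
    case (Cons c cs t ts)
    then have "\<exists>F. (\<forall>c\<in>set cs. crossing_form Q (g c) c (F c)) \<and>
      induces Q P (foldr (\<lambda>t u. t \<otimes>\<^bsub>mapping_class_group Q P\<^esub> u) ts \<one>\<^bsub>mapping_class_group Q P\<^esub>)
        (\<lambda>x. x + (\<Sum>c\<in>set cs. F c x *\<^sub>R curve_class (g c)))"
      by simp
    then obtain F where F_all: "(\<forall>c\<in>set cs. crossing_form Q (g c) c (F c)) \<and>
      induces Q P (foldr (\<lambda>t u. t \<otimes>\<^bsub>mapping_class_group Q P\<^esub> u) ts \<one>\<^bsub>mapping_class_group Q P\<^esub>)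
        (\<lambda>x. x + (\<Sum>c\<in>set cs. F c x *\<^sub>R curve_class (g c)))" ..
    note F = conjunct1[OF F_all] conjunct2[OF F_all]
    have c: "c \<in> components A" "c \<notin> set cs"
      using Cons.prems by auto
    from induces_dehn_twist[OF Q Cons.hyps(1) g[OF c(1)]]
    obtain Fc where Fc_all: "crossing_form Q (g c) c Fc \<and> induces Q P t (\<lambda>x. x + Fc x *\<^sub>R curve_class (g c))" ..
    note Fc = conjunct1[OF Fc_all] conjunct2[OF Fc_all]
    have lin: "linear Fc"
      using Fc(1) by (simp add: crossing_form_def)
    have zero: "Fc (curve_class (g d)) = 0" if "d \<in> set cs" for d
    proof -
      have d: "d \<in> components A" "d \<noteq> c"
        using that c Cons.prems by auto
      then have "d \<inter> c = {}"
        using components_nonoverlap[OF d(1) c(1)] by blast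
      then show ?thesis
        using Fc(1) g[OF d(1)] by (auto simp: crossing_form_def)
    qed
    define F' where "F' = F(c := Fc)"
    have F'_eq: "F' d = F d" if "d \<in> set cs" for d
      using that c(2) by (auto simp: F'_def)
    have "(\<lambda>x. x + Fc x *\<^sub>R curve_class (g c)) \<circ> (\<lambda>x. x + (\<Sum>c\<in>set cs. F c x *\<^sub>R curve_class (g c)))
        = (\<lambda>x. x + (\<Sum>d\<in>set (c # cs). F' d x *\<^sub>R curve_class (g d)))"
    proof
      fix x
      have "Fc (x + (\<Sum>c\<in>set cs. F c x *\<^sub>R curve_class (g c))) = Fc x"
        by (simp add: linear_add[OF lin] linear_sum[OF lin] linear_scale[OF lin] zero)
      moreover have "(\<Sum>d\<in>set cs. F' d x *\<^sub>R curve_class (g d)) = (\<Sum>d\<in>set cs. F d x *\<^sub>R curve_class (g d))"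
        by (rule sum.cong) (simp_all add: F'_eq)
      ultimately show "((\<lambda>x. x + Fc x *\<^sub>R curve_class (g c)) \<circ> (\<lambda>x. x + (\<Sum>c\<in>set cs. F c x *\<^sub>R curve_class (g c)))) x
          = x + (\<Sum>d\<in>set (c # cs). F' d x *\<^sub>R curve_class (g d))"
        using c(2) by (simp add: F'_def add_ac)
    qed
    moreover have "\<forall>d\<in>set (c # cs). crossing_form Q (g d) d (F' d)"
      using F(1) Fc(1) by (auto simp: F'_def)
    ultimately show ?case
      using induces_mult[OF Q Fc(2) F(2)] by (intro exI[of _ F'] conjI) simp_all
  qed
  then show ?thesis
    using cs T_def by simp
qed

section \<open>Disjoint curves\<close>

lemma geometric_intersection_eq_0:
  assumes "isotopic_curves P c c'" "isotopic_curves P d d'" "c' \<inter> d' = {}"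
  shows "geometric_intersection P c d = 0"
proof -
  have "0 \<in> {card (c' \<inter> d') | c' d'. isotopic_curves P c c' \<and> isotopic_curves P d d' \<and> finite (c' \<inter> d')}"
    using assms by (intro CollectI exI[of _ c'] exI[of _ d']) simp
  from cInf_lower[OF this bdd_below_bot] show ?thesis
    by (simp add: geometric_intersection_def)
qed

lemma isotopic_curves_refl:
  fixes c :: "'a::topological_space set"
  assumes "simple_closed_curve P c"
  shows "isotopic_curves P c c"
proof -
  obtain g h where gh: "homeomorphism unit_circle c g h" and c: "c \<subseteq> - P"
    using assms by (auto simp: simple_closed_curve_def parametrizes_def)
  have "homotopic_with_canon (\<lambda>f. inj_on f unit_circle) unit_circle (- P) g g"
    unfolding homotopic_with_refl
  proof
    show "continuous_map (top_of_set unit_circle) (top_of_set (- P)) g"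
      using gh c by (auto simp: homeomorphism_def continuous_map_in_subtopology)
    show "inj_on g unit_circle"
      using homeomorphism_apply1[OF gh] by (metis inj_onI)
  qed
  note hom = this
  show ?thesis
    unfolding isotopic_curves_def parametrizes_def
    by (intro exI[of _ g] conjI hom) (use gh in blast)+
qed

lemma (in embedded_annulus) parametrizes_circle:
  assumes "1 \<le> r" "r \<le> 2"
  shows "parametrizes (\<lambda>w. \<phi> (of_real r * w)) (\<phi> ` {z. norm z = r})"
  unfolding parametrizes_def
proof (intro exI, rule homeomorphismI)
  have ring: "of_real r * w \<in> closed_ring" if "w \<in> unit_circle" for w
    using that assms by (simp add: closed_ring_def norm_mult)
  show "continuous_on unit_circle (\<lambda>w. \<phi> (of_real r * w))"
    by (rule continuous_on_compose2[OF continuous_phi]) (use ring in \<open>auto intro!: continuous_intros\<close>)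
  have sub: "\<phi> ` {z. norm z = r} \<subseteq> \<phi> ` closed_ring"
    using assms by (auto simp: closed_ring_def)
  show "continuous_on (\<phi> ` {z. norm z = r}) (\<lambda>p. \<phi>' p / of_real r)"
    using assms by (intro continuous_intros continuous_on_subset[OF continuous_inv sub]) auto
  show "(\<lambda>w. \<phi> (of_real r * w)) ` unit_circle \<subseteq> \<phi> ` {z. norm z = r}"
    using assms by (auto simp: norm_mult)
  have inv: "\<phi>' (\<phi> z) = z" if "norm z = r" for z
    using that assms by (simp add: closed_ring_def)
  show "(\<lambda>p. \<phi>' p / of_real r) ` \<phi> ` {z. norm z = r} \<subseteq> unit_circle"
    using assms by (auto simp: inv norm_divide)
  show "\<phi>' (\<phi> (of_real r * w)) / of_real r = w" if "w \<in> unit_circle" for w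
    using ring[OF that] assms by simp
  show "\<phi> (of_real r * (\<phi>' p / of_real r)) = p" if "p \<in> \<phi> ` {z. norm z = r}" for p
    using that assms by (auto simp: inv)
qed

lemma (in embedded_annulus) isotopic_circles:
  assumes P: "\<phi> ` closed_ring \<subseteq> - P" and r: "1 \<le> r" "r \<le> 2" and s: "1 \<le> s" "s \<le> 2"
  shows "isotopic_curves P (\<phi> ` {z. norm z = r}) (\<phi> ` {z. norm z = s})"
proof -
  define h where "h z = \<phi> (of_real ((1 - fst z) * r + fst z * s) * snd z)" for z :: "real \<times> complex"
  have radius: "1 \<le> (1 - t) * r + t * s \<and> (1 - t) * r + t * s \<le> 2" if "t \<in> {0..1}" for t
    using convexD_alt[of "{1..2}" r s t] that r s by simp
  have ring: "of_real ((1 - t) * r + t * s) * w \<in> closed_ring" if "t \<in> {0..1}" "norm w = 1" for t w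
    using radius[OF that(1)] that(2) by (simp add: closed_ring_def norm_mult del: of_real_add of_real_mult)
  have "continuous_on ({0..1} \<times> unit_circle) h"
    unfolding h_def
    by (rule continuous_on_compose2[OF continuous_phi]) (use ring in \<open>auto intro!: continuous_intros\<close>)
  moreover have "h z \<in> - P" if "z \<in> {0..1} \<times> unit_circle" for z
    using subsetD[OF P imageI[OF ring[of "fst z" "snd z"]]] that by (simp add: h_def mem_Times_iff)
  then have "h ` ({0..1} \<times> unit_circle) \<subseteq> - P"
    by blast
  ultimately have "continuous_map (prod_topology (top_of_set {0..1}) (top_of_set unit_circle)) (top_of_set (- P)) h"
    by (simp add: prod_topology_subtopology_eu continuous_map_in_subtopology image_subset_iff_funcset)
  moreover have "inj_on (\<lambda>w. h (t, w)) unit_circle" if "t \<in> {0..1}" for t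
  proof (rule inj_onI)
    fix v w assume "v \<in> unit_circle" "w \<in> unit_circle" "h (t, v) = h (t, w)"
    then have "of_real ((1 - t) * r + t * s) * v = of_real ((1 - t) * r + t * s) * w"
      using ring[OF that] by (intro inj_onD[OF inj_phi]) (simp_all add: h_def)
    moreover have "(1 - t) * r + t * s \<noteq> 0"
      using radius[OF that] by linarith
    ultimately show "v = w"
      by (metis mult_cancel_left of_real_eq_0_iff)
  qed
  ultimately have "homotopic_with_canon (\<lambda>f. inj_on f unit_circle) unit_circle (- P)
      (\<lambda>w. \<phi> (of_real r * w)) (\<lambda>w. \<phi> (of_real s * w))"
    unfolding homotopic_with_def by (intro exI[of _ h]) (simp add: h_def)
  then show ?thesis
    unfolding isotopic_curves_def using parametrizes_circle r s by blast
qed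

text \<open>The twist annulus contains a parallel copy of \<open>c\<close>, the circle of radius
  7/4, isotopic to it and disjoint from it.\<close>

lemma geometric_self_intersection:
  fixes Q :: "('a::t2_space set \<times> ('a \<Rightarrow> complex)) set"
  assumes Q: "oriented_atlas Q" and "left_twist_homeo Q P c h"
  shows "geometric_intersection P c c = 0"
proof -
  obtain \<phi> \<phi>' where \<phi>: "embedded_annulus \<phi> \<phi>'" "\<phi> ` {z. norm z = 3 / 2} = c" "\<phi> ` closed_ring \<subseteq> - P"
    by (rule left_twist_annulus[OF assms]) blast
  interpret embedded_annulus \<phi> \<phi>' by (rule \<phi>(1))
  have "isotopic_curves P c c" "isotopic_curves P c (\<phi> ` {z. norm z = 7 / 4})"
    unfolding \<phi>(2)[symmetric] by (rule isotopic_circles[OF \<phi>(3)]; simp)+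
  moreover have "c \<inter> \<phi> ` {z. norm z = 7 / 4} = {}"
    unfolding \<phi>(2)[symmetric] core_set_def[symmetric] using core_set_iff by (auto simp: closed_ring_def)
  ultimately show ?thesis
    by (rule geometric_intersection_eq_0)
qed

section \<open>The Coxeter element of a bipartite graph\<close>

lemma linear_coxeter_form: "linear (coxeter_form m x)"
  unfolding coxeter_form_def
  by (rule linearI) (simp_all add: matrix_vector_right_distrib inner_add_right matrix_vector_mult_scaleR)

definition neighbour_sum :: "('n::finite \<Rightarrow> 'n \<Rightarrow> nat) \<Rightarrow> 'n \<Rightarrow> real ^ 'n \<Rightarrow> real"
  where "neighbour_sum m i x = (\<Sum>j\<in>UNIV. real (m i j) * x $ j)"

lemma coxeter_form_axis_left: "coxeter_form m (axis i 1) x = 2 * x $ i - neighbour_sum m i x"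
  by (simp add: coxeter_form_def inner_axis' matrix_vector_mult_diff_rdistrib scaleR_matrix_vector_assoc[symmetric])
    (simp add: neighbour_sum_def adjacency_matrix_def matrix_vector_mult_def)

text \<open>The product of the reflections in \<open>I\<close>, in the form that it takes when no
  two vertices of \<open>I\<close> are adjacent (\<open>word_reflection_commuting\<close>).\<close>

definition coxeter_half :: "('n::finite \<Rightarrow> 'n \<Rightarrow> nat) \<Rightarrow> 'n set \<Rightarrow> real ^ 'n \<Rightarrow> real ^ 'n"
  where "coxeter_half m I x = x - (\<Sum>i\<in>I. coxeter_form m (axis i 1) x *\<^sub>R axis i 1)"

text \<open>Distinct roots are orthogonal for the form, so subtracting multiples of the later ones
  does not alter the coefficient of the next.\<close>

lemma word_reflection_commuting:
  assumes "distinct v" and "\<And>i j. i \<in> set v \<Longrightarrow> j \<in> set v \<Longrightarrow> m i j = 0"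
  shows "word_reflection m v x = x - (\<Sum>i\<in>set v. coxeter_form m (axis i 1) x *\<^sub>R axis i 1)"
  using assms
proof (induction v)
  case Nil
  then show ?case by (simp add: word_reflection_def)
next
  case (Cons i v)
  define y where "y = (\<Sum>j\<in>set v. coxeter_form m (axis j 1) x *\<^sub>R axis j 1 :: real ^ 'a)"
  have "coxeter_form m (axis i 1) (axis j 1) = 0" if "j \<in> set v" for j
    using Cons.prems that by (auto simp: coxeter_form_axis)
  then have "coxeter_form m (axis i 1) y = 0"
    by (simp add: y_def linear_sum[OF linear_coxeter_form] linear_scale[OF linear_coxeter_form])
  then have "coxeter_form m (axis i 1) (x - y) = coxeter_form m (axis i 1) x"
    by (simp add: linear_diff[OF linear_coxeter_form])
  moreover have "word_reflection m v x = x - y"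
    unfolding y_def by (rule Cons.IH) (use Cons.prems in simp_all)
  ultimately have wr: "word_reflection m (i # v) x = x - y - coxeter_form m (axis i 1) x *\<^sub>R axis i 1"
    by (simp add: word_reflection_def coxeter_reflection_def)
  have sm: "(\<Sum>j\<in>set (i # v). coxeter_form m (axis j 1) x *\<^sub>R axis j 1) =
      coxeter_form m (axis i 1) x *\<^sub>R axis i 1 + y"
    using Cons.prems(1) by (simp add: y_def)
  show ?case
    unfolding wr sm by (simp add: algebra_simps)
qed

text \<open>The group product is a class of words, all with the same reflection product; it is
  evaluated on the concatenation of the two words chosen by
  \<open>generator_product\<close>.\<close>

lemma geometric_rep_product:
  assumes m: "small_type m" "\<And>i j. m i j = m j i" "\<And>i. m i i = 0"
    and I: "\<And>i j. i \<in> I \<Longrightarrow> j \<in> I \<Longrightarrow> m i j = 0" and J: "\<And>i j. i \<in> J \<Longrightarrow> j \<in> J \<Longrightarrow> m i j = 0"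
  shows "geometric_rep m (generator_product m I \<otimes>\<^bsub>coxeter_group m\<^esub> generator_product m J) = coxeter_half m I \<circ> coxeter_half m J"
proof -
  let ?S = "coxeter_half m"
  define v where "v I = (SOME v. distinct v \<and> set v = I)" for I :: "'a set"
  have v: "distinct (v I)" "set (v I) = I" for I
  proof -
    have "\<exists>v. distinct v \<and> set v = I"
      using finite_distinct_list[OF finite[of I]] by blast
    from someI_ex[OF this] show "distinct (v I)" "set (v I) = I"
      unfolding v_def by blast+
  qed
  have rep: "word_reflection m (v I) = ?S I" "word_reflection m (v J) = ?S J"
    using word_reflection_commuting[OF v(1), of I m] word_reflection_commuting[OF v(1), of J m] I J
    by (simp_all add: coxeter_half_def v(2) fun_eq_iff)
  have product: "generator_product m I \<otimes>\<^bsub>coxeter_group m\<^esub> generator_product m J =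
      {w. \<exists>a b. coxeter_equiv m (v I) a \<and> coxeter_equiv m (v J) b \<and> coxeter_equiv m (a @ b) w}"
    by (auto simp: coxeter_group_def generator_product_def v_def)
  have "word_reflection m w = ?S I \<circ> ?S J"
    if "coxeter_equiv m (v I) a" "coxeter_equiv m (v J) b" "coxeter_equiv m (a @ b) w" for a b w
    using word_reflection_cong[OF m that(1)] word_reflection_cong[OF m that(2)] word_reflection_cong[OF m that(3)] rep
    by (simp add: word_reflection_append)
  moreover have "v I @ v J \<in> generator_product m I \<otimes>\<^bsub>coxeter_group m\<^esub> generator_product m J"
    unfolding product using coxeter_equiv.refl by blast
  moreover have "f ` X = {c}" if "\<And>w. w \<in> X \<Longrightarrow> f w = c" "v \<in> X" for f :: "'a list \<Rightarrow> real ^ 'a \<Rightarrow> real ^ 'a" and X c v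
    using that by blast
  ultimately have "word_reflection m ` (generator_product m I \<otimes>\<^bsub>coxeter_group m\<^esub> generator_product m J) = {?S I \<circ> ?S J}"
    unfolding product by blast
  then show ?thesis
    by (simp add: geometric_rep_def)
qed

section \<open>Eigenvalues\<close>

text \<open>In the complexification the two equations are (c + \<i> b)(u + \<i> v) = p + \<i> q. The
  solution multiplies by the conjugate and divides by the squared modulus.\<close>

lemma complex_scaling_solution:
  fixes p q :: "'v::real_vector"
  assumes "c\<^sup>2 + b\<^sup>2 \<noteq> (0::real)"
  shows "c *\<^sub>R u - b *\<^sub>R v = p \<and> b *\<^sub>R u + c *\<^sub>R v = q \<longleftrightarrow>
    u = inverse (c\<^sup>2 + b\<^sup>2) *\<^sub>R (c *\<^sub>R p + b *\<^sub>R q) \<and> v = inverse (c\<^sup>2 + b\<^sup>2) *\<^sub>R (c *\<^sub>R q - b *\<^sub>R p)"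
    (is "?L \<longleftrightarrow> ?R")
proof
  assume ?L
  then have p: "p = c *\<^sub>R u - b *\<^sub>R v" and q: "q = b *\<^sub>R u + c *\<^sub>R v" by auto
  have "c *\<^sub>R p + b *\<^sub>R q = (c\<^sup>2 + b\<^sup>2) *\<^sub>R u" "c *\<^sub>R q - b *\<^sub>R p = (c\<^sup>2 + b\<^sup>2) *\<^sub>R v"
    unfolding p q by (simp_all add: algebra_simps power2_eq_square)
  then show ?R
    using assms by simp
next
  assume R: ?R
  define D where "D = c\<^sup>2 + b\<^sup>2"
  have "c *\<^sub>R u - b *\<^sub>R v = inverse D *\<^sub>R (D *\<^sub>R p)" "b *\<^sub>R u + c *\<^sub>R v = inverse D *\<^sub>R (D *\<^sub>R q)"
    unfolding conjunct1[OF R] conjunct2[OF R] D_def[symmetric]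
    by (simp_all add: algebra_simps power2_eq_square D_def)
  then show ?L
    using assms by (simp add: D_def)
qed

lemma complex_scaling_eq_0:
  fixes u v :: "'v::real_vector"
  assumes "c\<^sup>2 + b\<^sup>2 \<noteq> (0::real)" "c *\<^sub>R u - b *\<^sub>R v = 0" "b *\<^sub>R u + c *\<^sub>R v = 0"
  shows "u = 0" "v = 0"
  using complex_scaling_solution[OF assms(1), of u v 0 0] assms(2,3) by simp_all

text \<open>Stated for a family, as powers of a matrix may repeat; a repetition is itself a
  relation, with coefficients 1 and -1.\<close>

lemma linear_dependence:
  fixes f :: "nat \<Rightarrow> 'e::euclidean_space"
  obtains c n where "(\<Sum>k\<le>n. c k *\<^sub>R f k) = 0" "\<exists>k\<le>n. c k \<noteq> (0::real)"
proof (cases "inj_on f {..DIM('e)}")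
  case True
  then have "card (f ` {..DIM('e)}) = Suc DIM('e)"
    by (simp add: card_image)
  then have "dependent (f ` {..DIM('e)})"
    by (intro dependent_biggerset) auto
  then obtain u v where u: "v \<in> f ` {..DIM('e)}" "u v \<noteq> 0" "(\<Sum>v\<in>f ` {..DIM('e)}. u v *\<^sub>R v) = 0"
    by (auto simp: dependent_finite)
  have "(\<Sum>k\<le>DIM('e). u (f k) *\<^sub>R f k) = 0"
    using u(3) by (simp add: sum.reindex[OF True])
  moreover have "\<exists>k\<le>DIM('e). u (f k) \<noteq> 0"
    using u(1,2) by auto
  ultimately show ?thesis by (rule that)
next
  case False
  then obtain i j where ij: "i \<le> DIM('e)" "j \<le> DIM('e)" "i \<noteq> j" "f i = f j"
    by (auto simp: inj_on_def)
  define c where "c k = (if k = i then 1 else if k = j then - 1 else (0::real))" for k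
  have "(\<Sum>k\<le>DIM('e). c k *\<^sub>R f k) = (\<Sum>k\<in>{i, j}. c k *\<^sub>R f k)"
    by (rule sum.mono_neutral_right) (use ij in \<open>auto simp: c_def\<close>)
  also have "\<dots> = 0"
    using ij by (simp add: c_def)
  finally have "(\<Sum>k\<le>DIM('e). c k *\<^sub>R f k) = 0" .
  then show ?thesis
    by (rule that) (use ij(1) in \<open>auto simp: c_def\<close>)
qed

text \<open>Matrices form a finite-dimensional space, so some nontrivial polynomial annihilates
  \<open>L\<close>; every eigenvalue is a root of it.\<close>

lemma finite_complex_eigenvalues:
  fixes L :: "real ^ 'n \<Rightarrow> real ^ 'n"
  assumes L: "linear L"
  shows "finite {z. complex_eigenvalue L z}"
proof -
  have lin: "linear (L ^^ k)" for k
    by (induction k) (auto intro: linear_compose[OF _ L, unfolded comp_def] simp: linear_id id_def[symmetric])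
  obtain c n where c: "(\<Sum>k\<le>n. c k *\<^sub>R matrix (L ^^ k)) = 0" "\<exists>k\<le>n. c k \<noteq> 0"
    by (rule linear_dependence[of "\<lambda>k. matrix (L ^^ k)"]) blast
  have sum0: "(\<Sum>k\<le>n. c k *\<^sub>R (L ^^ k) x) = 0" for x
  proof -
    have "(\<Sum>k\<le>n. c k *\<^sub>R matrix (L ^^ k)) *v x = (\<Sum>k\<le>n. (c k *\<^sub>R matrix (L ^^ k)) *v x)"
      by (induction n) (simp_all add: matrix_vector_mult_add_rdistrib)
    also have "\<dots> = (\<Sum>k\<le>n. c k *\<^sub>R (L ^^ k) x)"
      by (simp add: scaleR_matrix_vector_assoc[symmetric] fun_cong[OF matrix_vector_mul(2)[OF lin]])
    finally show ?thesis
      using c(1) by simp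
  qed
  have "(\<Sum>k\<le>n. complex_of_real (c k) * z ^ k) = 0" if ev: "complex_eigenvalue L z" for z
  proof (rule ccontr)
    assume "(\<Sum>k\<le>n. complex_of_real (c k) * z ^ k) \<noteq> 0"
    define p where "p = (\<Sum>k\<le>n. complex_of_real (c k) * z ^ k)"
    obtain u v where uv: "u \<noteq> 0 \<or> v \<noteq> 0" "L u = Re z *\<^sub>R u - Im z *\<^sub>R v" "L v = Im z *\<^sub>R u + Re z *\<^sub>R v"
      using ev unfolding complex_eigenvalue_def by blast
    \<comment> \<open>The equation L^k w = z^k w for w = u + \<i> v, separated into real and
      imaginary parts.\<close>
    have pow: "(L ^^ k) u = Re (z ^ k) *\<^sub>R u - Im (z ^ k) *\<^sub>R v \<and> (L ^^ k) v = Im (z ^ k) *\<^sub>R u + Re (z ^ k) *\<^sub>R v" for k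
    proof (induction k)
      case (Suc k)
      have "(L ^^ Suc k) u = L (Re (z ^ k) *\<^sub>R u - Im (z ^ k) *\<^sub>R v)"
        "(L ^^ Suc k) v = L (Im (z ^ k) *\<^sub>R u + Re (z ^ k) *\<^sub>R v)"
        using Suc by simp_all
      then show ?case
        by (simp add: linear_add[OF L] linear_diff[OF L] linear_scale[OF L] uv(2,3) algebra_simps)
    qed simp
    have parts: "Re p = (\<Sum>k\<le>n. c k * Re (z ^ k))" "Im p = (\<Sum>k\<le>n. c k * Im (z ^ k))"
      by (simp_all add: p_def)
    have "(\<Sum>k\<le>n. c k *\<^sub>R (L ^^ k) u) = (\<Sum>k\<le>n. (c k * Re (z ^ k)) *\<^sub>R u - (c k * Im (z ^ k)) *\<^sub>R v)"
      by (rule sum.cong) (simp_all add: conjunct1[OF pow] scaleR_diff_right)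
    also have "\<dots> = Re p *\<^sub>R u - Im p *\<^sub>R v"
      by (simp only: parts sum_subtractf scaleR_sum_left)
    finally have "Re p *\<^sub>R u - Im p *\<^sub>R v = 0"
      by (simp add: sum0)
    moreover have "(\<Sum>k\<le>n. c k *\<^sub>R (L ^^ k) v) = (\<Sum>k\<le>n. (c k * Im (z ^ k)) *\<^sub>R u + (c k * Re (z ^ k)) *\<^sub>R v)"
      by (rule sum.cong) (simp_all add: conjunct2[OF pow] scaleR_add_right)
    then have "(\<Sum>k\<le>n. c k *\<^sub>R (L ^^ k) v) = Im p *\<^sub>R u + Re p *\<^sub>R v"
      by (simp only: parts sum.distrib scaleR_sum_left)
    then have "Im p *\<^sub>R u + Re p *\<^sub>R v = 0"
      by (simp add: sum0)
    moreover have "(Re p)\<^sup>2 + (Im p)\<^sup>2 \<noteq> 0"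
      using \<open>(\<Sum>k\<le>n. complex_of_real (c k) * z ^ k) \<noteq> 0\<close> unfolding p_def[symmetric]
      by (simp add: complex_eq_iff sum_power2_eq_zero_iff)
    ultimately show False
      using complex_scaling_eq_0[of "Re p" "Im p" u v] uv(1) by blast
  qed
  then have "{z. complex_eigenvalue L z} \<subseteq> {z. (\<Sum>k\<le>n. complex_of_real (c k) * z ^ k) = 0}"
    by blast
  moreover have "finite {z. (\<Sum>k\<le>n. complex_of_real (c k) * z ^ k) = 0}"
    using c(2) polyfun_finite_roots[of "\<lambda>k. complex_of_real (c k)" n] by simp
  ultimately show ?thesis
    by (rule finite_subset)
qed

text \<open>Rayleigh's principle, applied to the square of a self-adjoint map.\<close>

lemma self_adjoint_square_eigenvector:
  fixes A :: "'e::euclidean_space \<Rightarrow> 'e"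
  assumes A: "linear A" "\<And>x y. A x \<bullet> y = x \<bullet> A y" and "A \<noteq> (\<lambda>_. 0)"
  obtains l x where "0 < l" "x \<noteq> 0" "A (A x) = l *\<^sub>R x"
proof -
  have cont: "continuous_on S (\<lambda>x. A x \<bullet> A x)" for S
    by (intro continuous_intros linear_continuous_on linear_conv_bounded_linear[THEN iffD1] A(1))
  obtain y where y: "A y \<noteq> 0"
    using assms(3) by blast
  then have y0: "y \<noteq> 0"
    using linear_0[OF A(1)] by metis
  have "sphere (0::'e) 1 \<noteq> {}"
    using y0 by (auto intro: exI[of _ "sgn y"] simp: norm_sgn)
  then obtain x where x: "x \<in> sphere 0 1" "\<And>w. w \<in> sphere 0 1 \<Longrightarrow> A w \<bullet> A w \<le> A x \<bullet> A x"
    using continuous_attains_sup[OF compact_sphere _ cont] by blast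
  define l where "l = A x \<bullet> A x"
  have bound: "A w \<bullet> A w \<le> l * (w \<bullet> w)" for w
  proof (cases "w = 0")
    case True
    then show ?thesis by (simp add: linear_0[OF A(1)])
  next
    case False
    have "A (sgn w) \<bullet> A (sgn w) \<le> l"
      unfolding l_def using False by (intro x(2)) (simp add: norm_sgn)
    then have "(A w \<bullet> A w) / (norm w)\<^sup>2 \<le> l"
      by (simp add: sgn_div_norm linear_scale[OF A(1)] power2_eq_square field_simps)
    then show ?thesis
      using False by (simp add: divide_le_eq power2_norm_eq_inner)
  qed
  have "0 < A y \<bullet> A y"
    using y by simp
  then have "0 < l * (y \<bullet> y)"
    using bound[of y] by linarith
  then have l: "0 < l"
    by (rule zero_less_mult_pos2) (use y0 in simp)
  have xx: "x \<bullet> x = 1"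
    using x(1) by (simp add: norm_eq_1)
  \<comment> \<open>The residual of the eigenvalue equation. Were it nonzero, a small step from the
    maximizer \<open>x\<close> against \<open>d\<close> would violate \<open>bound\<close>.\<close>
  define d where "d = l *\<^sub>R x - A (A x)"
  have "d \<bullet> d = 0"
  proof (rule ccontr)
    assume "d \<bullet> d \<noteq> 0"
    then have dd: "0 < d \<bullet> d" by (simp add: inner_gt_zero_iff)
    have ineq: "0 \<le> l * (w \<bullet> w) - A w \<bullet> A w" for w
      using bound[of w] by simp
    have lin: "l * (x \<bullet> d) - A x \<bullet> A d = d \<bullet> d"
    proof -
      have "d \<bullet> d = (l *\<^sub>R x - A (A x)) \<bullet> d"
        by (simp only: d_def)
      then show ?thesis
        by (simp add: inner_diff_left A(2)[of "A x" d])
    qed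
    define C where "C = l * (d \<bullet> d) - A d \<bullet> A d"
    have quad: "0 \<le> - 2 * t * (d \<bullet> d) + t\<^sup>2 * C" for t
    proof -
      have "l * ((x - t *\<^sub>R d) \<bullet> (x - t *\<^sub>R d)) - A (x - t *\<^sub>R d) \<bullet> A (x - t *\<^sub>R d) =
          (l * (x \<bullet> x) - A x \<bullet> A x) - 2 * t * (l * (x \<bullet> d) - A x \<bullet> A d) + t\<^sup>2 * C"
        by (simp add: linear_diff[OF A(1)] linear_scale[OF A(1)] C_def inner_diff_left inner_diff_right
            inner_commute algebra_simps power2_eq_square)
      then show ?thesis
        using ineq[of "x - t *\<^sub>R d"] by (simp add: lin xx l_def[symmetric])
    qed
    have C: "0 \<le> C"
      using ineq[of d] by (simp add: C_def)
    \<comment> \<open>Small enough for the linear term of \<open>quad\<close> to outweigh the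
      quadratic one; adding 1 avoids division by 0.\<close>
    define t where "t = (d \<bullet> d) / (C + 1)"
    have t: "0 < t" "t * (C + 1) = d \<bullet> d"
      using dd C by (simp_all add: t_def)
    have "t * C < 2 * (d \<bullet> d)"
      using t(1) dd t(2)[unfolded distrib_left mult_1_right] by linarith
    then have "t * (t * C) < t * (2 * (d \<bullet> d))"
      using t(1) by (rule mult_strict_left_mono)
    then show False
      using quad[of t] by (simp add: power2_eq_square algebra_simps)
  qed
  then have "A (A x) = l *\<^sub>R x"
    by (simp add: d_def)
  moreover have "x \<noteq> 0"
    using xx by auto
  ultimately show ?thesis
    using that l by blast
qed

text \<open>The roots have product 1 and sum 2 - l. For \<open>4 \<le> l\<close> they are real and
  the smaller one is at most -1; otherwise they are conjugate on the unit circle.\<close>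

lemma reciprocal_root:
  assumes "0 < l"
  obtains z :: complex where "z\<^sup>2 - (2 - of_real l) * z + 1 = 0" "z \<noteq> 1" "1 \<le> norm z"
proof (cases "4 \<le> l")
  case True
  define q where "q = sqrt ((2 - l)\<^sup>2 - 4)"
  define r where "r = ((2 - l) - q) / 2"
  have "2\<^sup>2 \<le> (l - 2)\<^sup>2"
    using True by (intro power_mono) simp_all
  then have nonneg: "0 \<le> (2 - l)\<^sup>2 - 4"
    by (simp add: power2_commute)
  have "0 \<le> q"
    unfolding q_def by (rule real_sqrt_ge_zero[OF nonneg])
  then have r: "r \<le> - 1"
    using True by (simp add: r_def)
  have "(2 * r - (2 - l))\<^sup>2 = (2 - l)\<^sup>2 - 4"
  proof -
    have "2 * r - (2 - l) = - q"
      by (simp add: r_def field_simps)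
    then show ?thesis
      using nonneg by (simp add: q_def)
  qed
  then have root: "r\<^sup>2 - (2 - l) * r + 1 = 0"
    by (simp add: power2_eq_square algebra_simps)
  have "complex_of_real (r\<^sup>2 - (2 - l) * r + 1) = 0"
    by (simp only: root of_real_0)
  then have "(of_real r)\<^sup>2 - (2 - of_real l) * of_real r + 1 = (0::complex)"
    by (simp only: of_real_diff of_real_add of_real_mult of_real_power of_real_1 of_real_numeral)
  then show ?thesis
    by (rule that) (use r in \<open>auto simp: complex_eq_iff\<close>)
next
  case False
  define b where "b = sqrt (4 - (2 - l)\<^sup>2) / 2"
  have "(2 - l)\<^sup>2 < 2\<^sup>2"
  proof -
    have "0 < l * (4 - l)"
      using assms False by simp
    then show ?thesis
      by (simp add: power2_eq_square algebra_simps)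
  qed
  then have b: "0 < b" "b\<^sup>2 = (4 - (2 - l)\<^sup>2) / 4"
    by (simp_all add: b_def power_divide)
  define z where "z = Complex ((2 - l) / 2) b"
  have "z\<^sup>2 - (2 - of_real l) * z + 1 = 0"
    using b(2) by (simp add: z_def complex_eq_iff power2_eq_square field_simps)
  moreover have "(norm z)\<^sup>2 = 1"
    using b(2) by (simp add: z_def cmod_power2 power_divide field_simps)
  then have "norm z = 1"
    using norm_ge_zero[of z] unfolding power2_eq_1_iff by linarith
  moreover have "z \<noteq> 1"
    using b(1) by (auto simp: z_def complex_eq_iff)
  ultimately show ?thesis
    using that by simp
qed

section \<open>Transvections along a bipartite graph\<close>

lemma coxeter_half_nth:
  "coxeter_half m I x $ k = (if k \<in> I then neighbour_sum m k x - x $ k else x $ k)"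
proof -
  have "(\<Sum>i\<in>I. coxeter_form m (axis i 1) x *\<^sub>R axis i 1) $ k =
      (\<Sum>i\<in>I. if i = k then coxeter_form m (axis i 1) x else 0)"
    unfolding sum_component by (rule sum.cong) (auto simp: axis_def)
  also have "\<dots> = (if k \<in> I then coxeter_form m (axis k 1) x else 0)"
    by (simp add: sum.delta)
  finally show ?thesis
    by (simp add: coxeter_half_def coxeter_form_axis_left)
qed

text \<open>The linear algebra of the theorem, detached from the surface: \<open>I\<close> holds the
  vertices from A, \<open>cl\<close> the classes of the oriented curves, \<open>F\<close> their
  crossing forms. The sign in \<open>F_cl\<close> depends on the side of \<open>j\<close> alone,
  since edges join opposite sides.\<close>

locale bipartite_action =
  fixes m :: "'n::finite \<Rightarrow> 'n \<Rightarrow> nat" and I :: "'n set"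
    and cl :: "'n \<Rightarrow> 'v::real_vector" and F :: "'n \<Rightarrow> 'v \<Rightarrow> real"
  assumes sym: "m i j = m j i"
    and bipartite: "(i \<in> I) = (j \<in> I) \<Longrightarrow> m i j = 0"
    and linear_F: "linear (F i)"
    and F_cl: "F i (cl j) = (if j \<in> I then 1 else - 1) * real (m i j)"
    and edge: "\<exists>i j. m i j \<noteq> 0"
begin

text \<open>The signs are those of \<open>F_cl\<close>, so the forms pull back along
  \<open>eta\<close> to the rows of the adjacency matrix (\<open>F_eta\<close>).\<close>

definition eta :: "real ^ 'n \<Rightarrow> 'v"
  where "eta x = (\<Sum>i\<in>UNIV. ((if i \<in> I then 1 else - 1) * x $ i) *\<^sub>R cl i)"

definition transvection :: "'n set \<Rightarrow> 'v \<Rightarrow> 'v"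
  where "transvection J x = x + (\<Sum>i\<in>J. F i x *\<^sub>R cl i)"

definition adj :: "real ^ 'n \<Rightarrow> real ^ 'n"
  where "adj x = (\<chi> i. neighbour_sum m i x)"

definition proj :: "'n set \<Rightarrow> real ^ 'n \<Rightarrow> real ^ 'n"
  where "proj J x = (\<chi> i. if i \<in> J then x $ i else 0)"

text \<open>The two transvections in coordinates. The first one subtracts neighbour sums, because of
  the minus sign in \<open>eta\<close> on \<open>- I\<close>.\<close>

definition lift :: "real ^ 'n \<Rightarrow> real ^ 'n"
  where "lift x = (let y = x - proj (- I) (adj x) in y + proj I (adj y))"

lemma linear_eta: "linear eta"
  unfolding eta_def
  by (rule linearI) (simp_all add: algebra_simps sum.distrib scaleR_sum_right)

lemma linear_adj: "linear adj"
  by (rule linearI)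
    (simp_all add: adj_def neighbour_sum_def vec_eq_iff algebra_simps sum.distrib sum_distrib_left)

lemma linear_proj: "linear (proj J)"
  by (rule linearI) (simp_all add: proj_def vec_eq_iff)

lemma linear_lift: "linear lift"
  unfolding lift_def Let_def
  by (rule linearI)
    (simp_all add: linear_add[OF linear_adj] linear_add[OF linear_proj] linear_diff[OF linear_adj]
      linear_diff[OF linear_proj] linear_scale[OF linear_adj] linear_scale[OF linear_proj] algebra_simps)

lemma adj_symmetric: "adj x \<bullet> y = x \<bullet> adj y"
proof -
  have "adj x \<bullet> y = (\<Sum>i\<in>UNIV. \<Sum>j\<in>UNIV. real (m i j) * x $ j * y $ i)"
    by (simp add: inner_vec_def adj_def neighbour_sum_def sum_distrib_right)
  also have "\<dots> = (\<Sum>j\<in>UNIV. \<Sum>i\<in>UNIV. real (m i j) * x $ j * y $ i)"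
    by (rule sum.swap)
  also have "\<dots> = (\<Sum>j\<in>UNIV. \<Sum>i\<in>UNIV. x $ j * (real (m j i) * y $ i))"
    by (intro sum.cong) (simp_all add: sym[of _ "_ :: 'n"] mult_ac)
  also have "\<dots> = x \<bullet> adj y"
    by (simp add: inner_vec_def adj_def neighbour_sum_def sum_distrib_left)
  finally show ?thesis .
qed

text \<open>Only vertices on the side opposite to \<open>k\<close> enter its neighbour sum.\<close>

lemma adj_cong:
  assumes "\<And>j. (j \<in> I) \<noteq> (k \<in> I) \<Longrightarrow> x $ j = c * y $ j"
  shows "adj x $ k = c * adj y $ k"
proof -
  have "real (m k j) * x $ j = c * (real (m k j) * y $ j)" for j
    by (cases "(j \<in> I) = (k \<in> I)") (use assms[of j] bipartite[of k j] in auto)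
  then have "(\<Sum>j\<in>UNIV. real (m k j) * x $ j) = (\<Sum>j\<in>UNIV. c * (real (m k j) * y $ j))"
    by (rule sum.cong[OF HOL.refl])
  then show ?thesis
    by (simp add: adj_def neighbour_sum_def flip: sum_distrib_left)
qed

lemma F_eta: "F i (eta x) = adj x $ i"
proof -
  have "F i (eta x) = (\<Sum>j\<in>UNIV. ((if j \<in> I then 1 else - 1) * x $ j) * F i (cl j))"
    by (simp add: eta_def linear_sum[OF linear_F] linear_scale[OF linear_F])
  also have "\<dots> = (\<Sum>j\<in>UNIV. real (m i j) * x $ j)"
    by (rule sum.cong) (simp_all add: F_cl)
  finally show ?thesis
    by (simp add: adj_def neighbour_sum_def)
qed

lemma eta_proj:
  "eta (proj I y) = (\<Sum>i\<in>I. y $ i *\<^sub>R cl i)" "eta (proj (- I) y) = - (\<Sum>i\<in>- I. y $ i *\<^sub>R cl i)"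
proof -
  have "eta (proj I y) = (\<Sum>i\<in>UNIV. if i \<in> I then y $ i *\<^sub>R cl i else 0)"
    unfolding eta_def by (rule sum.cong) (simp_all add: proj_def)
  then show "eta (proj I y) = (\<Sum>i\<in>I. y $ i *\<^sub>R cl i)"
    by (simp add: sum.inter_filter[symmetric])
  have "eta (proj (- I) y) = (\<Sum>i\<in>UNIV. if i \<in> - I then - (y $ i *\<^sub>R cl i) else 0)"
    unfolding eta_def by (rule sum.cong) (simp_all add: proj_def)
  also have "\<dots> = (\<Sum>i\<in>- I. - (y $ i *\<^sub>R cl i))"
    by (subst sum.inter_filter[symmetric]) (simp_all add: Compl_eq)
  finally show "eta (proj (- I) y) = - (\<Sum>i\<in>- I. y $ i *\<^sub>R cl i)"
    by (simp add: sum_negf)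
qed

lemma transvections_eta: "transvection I (transvection (- I) (eta x)) = eta (lift x)"
proof -
  define y where "y = x - proj (- I) (adj x)"
  have y: "transvection (- I) (eta x) = eta y"
    by (simp add: transvection_def y_def F_eta linear_diff[OF linear_eta] eta_proj)
  have "transvection I (eta y) = eta (y + proj I (adj y))"
    by (simp add: transvection_def F_eta linear_add[OF linear_eta] eta_proj)
  then show ?thesis
    by (simp add: y lift_def Let_def y_def)
qed

text \<open>Each half negates the coordinates on its own side. After the first one, \<open>y\<close>
  and \<open>z\<close> differ by the sign on \<open>- I\<close>; all neighbours of \<open>I\<close>
  lie there, so the neighbour sums on \<open>I\<close> change sign as well.\<close>

lemma coxeter_halves: "coxeter_half m I (coxeter_half m (- I) x) = - lift x"
proof -
  define y where "y = coxeter_half m (- I) x"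
  define z where "z = x - proj (- I) (adj x)"
  have y: "y $ k = (if k \<in> I then x $ k else - z $ k)" and z: "k \<in> I \<Longrightarrow> z $ k = x $ k" for k
    by (simp_all add: y_def z_def coxeter_half_nth proj_def adj_def)
  have "coxeter_half m I y $ k = (- (z + proj I (adj z))) $ k" for k
  proof (cases "k \<in> I")
    case True
    then have "adj y $ k = - 1 * adj z $ k"
      by (intro adj_cong) (simp add: y)
    with True show ?thesis
      by (simp add: coxeter_half_nth proj_def y z) (simp add: adj_def)
  next
    case False
    then show ?thesis
      by (simp add: coxeter_half_nth proj_def y)
  qed
  then show ?thesis
    by (simp add: vec_eq_iff y_def[symmetric] lift_def z_def Let_def)
qed

lemma lift_kernel:
  assumes "eta x = 0"
  shows "lift x = x"
proof -
  have "adj x $ i = 0" for i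
    using F_eta[of i x] linear_0[OF linear_F] assms by simp
  then have "adj x = 0"
    by (simp add: vec_eq_iff)
  then show ?thesis
    by (simp add: lift_def linear_0[OF linear_proj])
qed

definition action :: "'v \<Rightarrow> 'v"
  where "action x = transvection I (transvection (- I) x)"

lemma action_eta: "action (eta x) = eta (lift x)"
  by (simp add: action_def transvections_eta)

lemma action_minus_id: "action x - x \<in> range eta"
proof -
  have sub: "subspace (range eta)"
    using linear_subspace_image[OF linear_eta subspace_UNIV] .
  have "cl i \<in> range eta" for i
  proof -
    have "eta (axis i 1) = (\<Sum>j\<in>UNIV. if j = i then (if i \<in> I then 1 else - 1) *\<^sub>R cl i else 0)"
      unfolding eta_def by (rule sum.cong) (auto simp: axis_def)
    then have "eta (axis i 1) = (if i \<in> I then 1 else - 1) *\<^sub>R cl i"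
      by simp
    then have "cl i = eta ((if i \<in> I then 1 else - 1) *\<^sub>R axis i 1)"
      by (simp add: linear_scale[OF linear_eta])
    then show ?thesis
      by blast
  qed
  then have *: "transvection J y - y \<in> range eta" for J y
    by (simp add: transvection_def subspace_sum[OF sub] subspace_scale[OF sub])
  have "action x - x = (transvection I (transvection (- I) x) - transvection (- I) x) + (transvection (- I) x - x)"
    by (simp add: action_def)
  then show ?thesis
    using subspace_add[OF sub *[of I "transvection (- I) x"] *[of "- I" x]] by simp
qed

lemma eigenvalue_distance:
  assumes "z \<noteq> 1"
  shows "(Re z - 1)\<^sup>2 + (Im z)\<^sup>2 \<noteq> 0"
  using assms by (simp add: sum_power2_eq_zero_iff complex_eq_iff)

text \<open>If \<open>eta\<close> killed the eigenvector, \<open>lift\<close> would fix it, contrary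
  to \<open>z \<noteq> 1\<close>.\<close>

lemma eigenvalue_lift_imp_action:
  assumes "complex_eigenvalue lift z" "z \<noteq> 1"
  shows "complex_eigenvalue action z"
proof -
  obtain u v where uv: "u \<noteq> 0 \<or> v \<noteq> 0" "lift u = Re z *\<^sub>R u - Im z *\<^sub>R v" "lift v = Im z *\<^sub>R u + Re z *\<^sub>R v"
    using assms(1) unfolding complex_eigenvalue_def by blast
  have "eta u \<noteq> 0 \<or> eta v \<noteq> 0"
  proof (rule ccontr)
    assume "\<not> (eta u \<noteq> 0 \<or> eta v \<noteq> 0)"
    then have "lift u = u" "lift v = v"
      using lift_kernel by blast+
    moreover have "(Re z - 1) *\<^sub>R u - Im z *\<^sub>R v = lift u - u" "Im z *\<^sub>R u + (Re z - 1) *\<^sub>R v = lift v - v"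
      by (simp_all add: uv(2,3) scaleR_left_diff_distrib)
    ultimately have "(Re z - 1) *\<^sub>R u - Im z *\<^sub>R v = 0" "Im z *\<^sub>R u + (Re z - 1) *\<^sub>R v = 0"
      by simp_all
    then show False
      using complex_scaling_eq_0[OF eigenvalue_distance[OF assms(2)], of u v] uv(1) by blast
  qed
  moreover have "action (eta u) = Re z *\<^sub>R eta u - Im z *\<^sub>R eta v" "action (eta v) = Im z *\<^sub>R eta u + Re z *\<^sub>R eta v"
    by (simp_all add: action_eta uv linear_diff[OF linear_eta] linear_add[OF linear_eta] linear_scale[OF linear_eta])
  ultimately show ?thesis
    unfolding complex_eigenvalue_def by blast
qed

text \<open>An eigenvector of \<open>action\<close> for \<open>z \<noteq> 1\<close> lies in the range of \<open>eta\<close>; as \<open>lift\<close> is the identity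
  on the kernel of \<open>eta\<close>, a preimage can be corrected to an eigenvector of \<open>lift\<close>.\<close>

lemma eigenvalue_action_imp_lift:
  assumes "complex_eigenvalue action z" "z \<noteq> 1"
  shows "complex_eigenvalue lift z"
proof -
  define c b where "c = Re z - 1" and "b = Im z"
  have D: "c\<^sup>2 + b\<^sup>2 \<noteq> 0"
    unfolding c_def b_def by (rule eigenvalue_distance[OF assms(2)])
  note solve = complex_scaling_solution[OF D]
  have sub: "subspace (range eta)"
    using linear_subspace_image[OF linear_eta subspace_UNIV] .
  obtain u v where uv: "u \<noteq> 0 \<or> v \<noteq> 0" "action u = Re z *\<^sub>R u - Im z *\<^sub>R v" "action v = Im z *\<^sub>R u + Re z *\<^sub>R v"
    using assms(1) unfolding complex_eigenvalue_def by blast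
  define p q where "p = action u - u" and "q = action v - v"
  have "c *\<^sub>R u - b *\<^sub>R v = p \<and> b *\<^sub>R u + c *\<^sub>R v = q"
    by (simp add: p_def q_def uv(2,3) c_def b_def scaleR_left_diff_distrib)
  then have "u = inverse (c\<^sup>2 + b\<^sup>2) *\<^sub>R (c *\<^sub>R p + b *\<^sub>R q)" "v = inverse (c\<^sup>2 + b\<^sup>2) *\<^sub>R (c *\<^sub>R q - b *\<^sub>R p)"
    unfolding solve by blast+
  moreover have "p \<in> range eta" "q \<in> range eta"
    unfolding p_def q_def by (rule action_minus_id)+
  ultimately have "u \<in> range eta" "v \<in> range eta"
    by (simp_all add: subspace_scale[OF sub] subspace_add[OF sub] subspace_diff[OF sub])
  then obtain x y where xy: "u = eta x" "v = eta y"
    by blast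
  \<comment> \<open>The failure of the preimage to be an eigenvector, an element of the kernel of
    \<open>eta\<close>.\<close>
  define k l where "k = lift x - (Re z *\<^sub>R x - Im z *\<^sub>R y)" and "l = lift y - (Im z *\<^sub>R x + Re z *\<^sub>R y)"
  have kl: "eta k = 0" "eta l = 0"
    using uv(2,3) unfolding xy action_eta
    by (simp_all add: k_def l_def linear_diff[OF linear_eta] linear_add[OF linear_eta] linear_scale[OF linear_eta])
  \<comment> \<open>The solution of (z - 1)(r + \<i> s) = k + \<i> l. It lies in the kernel, where
    \<open>lift\<close> is the identity, so adding it to the preimage cancels the failure.\<close>
  define r s where "r = inverse (c\<^sup>2 + b\<^sup>2) *\<^sub>R (c *\<^sub>R k + b *\<^sub>R l)" and "s = inverse (c\<^sup>2 + b\<^sup>2) *\<^sub>R (c *\<^sub>R l - b *\<^sub>R k)"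
  have rs: "c *\<^sub>R r - b *\<^sub>R s = k" "b *\<^sub>R r + c *\<^sub>R s = l"
    using solve[of r s k l] by (simp_all add: r_def s_def)
  have eta_rs: "eta r = 0" "eta s = 0"
    by (simp_all add: r_def s_def kl linear_diff[OF linear_eta] linear_add[OF linear_eta] linear_scale[OF linear_eta])
  have "lift (x + r) = lift x + r" "lift (y + s) = lift y + s"
    by (simp_all add: linear_add[OF linear_lift] lift_kernel eta_rs)
  moreover have "lift x = k + (Re z *\<^sub>R x - Im z *\<^sub>R y)" "lift y = l + (Im z *\<^sub>R x + Re z *\<^sub>R y)"
    by (simp_all add: k_def l_def)
  ultimately have "lift (x + r) = Re z *\<^sub>R (x + r) - Im z *\<^sub>R (y + s)" "lift (y + s) = Im z *\<^sub>R (x + r) + Re z *\<^sub>R (y + s)"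
    by (simp_all add: c_def b_def algebra_simps flip: rs)
  moreover have "x + r \<noteq> 0 \<or> y + s \<noteq> 0"
  proof -
    have "eta (x + r) = u" "eta (y + s) = v"
      by (simp_all add: linear_add[OF linear_eta] eta_rs xy)
    then show ?thesis
      using uv(1) linear_0[OF linear_eta] by metis
  qed
  ultimately show ?thesis
    unfolding complex_eigenvalue_def by blast
qed

lemma proj_adj:
  "proj I (adj x) = adj (proj (- I) x)" "proj (- I) (adj x) = adj (proj I x)"
proof -
  have "proj I (adj x) $ k = adj (proj (- I) x) $ k \<and> proj (- I) (adj x) $ k = adj (proj I x) $ k" for k
  proof (cases "k \<in> I")
    case True
    have "adj (proj (- I) x) $ k = 1 * adj x $ k"
      by (rule adj_cong) (use True in \<open>simp add: proj_def\<close>)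
    moreover have "adj (proj I x) $ k = 0 * adj x $ k"
      by (rule adj_cong) (use True in \<open>simp add: proj_def\<close>)
    ultimately show ?thesis
      using True by (simp add: proj_def)
  next
    case False
    have "adj (proj I x) $ k = 1 * adj x $ k"
      by (rule adj_cong) (use False in \<open>simp add: proj_def\<close>)
    moreover have "adj (proj (- I) x) $ k = 0 * adj x $ k"
      by (rule adj_cong) (use False in \<open>simp add: proj_def\<close>)
    ultimately show ?thesis
      using False by (simp add: proj_def)
  qed
  then show "proj I (adj x) = adj (proj (- I) x)" "proj (- I) (adj x) = adj (proj I x)"
    by (simp_all add: vec_eq_iff)
qed

text \<open>The squared adjacency map preserves both sides, so each part of an eigenvector is 0 or
  again an eigenvector. If the part on \<open>I\<close> vanishes, \<open>adj\<close> carries the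
  other part across.\<close>

lemma adj_square_eigenvector:
  obtains l p where "0 < l" "p \<noteq> 0" "proj I p = p" "proj (- I) p = 0" "adj (adj p) = l *\<^sub>R p"
proof -
  obtain i j where "m i j \<noteq> 0"
    using edge by blast
  then have "adj (axis j 1) $ i \<noteq> 0"
    by (simp add: adj_def neighbour_sum_def axis_def if_distrib[of "(*) _"] cong: if_cong)
  then have "adj \<noteq> (\<lambda>_. 0)"
    by (metis zero_index)
  then obtain l x where x: "0 < l" "x \<noteq> 0" "adj (adj x) = l *\<^sub>R x"
    using self_adjoint_square_eigenvector[OF linear_adj adj_symmetric] by metis
  have proj_idem: "proj I (proj I y) = proj I y" "proj (- I) (proj I y) = 0" for y
    by (simp_all add: proj_def vec_eq_iff)
  have sq: "adj (adj (proj J x)) = l *\<^sub>R proj J x" if "J = I \<or> J = - I" for J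
    using that x(3) proj_adj[of x] proj_adj[of "adj x"] by (auto simp: linear_scale[OF linear_proj])
  show ?thesis
  proof (cases "proj I x = 0")
    case False
    then show ?thesis
      using that[of l "proj I x"] x(1) sq[of I] proj_idem by simp
  next
    case True
    define p where "p = adj (proj (- I) x)"
    have "x = proj I x + proj (- I) x"
      by (simp add: proj_def vec_eq_iff)
    then have "proj (- I) x \<noteq> 0"
      using True x(2) by auto
    then have "adj p \<noteq> 0"
      using sq[of "- I"] x(1) by (simp add: p_def)
    then have "p \<noteq> 0"
      using linear_0[OF linear_adj] by auto
    moreover have "p = proj I (adj x)"
      by (simp add: p_def proj_adj)
    moreover have "adj (adj p) = l *\<^sub>R p"
      using sq[of "- I"] by (simp add: p_def linear_scale[OF linear_adj])
    ultimately show ?thesis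
      using that[of l p] x(1) proj_idem by simp
  qed
qed

text \<open>The plane spanned by \<open>p\<close> and \<open>q = adj p\<close> is invariant under
  \<open>lift\<close>, with trace 2 - l and determinant 1.\<close>

lemma large_eigenvalue:
  obtains z where "complex_eigenvalue lift z" "z \<noteq> 1" "1 \<le> norm z"
proof -
  obtain l p where l: "0 < l" and p: "p \<noteq> 0" "proj I p = p" "proj (- I) p = 0" "adj (adj p) = l *\<^sub>R p"
    by (rule adj_square_eigenvector)
  define q where "q = adj p"
  have q: "adj q = l *\<^sub>R p" "proj (- I) q = q" "proj I q = 0" "q \<noteq> 0"
    using p l proj_adj[of p] linear_0[OF linear_adj] by (auto simp: q_def)
  have lift_p: "lift p = (1 - l) *\<^sub>R p - q"
    by (simp add: lift_def Let_def q_def[symmetric] q p linear_diff[OF linear_adj] linear_diff[OF linear_proj]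
        linear_scale[OF linear_proj] algebra_simps)
  have lift_q: "lift q = q + l *\<^sub>R p"
    by (simp add: lift_def Let_def q p linear_scale[OF linear_proj])
  obtain z :: complex where z: "z\<^sup>2 - (2 - of_real l) * z + 1 = 0" "z \<noteq> 1" "1 \<le> norm z"
    by (rule reciprocal_root[OF l])
  define a b where "a = Re z" and "b = Im z"
  have re: "(1 - a) * (1 - l) + l = a * (1 - a) + b * b"
    using arg_cong[OF z(1), of Re] by (simp add: a_def b_def power2_eq_square algebra_simps)
  have im: "- b * (1 - l) = b * (1 - a) - a * b"
    using arg_cong[OF z(1), of Im] by (simp add: a_def b_def power2_eq_square algebra_simps)
  \<comment> \<open>The real and imaginary parts of the eigenvector (1 - z) p + q.\<close>
  define u v where "u = (1 - a) *\<^sub>R p + q" and "v = - b *\<^sub>R p"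
  have "lift u = (1 - a) *\<^sub>R lift p + lift q"
    by (simp only: u_def linear_add[OF linear_lift] linear_scale[OF linear_lift])
  also have "\<dots> = ((1 - a) * (1 - l) + l) *\<^sub>R p + a *\<^sub>R q"
    by (simp add: lift_p lift_q algebra_simps)
  also have "\<dots> = a *\<^sub>R u - b *\<^sub>R v"
    unfolding re by (simp add: u_def v_def algebra_simps)
  finally have "lift u = Re z *\<^sub>R u - Im z *\<^sub>R v"
    by (simp add: a_def b_def)
  moreover have "lift v = Im z *\<^sub>R u + Re z *\<^sub>R v"
  proof -
    have "lift v = - b *\<^sub>R ((1 - l) *\<^sub>R p - q)"
      by (simp only: v_def linear_scale[OF linear_lift] lift_p)
    also have "\<dots> = (- b * (1 - l)) *\<^sub>R p + b *\<^sub>R q"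
      by (simp only: scaleR_diff_right scaleR_scaleR scaleR_minus_left diff_minus_eq_add)
    also have "\<dots> = (b * (1 - a) - a * b) *\<^sub>R p + b *\<^sub>R q"
      by (simp only: im)
    also have "\<dots> = b *\<^sub>R ((1 - a) *\<^sub>R p + q) + a *\<^sub>R (- b *\<^sub>R p)"
      by (simp add: scaleR_add_right scaleR_left_diff_distrib[of "b * (1 - a)"])
    finally show ?thesis
      by (simp add: u_def v_def a_def b_def)
  qed
  moreover have "proj (- I) u = q"
    by (simp add: u_def linear_add[OF linear_proj] linear_scale[OF linear_proj] p q)
  then have "u \<noteq> 0"
    using q(4) linear_0[OF linear_proj] by auto
  ultimately have "complex_eigenvalue lift z"
    unfolding complex_eigenvalue_def by blast
  then show ?thesis
    using z that by blast
qed

lemma complex_eigenvalue_neg: "complex_eigenvalue (\<lambda>x. - L x) z \<longleftrightarrow> complex_eigenvalue L (- z)"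
  unfolding complex_eigenvalue_def by (simp add: minus_equation_iff[of "L _"] eq_commute[of _ "L _"])

lemma spectral_radius_eq: "spectral_radius_of (\<lambda>x. - lift x) = spectral_radius_of action"
proof -
  define S where "S = norm ` {z. complex_eigenvalue lift z}"
  define S' where "S' = norm ` {z. complex_eigenvalue action z}"
  have "norm ` {z. complex_eigenvalue (\<lambda>x. - lift x) z} = S"
  proof -
    have "{z. complex_eigenvalue (\<lambda>x. - lift x) z} = uminus ` {z. complex_eigenvalue lift z}"
      unfolding complex_eigenvalue_neg by (auto simp: image_iff intro: exI[of _ "- _"] minus_minus[symmetric])
    then show ?thesis
      by (simp add: S_def image_image)
  qed
  then have rad: "spectral_radius_of (\<lambda>x. - lift x) = Max S" "spectral_radius_of action = Max S'"
    by (simp_all add: spectral_radius_of_def S'_def)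
  have iff: "complex_eigenvalue action z \<longleftrightarrow> complex_eigenvalue lift z" if "z \<noteq> 1" for z
    using eigenvalue_action_imp_lift eigenvalue_lift_imp_action that by blast
  have fin: "finite {z. complex_eigenvalue lift z}"
    by (rule finite_complex_eigenvalues[OF linear_lift])
  \<comment> \<open>This makes the spectrum on homology finite, so that its \<open>Max\<close> is
    meaningful.\<close>
  have sub: "{z. complex_eigenvalue action z} \<subseteq> insert 1 {z. complex_eigenvalue lift z}"
    using iff by auto
  have "finite S" "finite S'"
    using fin finite_subset[OF sub] by (simp_all add: S_def S'_def)
  obtain z where z: "complex_eigenvalue lift z" "z \<noteq> 1" "1 \<le> norm z"
    by (rule large_eigenvalue)
  have zS: "norm z \<in> S" "norm z \<in> S'"
    using z iff by (auto simp: S_def S'_def)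
  have "s \<le> Max S'" if "s \<in> S" for s
  proof -
    obtain w where w: "s = norm w" "complex_eigenvalue lift w"
      using \<open>s \<in> S\<close> by (auto simp: S_def)
    show ?thesis
    proof (cases "w = 1")
      case True
      then show ?thesis
        using w z(3) Max_ge[OF \<open>finite S'\<close> zS(2)] by simp
    next
      case False
      then have "s \<in> S'"
        using w iff by (auto simp: S'_def)
      then show ?thesis
        by (rule Max_ge[OF \<open>finite S'\<close>])
    qed
  qed
  moreover have "s \<le> Max S" if "s \<in> S'" for s
  proof -
    obtain w where w: "s = norm w" "complex_eigenvalue action w"
      using \<open>s \<in> S'\<close> by (auto simp: S'_def)
    show ?thesis
    proof (cases "w = 1")
      case True
      then show ?thesis
        using w z(3) Max_ge[OF \<open>finite S\<close> zS(1)] by simp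
    next
      case False
      then have "s \<in> S"
        using w iff by (auto simp: S_def)
      then show ?thesis
        by (rule Max_ge[OF \<open>finite S\<close>])
    qed
  qed
  moreover have "Max S \<in> S" "Max S' \<in> S'"
    using Max_in[OF \<open>finite S\<close>] Max_in[OF \<open>finite S'\<close>] zS by blast+
  ultimately show ?thesis
    unfolding rad by (meson order_antisym)
qed

lemma eta_intertwines:
  "linear eta" "action \<circ> eta = (\<lambda>x. - eta ((coxeter_half m I \<circ> coxeter_half m (- I)) x))"
  "eta x = 0 \<Longrightarrow> (coxeter_half m I \<circ> coxeter_half m (- I)) x = - x"
  "spectral_radius_of (coxeter_half m I \<circ> coxeter_half m (- I)) = spectral_radius_of action"
proof -
  have eq: "coxeter_half m I \<circ> coxeter_half m (- I) = (\<lambda>x. - lift x)"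
    by (simp add: fun_eq_iff coxeter_halves)
  show "linear eta"
    by (rule linear_eta)
  show "action \<circ> eta = (\<lambda>x. - eta ((coxeter_half m I \<circ> coxeter_half m (- I)) x))"
    unfolding eq by (simp add: fun_eq_iff action_eta linear_neg[OF linear_eta])
  show "eta x = 0 \<Longrightarrow> (coxeter_half m I \<circ> coxeter_half m (- I)) x = - x"
    unfolding eq by (simp add: lift_kernel)
  show "spectral_radius_of (coxeter_half m I \<circ> coxeter_half m (- I)) = spectral_radius_of action"
    unfolding eq by (rule spectral_radius_eq)
qed

end

section \<open>From curves to the graph\<close>

lemma infinite_curve:
  assumes "parametrizes g c"
  shows "infinite c"
proof
  assume "finite c"
  have "inj_on (curve_path g) {0<..<1}"
  proof (rule inj_onI)
    fix s t :: real
    assume st: "s \<in> {0<..<1}" "t \<in> {0<..<1}" "curve_path g s = curve_path g t"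
    then obtain n :: int where n: "s - t = of_int n"
      using parametrizes_curve_path(3)[OF assms] by (auto elim: Ints_cases)
    then have "n = 0"
      using st by auto
    with n show "s = t" by simp
  qed
  moreover have "curve_path g ` {0<..<1} \<subseteq> c"
    using parametrizes_curve_path(2)[OF assms] by blast
  ultimately have "finite {0<..<1::real}"
    using \<open>finite c\<close> by (metis finite_imageD finite_subset)
  then show False
    by (simp add: infinite_Ioo)
qed

lemma twisted_component:
  assumes "positive_multitwist Q P A T" "c \<in> components A"
  obtains h where "left_twist_homeo Q P c h"
proof -
  obtain cs ts where "set cs = components A" "list_all2 (positive_dehn_twist Q P) cs ts"
    using assms(1) unfolding positive_multitwist_def by blast
  then obtain t where "positive_dehn_twist Q P c t"
    using assms(2) by (metis in_set_conv_nth list_all2_conv_all_nth)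
  then show ?thesis
    using that by (auto simp: positive_dehn_twist_def)
qed

text \<open>Filling is applied to \<open>c\<close> itself. The component that it yields is not
  \<open>c\<close>, which has a disjoint parallel copy, nor another component of \<open>A\<close>,
  which is disjoint from \<open>c\<close>.\<close>

lemma filling_meets_component:
  fixes Q :: "('a::t2_space set \<times> ('a \<Rightarrow> complex)) set"
  assumes Q: "oriented_atlas Q" and A: "essential_1_manifold P A" and TA: "positive_multitwist Q P A T"
    and meets: "\<And>d. essential_curve P d \<Longrightarrow> \<exists>e \<in> components A \<union> components B. geometric_intersection P d e \<noteq> 0"
    and c: "c \<in> components A"
  shows "\<exists>d \<in> components B. geometric_intersection P c d \<noteq> 0"
proof -
  have ess: "essential_curve P d" if "d \<in> components A" for d
    using A that by (simp add: essential_1_manifold_def)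
  obtain h where h: "left_twist_homeo Q P c h"
    by (rule twisted_component[OF TA c])
  have "geometric_intersection P c d = 0" if d: "d \<in> components A" for d
  proof (cases "d = c")
    case True
    then show ?thesis
      using geometric_self_intersection[OF Q h] by simp
  next
    case False
    then have "c \<inter> d = {}"
      using components_nonoverlap[OF c d] by blast
    moreover have "isotopic_curves P c c" "isotopic_curves P d d"
      using ess[OF c] ess[OF d] by (auto simp: essential_curve_def intro: isotopic_curves_refl)
    ultimately show ?thesis
      by (metis geometric_intersection_eq_0)
  qed
  note none = this
  obtain e where "e \<in> components A \<union> components B" "geometric_intersection P c e \<noteq> 0"
    using meets[OF ess[OF c]] ..
  then show ?thesis
    using none[of e] by auto
qed

theorem theorem8p2:
  fixes Q :: "('a::t2_space set \<times> ('a \<Rightarrow> complex)) set"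
    and P A B :: "'a set"
    and s :: "'n::finite \<Rightarrow> 'a set"
    and T_A T_B :: "('a \<Rightarrow> 'a) set"
  defines "MCG \<equiv> mapping_class_group Q P"
    and "G \<equiv> configuration_graph A B s"
  defines "\<sigma>_A \<equiv> generator_product G {i. s i \<in> components A}"
    and "\<sigma>_B \<equiv> generator_product G {i. s i \<in> components B}"
  defines "T \<equiv> induced_H1 (T_A \<otimes>\<^bsub>MCG\<^esub> T_B)"
    and "\<theta> \<equiv> geometric_rep G (\<sigma>_A \<otimes>\<^bsub>coxeter_group G\<^esub> \<sigma>_B)"
  assumes "marked_surface Q P"
    and "\<not> ((UNIV :: 'a set) homeomorphic (sphere 0 1 :: (real ^ 3) set) \<and> card P \<le> 3)"
    and "essential_1_manifold P A" and "essential_1_manifold P B"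
    and "transverse A B" and "minimal_position P A B"
    and "fills P A B"
    and "bij_betw s UNIV (components A \<union> components B)"
    and "small_type G"
    and "positively_orientable Q A B"
    and "positive_multitwist Q P A T_A" and "positive_multitwist Q P B T_B"
  shows "\<exists>\<eta> :: real ^ 'n \<Rightarrow> 'a real_H1.
    linear \<eta> \<and>
    T \<circ> \<eta> = (\<lambda>x. - \<eta> (\<theta> x)) \<and>
    (\<forall>x. \<eta> x = 0 \<longrightarrow> \<theta> x = - x) \<and>
    spectral_radius_of \<theta> = spectral_radius_of T"
proof -
  note surface = assms(7) and ess_A = assms(9) and ess_B = assms(10) and minimal = assms(12)
    and fills = assms(13) and bij = assms(14) and small = assms(15) and orientable = assms(16)
    and TA = assms(17) and TB = assms(18)
  have Q: "oriented_atlas Q"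
    using surface by (simp add: marked_surface_def)
  obtain g where g: "\<And>c. c \<in> components A \<union> components B \<Longrightarrow> parametrizes (g c) c"
    and crossing: "\<And>a b p. a \<in> components A \<Longrightarrow> b \<in> components B \<Longrightarrow> p \<in> a \<inter> b \<Longrightarrow> positive_crossing Q (g a) (g b) p"
    using orientable unfolding positively_orientable_def by metis
  define I where "I = {i. s i \<in> components A}"
  have fin: "finite (a \<inter> b)" if "a \<in> components A" "b \<in> components B" for a b
    using minimal that by (auto simp: minimal_position_def)
  \<comment> \<open>A common component would meet itself in infinitely many points, contrary to
    minimal position.\<close>
  have disjoint: "components A \<inter> components B = {}"
  proof (rule ccontr)
    assume "components A \<inter> components B \<noteq> {}"
    then obtain c where c: "c \<in> components A" "c \<in> components B" by blast
    then show False
      using fin[OF c] infinite_curve[OF g[of c]] by simp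
  qed
  have s_mem: "s i \<in> components A \<union> components B" for i
    using bij by (auto simp: bij_betw_def)
  have inj: "inj s"
    using bij by (simp add: bij_betw_def)
  have not_I: "- I = {i. s i \<in> components B}"
    using s_mem disjoint by (auto simp: I_def)
  have bij_A: "bij_betw s I (components A)" and bij_B: "bij_betw s (- I) (components B)"
  proof -
    have "s ` I = components A" "s ` (- I) = components B"
      using bij unfolding not_I by (auto simp: I_def bij_betw_def image_iff) (metis UnI1 UnI2 rangeE)+
    then show "bij_betw s I (components A)" "bij_betw s (- I) (components B)"
      using inj by (auto simp: bij_betw_def intro: inj_on_subset)
  qed
  have in_A: "s i \<in> components A" if "i \<in> I" for i
    using that by (simp add: I_def)
  have in_B: "s i \<in> components B" if "i \<notin> I" for i
    using that not_I by blast
  \<comment> \<open>Components of the same manifold are disjoint, so no third curve passes through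
    an intersection point.\<close>
  have G_edge: "G i j = card (s i \<inter> s j)" if ij: "i \<in> I" "j \<notin> I" for i j
  proof -
    have "{p \<in> A \<inter> B. {k. p \<in> s k} = {i, j}} = s i \<inter> s j"
    proof (intro equalityI subsetI)
      fix p assume p: "p \<in> s i \<inter> s j"
      then have "p \<in> A \<inter> B"
        using in_components_subset[OF in_A[OF ij(1)]] in_components_subset[OF in_B[OF ij(2)]] by blast
      moreover have "k \<in> {i, j}" if k: "p \<in> s k" for k
      proof (cases "k \<in> I")
        case True
        then have "s k = s i"
          using components_eq[OF in_A[OF True] in_A[OF ij(1)]] p k by blast
        then show ?thesis
          using inj by (simp add: inj_eq)
      next
        case False
        then have "s k = s j"
          using components_eq[OF in_B[OF False] in_B[OF ij(2)]] p k by blast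
        then show ?thesis
          using inj by (simp add: inj_eq)
      qed
      ultimately show "p \<in> {p \<in> A \<inter> B. {k. p \<in> s k} = {i, j}}"
        using p by blast
    qed blast
    then show ?thesis
      by (simp add: G_def configuration_graph_def)
  qed
  have G_sym: "G i j = G j i" for i j
    by (simp add: G_def configuration_graph_def insert_commute)
  have G_same: "G i j = 0" if same: "(i \<in> I) = (j \<in> I)" for i j
  proof -
    have "{k. p \<in> s k} \<noteq> {i, j}" if p: "p \<in> A \<inter> B" for p
    proof
      assume *: "{k. p \<in> s k} = {i, j}"
      have "p \<in> \<Union>(components A)" "p \<in> \<Union>(components B)"
        using p by simp_all
      then have "p \<in> \<Union>(s ` I)" "p \<in> \<Union>(s ` (- I))"
        using bij_A bij_B by (simp_all only: bij_betw_def)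
      then obtain k l where "k \<in> I" "p \<in> s k" "l \<notin> I" "p \<in> s l"
        by blast
      then have "k \<in> {i, j}" "l \<in> {i, j}" "k \<in> I" "l \<notin> I"
        using * by blast+
      then show False
        using same by auto
    qed
    then have "{p \<in> A \<inter> B. {k. p \<in> s k} = {i, j}} = {}"
      by blast
    then show ?thesis
      by (simp only: G_def configuration_graph_def card.empty)
  qed
  have edge: "\<exists>i j. G i j \<noteq> 0"
  proof -
    have "\<exists>a\<in>components A. \<exists>b\<in>components B. geometric_intersection P a b \<noteq> 0 \<or> geometric_intersection P b a \<noteq> 0"
    \<comment> \<open>\<open>undefined\<close> serves as an arbitrary vertex; there is one because
      types are nonempty.\<close>
    proof (cases "s undefined \<in> components A")
      case True
      then show ?thesis
        using filling_meets_component[OF Q ess_A TA _ True, of B] fills unfolding fills_def by blast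
    next
      case False
      then have b: "s undefined \<in> components B"
        using s_mem by blast
      have "\<exists>e \<in> components B \<union> components A. geometric_intersection P d e \<noteq> 0" if "essential_curve P d" for d
        using fills that unfolding fills_def by blast
      then show ?thesis
        using filling_meets_component[OF Q ess_B TB _ b, of A] b by blast
    qed
    then obtain a b where ab: "a \<in> components A" "b \<in> components B"
      "geometric_intersection P a b \<noteq> 0 \<or> geometric_intersection P b a \<noteq> 0" by blast
    have "a \<inter> b \<noteq> {}"
    proof
      assume "a \<inter> b = {}"
      moreover have "isotopic_curves P a a" "isotopic_curves P b b"
        using ess_A ess_B ab(1,2) by (auto simp: essential_1_manifold_def essential_curve_def intro: isotopic_curves_refl)
      ultimately show False
        using geometric_intersection_eq_0[of P a a b b] geometric_intersection_eq_0[of P b b a a] ab(3) by blast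
    qed
    then have "card (a \<inter> b) \<noteq> 0"
      using fin[OF ab(1,2)] by simp
    moreover have "a \<in> s ` I" "b \<in> s ` (- I)"
      using ab(1,2) bij_A bij_B by (simp_all only: bij_betw_def)
    then obtain i j where ij: "i \<in> I" "a = s i" "j \<notin> I" "b = s j"
      by blast
    ultimately have "G i j \<noteq> 0"
      using G_edge[OF ij(1,3)] by simp
    then show ?thesis by blast
  qed
  have "\<exists>F. (\<forall>c\<in>components A. crossing_form Q (g c) c (F c)) \<and>
      induces Q P T_A (\<lambda>x. x + (\<Sum>c\<in>components A. F c x *\<^sub>R curve_class (g c)))"
    by (rule induces_multitwist[OF Q TA]) (simp add: g)
  then obtain FA where FA: "\<forall>c\<in>components A. crossing_form Q (g c) c (FA c)"
    "induces Q P T_A (\<lambda>x. x + (\<Sum>c\<in>components A. FA c x *\<^sub>R curve_class (g c)))" by blast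
  have "\<exists>F. (\<forall>c\<in>components B. crossing_form Q (g c) c (F c)) \<and>
      induces Q P T_B (\<lambda>x. x + (\<Sum>c\<in>components B. F c x *\<^sub>R curve_class (g c)))"
    by (rule induces_multitwist[OF Q TB]) (simp add: g)
  then obtain FB where FB: "\<forall>c\<in>components B. crossing_form Q (g c) c (FB c)"
    "induces Q P T_B (\<lambda>x. x + (\<Sum>c\<in>components B. FB c x *\<^sub>R curve_class (g c)))" by blast
  define cl where "cl i = curve_class (g (s i))" for i
  define F where "F i = (if i \<in> I then FA (s i) else FB (s i))" for i
  have form: "crossing_form Q (g (s i)) (s i) (F i)" for i
    using FA(1) FB(1) in_A in_B by (auto simp: F_def)
  have param: "parametrizes (g (s i)) (s i)" for i
    by (rule g[OF s_mem])
  have F_self: "F i (cl i) = 0" for i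
    using form[of i] by (simp add: crossing_form_def cl_def)
  have F_disjoint: "F i (cl j) = 0" if "s j \<inter> s i = {}" for i j
    using form[of i] param[of j] that by (auto simp: crossing_form_def cl_def)
  have F_cross: "F i (cl j) = - t"
    if "s j \<inter> s i = {p}" "t \<in> {1, - 1}" "oriented_crossing Q (g (s i)) (g (s j)) t p" for i j p t
    using form[of i] param[of j] that unfolding crossing_form_def cl_def by blast
  have F_cl: "F i (cl j) = (if j \<in> I then 1 else - 1) * real (G i j)" for i j
  proof (cases "(i \<in> I) = (j \<in> I)")
    case True
    have "F i (cl j) = 0"
    proof (cases "i = j")
      case False
      then have "s i \<noteq> s j"
        using inj by (simp add: inj_eq)
      then have "s j \<inter> s i = {}"
        using True in_A[of i] in_A[of j] in_B[of i] in_B[of j] components_nonoverlap[of "s j" _ "s i"] by metis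
      then show ?thesis
        by (rule F_disjoint)
    qed (simp add: F_self)
    then show ?thesis
      using G_same[OF True] by simp
  next
    case False
    \<comment> \<open>The same two vertices with that of A first, the order in which the crossings
      are positive.\<close>
    define a b where "a = (if i \<in> I then i else j)" and "b = (if i \<in> I then j else i)"
    have ab: "a \<in> I" "b \<notin> I"
      using False by (auto simp: a_def b_def)
    have G_ij: "G i j = card (s a \<inter> s b)"
      using G_edge[OF ab] G_sym[of i j] by (auto simp: a_def b_def)
    \<comment> \<open>Small type enters here: a single crossing determines the value of the
      form.\<close>
    have "card (s a \<inter> s b) \<le> 1"
      using small G_edge[OF ab] by (metis small_type_def)
    then consider "s a \<inter> s b = {}" | p where "s a \<inter> s b = {p}"
      using fin[OF in_A[OF ab(1)] in_B[OF ab(2)]] by (metis card_0_eq card_1_singletonE le_less less_one)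
    then show ?thesis
    proof cases
      case 1
      then have "s j \<inter> s i = {}"
        by (auto simp: a_def b_def split: if_splits)
      then show ?thesis
        using 1 F_disjoint by (simp add: G_ij)
    next
      case (2 p)
      then have p: "s j \<inter> s i = {p}"
        by (auto simp: a_def b_def Int_commute split: if_splits)
      have pos: "positive_crossing Q (g (s a)) (g (s b)) p"
        using crossing[OF in_A[OF ab(1)] in_B[OF ab(2)]] 2 by blast
      show ?thesis
      proof (cases "i \<in> I")
        case True
        then have "oriented_crossing Q (g (s i)) (g (s j)) 1 p"
          using positive_crossing_imp_oriented[OF pos] by (simp add: a_def b_def)
        then have "F i (cl j) = - 1"
          by (rule F_cross[OF p, rotated]) simp
        then show ?thesis
          using True False 2 by (simp add: G_ij)
      next
        case not_in: False
        \<comment> \<open>Seen from the curve of B the same crossing is negative.\<close>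
        then have "oriented_crossing Q (g (s i)) (g (s j)) (- 1) p"
          using positive_crossing_imp_oriented_swap[OF Q pos] by (simp add: a_def b_def)
        then have "F i (cl j) = - (- 1)"
          by (rule F_cross[OF p, rotated]) simp
        then show ?thesis
          using not_in False 2 by (simp add: G_ij)
      qed
    qed
  qed
  interpret bipartite_action G I cl F
  proof (intro bipartite_action.intro)
    show "linear (F i)" for i
      using form[of i] by (simp add: crossing_form_def)
  qed (rule G_sym, erule G_same, rule F_cl, rule edge)
  have "induced_H1 (T_A \<otimes>\<^bsub>MCG\<^esub> T_B) = action"
  proof -
    have "(\<Sum>c\<in>components A. FA c x *\<^sub>R curve_class (g c)) = (\<Sum>i\<in>I. F i x *\<^sub>R cl i)" for x
      unfolding sum.reindex_bij_betw[OF bij_A, symmetric] by (rule sum.cong) (simp_all add: F_def cl_def)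
    moreover have "(\<Sum>c\<in>components B. FB c x *\<^sub>R curve_class (g c)) = (\<Sum>i\<in>- I. F i x *\<^sub>R cl i)" for x
      unfolding sum.reindex_bij_betw[OF bij_B, symmetric] by (rule sum.cong) (simp_all add: F_def cl_def)
    ultimately have "induces Q P T_A (transvection I)" "induces Q P T_B (transvection (- I))"
      using FA(2) FB(2) by (simp_all add: transvection_def[abs_def])
    from induced_H1_eq[OF induces_mult[OF Q this]] show ?thesis
      by (simp add: MCG_def action_def[abs_def] comp_def)
  qed
  then have T_eq: "T = action"
    by (simp add: T_def)
  have theta: "\<theta> = coxeter_half G I \<circ> coxeter_half G (- I)"
    unfolding \<theta>_def \<sigma>_A_def \<sigma>_B_def I_def[symmetric] not_I[symmetric]
    by (rule geometric_rep_product[OF small]) (simp_all add: G_same G_sym)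
  show ?thesis
    unfolding T_eq theta using eta_intertwines by blast
qed

end
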